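(* Let $1/2<\theta<1$ and let $\mathcal{B}$ be an infinite set of primes such that $\sum_{p\in\mathcal{B}} p^{-\sigma}<\infty$ for some $\sigma<\theta$. Let $k,u$ be fixed positive integers with $\gcd(k,u)=1$, and let $\bar u$ satisfy $u\bar u\equiv 1\pmod k$. Then, for all large positive integers $Q$, \begin{align*} \mathcal{M}_{2,\mathcal{B}}(u,k,Q)&=\frac{4Q^2}{\phi(k)\zeta(2)}\left[\log 2Q+2\gamma-\frac{\zeta'(2)}{\zeta(2)}-\frac{17}{8}+\sum_{\substack{p\in\mathcal{B}\\ p\nmid k}}\frac{p\log p}{p^2-1}+\sum_{p\mid k}\frac{p\log p}{p^2-1}\right]\prod_{\substack{p\in\mathcal{B}\\ p\nmid k}}\left(1+\frac1p\right)^{-1}\prod_{p\mid k}\left(1+\frac1p\right)^{-1}\\ &\quad+\frac{4Q^2}{\phi(k)}\sum_{\chi\neq\chi_0}\frac{\chi(\bar u)L(1,\chi)}{L(2,\chi)}\prod_{p\in\mathcal{B}}\left(1-\frac{\chi(p)}{p}\right)\left(1-\frac{\chi(p)}{p^2}\right)^{-1}+O_{k,\mathcal{B}}\left(Q^{1+\theta}(\log Q)^2\right), \end{align*} where the sum over $\chi\ne\chi_0$ runs over the non-principal Dirichlet characters modulo $k$.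
   Context: $\mathcal{F}_Q$ is the Farey sequence of order $Q$: the increasing sequence $1/Q=\gamma_1<\gamma_2<\dots<\gamma_{N}=1$ of all fractions $a/q$ in $(0,1]$ with $\gcd(a,q)=1$ and $0<a\le q\le Q$. Write $\gamma_i=a_i/q_i$ in lowest terms. The index of $\gamma_i$ is $\nu(\gamma_i)=\nu_Q(\gamma_i)=\frac{q_{i-1}+q_{i+1}}{q_i}$ (an integer), with the conventions $\nu_Q(\gamma_1)=1$ and $\nu_Q(\gamma_N)=2Q$. Given an infinite set $\mathcal{B}$ of integers greater than $1$, a positive integer is $\mathcal{B}$-free if it is divisible by no element of $\mathcal{B}$. For a positive integer $l$, \[\mathcal{M}_{l,\mathcal{B}}(u,k,Q)=\sum_{\substack{\gamma_i=b/s\in\mathcal{F}_Q\\ s\equiv u \pmod k\\ s\text{ is }\mathcal{B}\text{-free}}}\nu(\gamma_i)^l,\] where $b/s$ is in lowest terms. $\phi$ is Euler's totient function, $\zeta$ is the Riemann zeta function, $L(s,\chi)$ is the Dirichlet $L$-function, $\chi_0$ is the principal character modulo $k$, $\gamma$ (without subscript) is Euler's constant, and $p$ always denotes a prime. *)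

theory Defs
  imports "HOL-Analysis.Analysis" "HOL-Number_Theory.Number_Theory"
begin

section \<open>Farey sequences and their indices\<close>

definition farey_set :: "nat \<Rightarrow> rat set" where
  "farey_set Q = {of_nat a / of_nat q | a q. coprime a q \<and> 0 < a \<and> a \<le> q \<and> q \<le> Q}"

definition farey_length :: "nat \<Rightarrow> nat" where
  "farey_length Q = card (farey_set Q)"

text \<open>The terms are numbered from 1, so they are meaningful for \<open>1 \<le> i \<le> farey_length Q\<close>.\<close>

definition farey :: "nat \<Rightarrow> nat \<Rightarrow> rat" where
  "farey Q i = sorted_list_of_set (farey_set Q) ! (i - 1)"

text \<open>\<^const>\<open>quotient_of\<close> yields numerator and positive denominator in lowest terms.\<close>

definition farey_denom :: "nat \<Rightarrow> nat \<Rightarrow> nat" where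
  "farey_denom Q i = nat (snd (quotient_of (farey Q i)))"

text \<open>
  The two conventions at the ends collide only for \<open>Q = 1\<close>, where the sequence has a
  single term; the first convention is then used.
\<close>

definition farey_index :: "nat \<Rightarrow> nat \<Rightarrow> real" where
  "farey_index Q i =
     (if i = 1 then 1
      else if i = farey_length Q then 2 * real Q
      else (real (farey_denom Q (i - 1)) + real (farey_denom Q (i + 1))) / real (farey_denom Q i))"

definition B_free :: "nat set \<Rightarrow> nat \<Rightarrow> bool" where
  "B_free B n \<longleftrightarrow> n > 0 \<and> (\<forall>b\<in>B. \<not> b dvd n)"

definition farey_moment :: "nat \<Rightarrow> nat set \<Rightarrow> nat \<Rightarrow> nat \<Rightarrow> nat \<Rightarrow> real" where
  "farey_moment l B u k Q =
     (\<Sum>i | i \<in> {1..farey_length Q} \<and> [farey_denom Q i = u] (mod k) \<and> B_free B (farey_denom Q i).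
        farey_index Q i ^ l)"


section \<open>Dirichlet characters, L-functions and the zeta function\<close>

definition dirichlet_characters :: "nat \<Rightarrow> (int \<Rightarrow> complex) set" where
  "dirichlet_characters k =
     {\<psi>. (\<forall>n. \<psi> (n + int k) = \<psi> n) \<and>
          (\<forall>m n. \<psi> (m * n) = \<psi> m * \<psi> n) \<and>
          (\<forall>n. \<psi> n \<noteq> 0 \<longleftrightarrow> coprime n (int k))}"

definition principal_character :: "nat \<Rightarrow> int \<Rightarrow> complex" where
  "principal_character k n = (if coprime n (int k) then 1 else 0)"

text \<open>
  The Dirichlet series, with terms summed in the natural order.  For non-principal \<open>\<psi>\<close> it
  converges (conditionally if \<open>Re s \<le> 1\<close>) to the L-function whenever \<open>Re s > 0\<close>, which
  covers the points \<open>s = 1\<close> and \<open>s = 2\<close>.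
\<close>

definition dirichlet_L :: "(int \<Rightarrow> complex) \<Rightarrow> complex \<Rightarrow> complex" where
  "dirichlet_L \<psi> s = (\<Sum>n. \<psi> (int (Suc n)) / of_nat (Suc n) powr s)"

text \<open>
  This is the Riemann zeta function on the half-plane \<open>Re s > 1\<close> only; that is enough for
  its value and its derivative at \<open>2\<close>.
\<close>

definition zeta :: "complex \<Rightarrow> complex" where
  "zeta s = (\<Sum>n. 1 / of_nat (Suc n) powr s)"


section \<open>Products over sets of natural numbers\<close>

text \<open>
  Infinite product over \<open>A\<close>, taken in increasing order of the indices; the order is
  immaterial when the product converges absolutely.
\<close>

definition prod_over :: "nat set \<Rightarrow> (nat \<Rightarrow> complex) \<Rightarrow> complex" where
  "prod_over A f = (\<Prod>n. if n \<in> A then f n else 1)"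

end

theory Submission
  imports Defs "HOL-Complex_Analysis.Complex_Analysis"
begin

text \<open>
  Consecutive denominators \<open>q', q\<close> of the Farey sequence run exactly once through the coprime
  pairs with \<open>q, q' \<le> Q < q + q'\<close>, and the index of \<open>a/q\<close> is \<open>(Q + q') div q\<close>, which takes
  only the values \<open>t = 2Q div q\<close> and \<open>t - 1\<close>.  Counting coprime residues in an interval turns
  the second moment over the fractions with denominator \<open>q\<close> into
  \<open>\<phi>(q)/q * (q - 2Q + 2 \<Sum>j\<le>2Q/q. 2Q - q j)\<close>, up to \<open>O(Q / sqrt q)\<close>.

  The congruence condition is detected by Dirichlet characters \<open>\<psi>\<close>.  Since
  \<open>\<phi>(q)/q\<close> times the indicator of being \<open>\<B>\<close>-free is \<open>\<Prod>p|q. 1 + h p\<close> with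
  \<open>h p = -1\<close> on \<open>\<B>\<close> and \<open>h p = -1/p\<close> elsewhere, the sums over \<open>q\<close> become sums over squarefree
  \<open>d\<close> of \<open>h(d) \<psi>(d)\<close> times Riesz means of the divisor-type sums \<open>\<Sum>n\<le>x. \<Sum>d|n. \<psi> d\<close>.
  The latter are \<open>\<alpha> x ln x + \<beta> x + O(sqrt x)\<close> by the hyperbola method, and the error is
  summable against \<open>h\<close> because \<open>\<Sum>p\<in>\<B>. p powr -\<theta>\<close> converges.  The
  principal character contributes \<open>\<alpha> = 1\<close> and \<open>\<beta> = 2\<gamma> - 1\<close> (after adding the prime
  divisors of \<open>k\<close> to \<open>\<B>\<close>), the others \<open>\<alpha> = 0\<close> and \<open>\<beta> = L(1, \<psi>)\<close>; the
  remaining sums over \<open>d\<close> are Euler products.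
\<close>

section \<open>Sums over finite subsets and Euler products\<close>

text \<open>The terms \<open>2Q - q j\<close> depend only on \<open>n = q j\<close>, so a sum over
  \<open>q\<close> and \<open>j\<close> turns into a sum of
  \<open>(2Q - n) * (\<Sum>d|n. \<psi> d)\<close>. The linear factor is what integration of a
  summatory function produces, so an asymptotic formula for the divisor sums can be integrated
  directly, without partial summation. The difficulty is that \<open>h\<close> has absolute value 1
  on \<B> and does not decay there; only the exponent \<theta> < 1 tames it. Every error is
  therefore a pure power \<open>X powr \<kappa>\<close>: for \<open>X = y / d\<close> it splits into
  \<open>y powr \<kappa>\<close> and a product over the primes of \<open>d\<close>, and the sum over
  all \<open>d\<close> is bounded by an Euler product. To avoid cutting the sum at
  \<open>d = y\<close>, each estimate must hold for \<open>X < 1\<close> as well, where the sum is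
  empty and the main term has to be small by itself. Two errors of relative size \<open>sqrt\<close>
  occur, one from the hyperbola method and one from the count of coprime residues; \<theta> > 1/2
  covers both. The logarithm of \<open>y / d\<close> brings a factor \<open>ln d\<close> into the
  main term, and this is the origin of the logarithmic derivatives in the result.\<close>

lemma prod_one_plus_eq_sum_Pow:
  fixes g :: "'a \<Rightarrow> 'b :: comm_semiring_1"
  assumes "finite A"
  shows "(\<Prod>x\<in>A. 1 + g x) = (\<Sum>F\<in>Pow A. \<Prod>x\<in>F. g x)"
  using prod_add[OF assms, of g "\<lambda>_. 1"] by (simp add: add.commute)

text \<open>A finite family of finite subsets lies in the power set of its union \<open>U\<close>,
  and there the sum factors as \<open>\<Prod>p\<in>U. 1 + norm (g p)\<close>, which
  \<open>exp\<close> of the sum of all norms bounds.\<close>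

lemma abs_summable_on_Fpow_prod:
  fixes g :: "'a \<Rightarrow> 'b :: {real_normed_field}"
  assumes g: "(\<lambda>p. norm (g p)) summable_on A"
  shows "(\<lambda>F. norm (\<Prod>p\<in>F. g p)) summable_on Fpow A"
proof (rule nonneg_bdd_above_summable_on)
  show "bdd_above (sum (\<lambda>F. norm (\<Prod>p\<in>F. g p)) ` {F. F \<subseteq> Fpow A \<and> finite F})"
  proof (rule bdd_aboveI2)
    fix G assume G: "G \<in> {F. F \<subseteq> Fpow A \<and> finite F}"
    define U where "U = \<Union>G"
    have U: "finite U" "U \<subseteq> A" "G \<subseteq> Pow U"
      using G by (auto simp: U_def Fpow_def)
    have "(\<Sum>F\<in>G. norm (\<Prod>p\<in>F. g p)) \<le> (\<Sum>F\<in>Pow U. norm (\<Prod>p\<in>F. g p))"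
      by (intro sum_mono2) (use U in auto)
    also have "\<dots> = (\<Prod>p\<in>U. 1 + norm (g p))"
      using U by (simp add: prod_one_plus_eq_sum_Pow prod_norm)
    also have "\<dots> \<le> exp (\<Sum>p\<in>U. norm (g p))"
      by (rule prod_le_exp_sum) auto
    also have "\<dots> \<le> exp (\<Sum>\<^sub>\<infinity>p\<in>A. norm (g p))"
      using U g by (auto intro!: finite_sum_le_infsum)
    finally show "(\<Sum>F\<in>G. norm (\<Prod>p\<in>F. g p)) \<le> exp (\<Sum>\<^sub>\<infinity>p\<in>A. norm (g p))" .
  qed
qed auto

text \<open>The expanded form of the product of all \<open>1 + g p\<close>. Being an unordered sum,
  it can be split by membership of an element and interchanged with other sums; over the primes it
  is a series over squarefree numbers.\<close>

definition euler_sum :: "('a \<Rightarrow> complex) \<Rightarrow> 'a set \<Rightarrow> complex" where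
  "euler_sum g A = (\<Sum>\<^sub>\<infinity>F\<in>Fpow A. \<Prod>p\<in>F. g p)"

lemma has_sum_euler_sum:
  assumes "(\<lambda>p. norm (g p)) summable_on A"
  shows "((\<lambda>F. \<Prod>p\<in>F. g p) has_sum euler_sum g A) (Fpow A)"
  unfolding euler_sum_def
  using abs_summable_on_Fpow_prod[OF assms] abs_summable_summable by (intro has_sum_infsum) blast

text \<open>The partial products are the sums over the power sets of initial segments, and these
  power sets are cofinal among the finite subsets of \<open>Fpow A\<close>.\<close>

lemma euler_sum_LIMSEQ:
  fixes A :: "nat set"
  assumes g: "(\<lambda>p. norm (g p)) summable_on A"
  shows "(\<lambda>n. \<Prod>p\<in>{p\<in>A. p \<le> n}. 1 + g p) \<longlonglongrightarrow> euler_sum g A"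
proof -
  define S where "S n = Pow {p\<in>A. p \<le> n}" for n :: nat
  have "filterlim S (finite_subsets_at_top (Fpow A)) sequentially"
    unfolding filterlim_finite_subsets_at_top
  proof safe
    fix X :: "nat set set" assume X: "finite X" "X \<subseteq> Fpow A"
    have fin: "finite (\<Union>X)" using X by (auto simp: Fpow_def)
    show "\<forall>\<^sub>F y in sequentially. finite (S y) \<and> X \<subseteq> S y \<and> S y \<subseteq> Fpow A"
    \<comment> \<open>The inserted \<open>0\<close> keeps \<open>Max\<close> meaningful when
      \<open>\<Union>X\<close> is empty.\<close>
    proof (rule eventually_sequentiallyI[of "Max (insert 0 (\<Union>X))"])
      fix n assume "Max (insert 0 (\<Union>X)) \<le> n"
      then have "p \<le> n" if "p \<in> \<Union>X" for p using fin that by auto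
      then show "finite (S n) \<and> X \<subseteq> S n \<and> S n \<subseteq> Fpow A"
        using X by (auto simp: S_def Fpow_def finite_subset)
    qed
  qed
  with has_sum_euler_sum[OF g]
  have "(\<lambda>n. \<Sum>F\<in>S n. \<Prod>p\<in>F. g p) \<longlonglongrightarrow> euler_sum g A"
    unfolding has_sum_def by (rule filterlim_compose)
  then show ?thesis by (simp add: S_def prod_one_plus_eq_sum_Pow)
qed

lemma summable_on_Diff_real:
  fixes f :: "'a \<Rightarrow> real"
  shows "f summable_on A \<Longrightarrow> f summable_on A - X"
  by (rule summable_on_subset) auto

lemma Fpow_containing:
  assumes "p \<in> A"
  shows "{F \<in> Fpow A. p \<in> F} = insert p ` Fpow (A - {p})"
proof safe
  fix F assume "F \<in> Fpow A" "p \<in> F"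
  then have "F = insert p (F - {p})" "F - {p} \<in> Fpow (A - {p})" by (auto simp: Fpow_def)
  then show "F \<in> insert p ` Fpow (A - {p})" by blast
qed (use assms in \<open>auto simp: Fpow_def\<close>)

lemma has_sum_Fpow_containing:
  assumes g: "(\<lambda>p. norm (g p)) summable_on A" and p: "p \<in> A"
  shows "((\<lambda>F. \<Prod>q\<in>F. g q) has_sum g p * euler_sum g (A - {p})) {F \<in> Fpow A. p \<in> F}"
proof -
  have "((\<lambda>F. g p * (\<Prod>q\<in>F. g q)) has_sum g p * euler_sum g (A - {p})) (Fpow (A - {p}))"
    by (intro has_sum_cmult_right has_sum_euler_sum summable_on_Diff_real g)
  also have "?this \<longleftrightarrow> (((\<lambda>F. \<Prod>q\<in>F. g q) \<circ> insert p) has_sum g p * euler_sum g (A - {p})) (Fpow (A - {p}))"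
    by (intro has_sum_cong) (auto simp: Fpow_def intro!: prod.insert[symmetric])
  also have "\<dots> \<longleftrightarrow> ((\<lambda>F. \<Prod>q\<in>F. g q) has_sum g p * euler_sum g (A - {p})) (insert p ` Fpow (A - {p}))"
    by (rule has_sum_reindex[symmetric]) (auto simp: inj_on_def Fpow_def)
  also have "insert p ` Fpow (A - {p}) = {F \<in> Fpow A. p \<in> F}"
    by (rule Fpow_containing[OF p, symmetric])
  finally show ?thesis .
qed

text \<open>The finite subsets split into those that contain \<open>p\<close>, which contribute the
  factor \<open>g p\<close>, and those that avoid it.\<close>

lemma euler_sum_remove:
  assumes g: "(\<lambda>p. norm (g p)) summable_on A" and p: "p \<in> A"
  shows "euler_sum g A = (1 + g p) * euler_sum g (A - {p})"
proof -
  have "((\<lambda>F. \<Prod>q\<in>F. g q) has_sum (g p * euler_sum g (A - {p}) + euler_sum g (A - {p})))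
          ({F \<in> Fpow A. p \<in> F} \<union> Fpow (A - {p}))"
    by (intro has_sum_Un_disjoint has_sum_Fpow_containing has_sum_euler_sum g p summable_on_Diff_real)
       (auto simp: Fpow_def)
  also have "{F \<in> Fpow A. p \<in> F} \<union> Fpow (A - {p}) = Fpow A" by (auto simp: Fpow_def)
  finally show ?thesis
    using has_sum_euler_sum[OF g] has_sum_unique by (fastforce simp: algebra_simps)
qed

text \<open>
  For \<open>g p = a p * p powr -s\<close> and \<open>c p = ln p\<close> this is, up to sign, the logarithmic
  derivative in \<open>s\<close> of the Euler product \<open>\<Prod>p. 1 + g p\<close>.
\<close>

lemma has_sum_Fpow_prod_times_sum:
  fixes c :: "'a \<Rightarrow> real"
  assumes g: "(\<lambda>p. norm (g p)) summable_on A" and cg: "(\<lambda>p. \<bar>c p\<bar> * norm (g p)) summable_on A"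
    and nz: "\<And>p. p \<in> A \<Longrightarrow> 1 + g p \<noteq> 0"
  shows "((\<lambda>F. (\<Prod>p\<in>F. g p) * of_real (\<Sum>p\<in>F. c p)) has_sum
           euler_sum g A * (\<Sum>\<^sub>\<infinity>p\<in>A. of_real (c p) * g p / (1 + g p))) (Fpow A)"
proof -
  \<comment> \<open>The claim is an interchange in the sum of \<open>f\<close> over all pairs with
    \<open>p \<in> F\<close>: for fixed \<open>F\<close> the terms add up to the left side, for
    fixed \<open>p\<close> to a multiple of \<open>euler_sum g (A - {p})\<close>.\<close>
  define f where "f = (\<lambda>(p, F). of_real (c p) * (\<Prod>q\<in>F. g q))"
  define N where "N = (\<Sum>\<^sub>\<infinity>F\<in>Fpow A. norm (\<Prod>q\<in>F. g q))"
  have absF: "(\<lambda>F. norm (\<Prod>q\<in>F. g q)) summable_on Fpow A"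
    by (rule abs_summable_on_Fpow_prod[OF g])
  have abs: "(\<lambda>x. norm (f x)) summable_on (SIGMA p:A. {F \<in> Fpow A. p \<in> F})"
  proof (subst Infinite_Sum.abs_summable_on_Sigma_iff, intro conjI ballI)
    fix p assume p: "p \<in> A"
    have "(\<lambda>F. norm (\<Prod>q\<in>F. g q)) summable_on {F \<in> Fpow A. p \<in> F}"
      by (rule summable_on_subset[OF absF]) auto
    then show "(\<lambda>F. norm (f (p, F))) summable_on {F \<in> Fpow A. p \<in> F}"
      unfolding f_def by (simp add: norm_mult summable_on_cmult_right)
  next
    have "(\<lambda>p. \<bar>c p\<bar> * norm (g p) * N) summable_on A"
      by (intro summable_on_cmult_left cg)
    then show "(\<lambda>p. norm (infsum (\<lambda>F. norm (f (p, F))) {F \<in> Fpow A. p \<in> F})) summable_on A"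
    proof (rule summable_on_comparison_test)
      fix p assume p: "p \<in> A"
      have absp: "(\<lambda>F. norm (\<Prod>q\<in>F. g q)) summable_on Fpow (A - {p})"
        by (rule abs_summable_on_Fpow_prod[OF summable_on_Diff_real[OF g]])
      have "infsum (\<lambda>F. norm (f (p, F))) {F \<in> Fpow A. p \<in> F}
              = infsum ((\<lambda>F. norm (f (p, F))) \<circ> insert p) (Fpow (A - {p}))"
        unfolding Fpow_containing[OF p] by (rule infsum_reindex) (auto simp: inj_on_def Fpow_def)
      also have "\<dots> = infsum (\<lambda>F. \<bar>c p\<bar> * norm (g p) * norm (\<Prod>q\<in>F. g q)) (Fpow (A - {p}))"
      proof (rule infsum_cong)
        fix F assume F: "F \<in> Fpow (A - {p})"
        then have "prod g (insert p F) = g p * prod g F"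
          by (intro prod.insert) (auto simp: Fpow_def)
        then show "((\<lambda>F. norm (f (p, F))) \<circ> insert p) F = \<bar>c p\<bar> * norm (g p) * norm (\<Prod>q\<in>F. g q)"
          by (simp add: f_def norm_mult)
      qed
      also have "\<dots> = \<bar>c p\<bar> * norm (g p) * infsum (\<lambda>F. norm (\<Prod>q\<in>F. g q)) (Fpow (A - {p}))"
        by (rule infsum_cmult_right) (rule absp)
      also have "\<dots> \<le> \<bar>c p\<bar> * norm (g p) * N"
        unfolding N_def
        by (intro mult_left_mono infsum_mono_neutral absp absF) (auto simp: Fpow_def)
      finally show "norm (infsum (\<lambda>F. norm (f (p, F))) {F \<in> Fpow A. p \<in> F})
          \<le> \<bar>c p\<bar> * norm (g p) * N"
        by (simp add: infsum_nonneg)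
    qed auto
  qed
  have sm: "f summable_on (SIGMA p:A. {F \<in> Fpow A. p \<in> F})"
    using abs abs_summable_summable by blast
  define S where "S = infsum f (SIGMA p:A. {F \<in> Fpow A. p \<in> F})"
  have hs: "(f has_sum S) (SIGMA p:A. {F \<in> Fpow A. p \<in> F})"
    using sm by (simp add: S_def)
  have "((\<lambda>p. of_real (c p) * (g p * euler_sum g (A - {p}))) has_sum S) A"
  proof (rule has_sum_SigmaD[OF hs])
    fix p assume "p \<in> A"
    then show "((\<lambda>F. f (p, F)) has_sum of_real (c p) * (g p * euler_sum g (A - {p}))) {F \<in> Fpow A. p \<in> F}"
      unfolding f_def prod.case by (intro has_sum_cmult_right has_sum_Fpow_containing g)
  qed
  then have "S = (\<Sum>\<^sub>\<infinity>p\<in>A. of_real (c p) * (g p * euler_sum g (A - {p})))"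
    by (simp add: infsumI)
  \<comment> \<open>Removing \<open>p\<close> from the index set divides the Euler product by
    \<open>1 + g p\<close>.\<close>
  also have "\<dots> = (\<Sum>\<^sub>\<infinity>p\<in>A. euler_sum g A * (of_real (c p) * g p / (1 + g p)))"
    using nz by (intro infsum_cong) (simp add: euler_sum_remove[OF g])
  also have "\<dots> = euler_sum g A * (\<Sum>\<^sub>\<infinity>p\<in>A. of_real (c p) * g p / (1 + g p))"
    by (rule infsum_cmult_right')
  finally have S: "S = euler_sum g A * (\<Sum>\<^sub>\<infinity>p\<in>A. of_real (c p) * g p / (1 + g p))" .
  have bij: "bij_betw prod.swap (SIGMA F:Fpow A. F) (SIGMA p:A. {F \<in> Fpow A. p \<in> F})"
    by (rule bij_betwI[where g = prod.swap]) (auto simp: Fpow_def)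
  have hs': "((\<lambda>(F, p). of_real (c p) * (\<Prod>q\<in>F. g q)) has_sum S) (SIGMA F:Fpow A. F)"
    using hs has_sum_reindex_bij_betw[OF bij, of f S]
    by (simp add: f_def case_prod_unfold)
  have "((\<lambda>F. (\<Prod>p\<in>F. g p) * of_real (\<Sum>p\<in>F. c p)) has_sum S) (Fpow A)"
  proof (rule has_sum_SigmaD[OF hs'])
    fix F assume "F \<in> Fpow A"
    then have "finite F" by (auto simp: Fpow_def)
    then show "((\<lambda>p. case (F, p) of (F, p) \<Rightarrow> of_real (c p) * (\<Prod>q\<in>F. g q))
        has_sum (\<Prod>p\<in>F. g p) * of_real (\<Sum>p\<in>F. c p)) F"
      by (intro has_sum_finiteI) (auto simp: sum_distrib_left mult.commute)
  qed
  with S show ?thesis by simp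
qed

text \<open>
  The inverse is again an Euler product, with factors \<open>1 + g' p\<close> for \<open>g' = - g / (1 + g)\<close>.
\<close>

lemma euler_sum_nonzero:
  fixes A :: "nat set"
  assumes g: "(\<lambda>p. norm (g p)) summable_on A" and le: "\<And>p. p \<in> A \<Longrightarrow> norm (g p) \<le> 1 / 2"
  shows "euler_sum g A \<noteq> 0"
proof
  assume 0: "euler_sum g A = 0"
  define g' where "g' p = - g p / (1 + g p)" for p
  have n: "norm (1 + g p) \<ge> 1 / 2" if "p \<in> A" for p
    using le[OF that] norm_triangle_ineq2[of 1 "- g p"] by simp
  have "(\<lambda>p. 2 * norm (g p)) summable_on A"
    by (intro summable_on_cmult_right g)
  then have g': "(\<lambda>p. norm (g' p)) summable_on A"
  proof (rule summable_on_comparison_test)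
    fix p assume p: "p \<in> A"
    have "norm (g' p) = norm (g p) / norm (1 + g p)" by (simp add: g'_def norm_divide)
    also have "\<dots> \<le> norm (g p) / (1 / 2)"
      by (intro divide_left_mono n p mult_pos_pos less_le_trans[OF _ n[OF p]]) auto
    finally show "norm (g' p) \<le> 2 * norm (g p)" by simp
  qed auto
  have "(\<lambda>n. (\<Prod>p\<in>{p\<in>A. p \<le> n}. 1 + g p) * (\<Prod>p\<in>{p\<in>A. p \<le> n}. 1 + g' p))
          \<longlonglongrightarrow> euler_sum g A * euler_sum g' A"
    by (intro tendsto_mult euler_sum_LIMSEQ g g')
  moreover have "(\<Prod>p\<in>{p\<in>A. p \<le> n}. 1 + g p) * (\<Prod>p\<in>{p\<in>A. p \<le> n}. 1 + g' p) = 1" for n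
  proof -
    have "(1 + g p) * (1 + g' p) = 1" if "p \<in> A" for p
    proof -
      have "1 + g p \<noteq> 0" using n[OF that] by auto
      then show ?thesis by (simp add: g'_def field_simps)
    qed
    then show ?thesis by (simp flip: prod.distrib)
  qed
  ultimately have "(\<lambda>n::nat. 1 :: complex) \<longlonglongrightarrow> 0" using 0 by simp
  then show False by (simp add: LIMSEQ_const_iff)
qed

section \<open>Summation against multiplicative functions\<close>

abbreviation primes :: "nat set" where
  "primes \<equiv> {p. prime p}"

text \<open>The cutoff is real because ranges are rescaled to \<open>y / \<Prod>F\<close>; 0 is left
  out since the summands divide by \<open>n\<close>.\<close>

definition nats_upto :: "real \<Rightarrow> nat set" where
  "nats_upto x = {n. 0 < n \<and> real n \<le> x}"

lemma in_nats_upto_iff: "n \<in> nats_upto x \<longleftrightarrow> 0 < n \<and> real n \<le> x"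
  by (simp add: nats_upto_def)

lemma nats_upto_eq: "nats_upto x = {1..nat \<lfloor>x\<rfloor>}"
proof (rule Set.set_eqI, rule iffI)
  fix n assume "n \<in> {1..nat \<lfloor>x\<rfloor>}"
  then have "0 < n" "int n \<le> \<lfloor>x\<rfloor>" by auto
  then show "n \<in> nats_upto x" by (simp add: nats_upto_def le_floor_iff)
qed (auto simp: nats_upto_def le_nat_floor)

lemma finite_nats_upto [simp]: "finite (nats_upto x)"
  by (simp add: nats_upto_eq)

lemma nats_upto_of_nat: "nats_upto (real N) = {1..N}"
  by (simp add: nats_upto_eq)

lemma nats_upto_empty: "x < 1 \<Longrightarrow> nats_upto x = {}"
  by (auto simp: nats_upto_def)

lemma Prod_primes_pos:
  assumes "F \<in> Fpow primes"
  shows "\<Prod>F > (0::nat)"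
  using assms by (auto simp: Fpow_def intro!: prod_pos prime_gt_0_nat)

lemma subset_prime_factors_in_Fpow:
  "F \<subseteq> prime_factors q \<Longrightarrow> F \<in> Fpow primes"
  using finite_subset[of F "prime_factors q"] by (auto simp: Fpow_def)

text \<open>Distinct primes are coprime, so their product divides \<open>n\<close> as soon as each
  of them does. This translates squarefree divisors into subsets of
  \<open>prime_factors n\<close>.\<close>

lemma Prod_primes_dvd_iff:
  assumes "F \<in> Fpow primes" "n > 0"
  shows "\<Prod>F dvd n \<longleftrightarrow> F \<subseteq> prime_factors n"
proof
  assume "\<Prod>F dvd n"
  moreover have F: "finite F" "\<And>p. p \<in> F \<Longrightarrow> prime p" using assms by (auto simp: Fpow_def)
  moreover have "p dvd \<Prod>F" if "p \<in> F" for p using dvd_prodI[of F p "\<lambda>x. x"] F that by simp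
  ultimately have "p dvd n" if "p \<in> F" for p using that dvd_trans by blast
  then show "F \<subseteq> prime_factors n"
    using assms(2) F by (auto simp: prime_factors_dvd)
next
  assume F: "F \<subseteq> prime_factors n"
  have "finite F" "\<And>p. p \<in> F \<Longrightarrow> prime p" using assms by (auto simp: Fpow_def)
  then show "\<Prod>F dvd n"
    using F
  proof (induction F)
    case (insert p F)
    have "coprime p (\<Prod>F)"
      by (rule prod_coprime_right, rule primes_coprime) (use insert in auto)
    then show ?case
      using insert by (auto intro!: divides_mult)
  qed auto
qed

text \<open>
  Finite sets of primes stand for squarefree numbers.  Every \<open>q\<close> and \<open>F \<subseteq> prime_factors q\<close>
  correspond to a pair \<open>(F, n)\<close> with \<open>q = n * \<Prod>F\<close>.
\<close>

lemma has_sum_multiplicative: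
  fixes a h :: "nat \<Rightarrow> complex"
  assumes sm: "(\<lambda>(F, n). (\<Prod>p\<in>F. h p) * a (n * \<Prod>F)) summable_on Fpow primes \<times> {0<..}"
    and inner: "\<And>F. F \<in> Fpow primes \<Longrightarrow> ((\<lambda>n. a (n * \<Prod>F)) has_sum g F) {0<..}"
    and total: "((\<lambda>q. a q * (\<Prod>p\<in>prime_factors q. 1 + h p)) has_sum S) {0<..}"
  shows "((\<lambda>F. (\<Prod>p\<in>F. h p) * g F) has_sum S) (Fpow primes)"
proof -
  define f where "f = (\<lambda>(F, n). (\<Prod>p\<in>F. h p) * a (n * \<Prod>F))"
  define f' where "f' = (\<lambda>(q, F). (\<Prod>p\<in>F. h p) * a q)"
  define Y where "Y = (SIGMA q:{0::nat<..}. Pow (prime_factors q))"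
  have bij: "bij_betw (\<lambda>(F, n). (n * \<Prod>F, F)) (Fpow primes \<times> {0<..}) Y"
  proof (rule bij_betwI[where g = "\<lambda>(q, F). (F, q div \<Prod>F)"])
    have "(n * \<Prod>F, F) \<in> Y" if "F \<in> Fpow primes" "0 < n" for F n
    proof -
      have "n * \<Prod>F > 0" using that Prod_primes_pos[of F] by simp
      moreover from this have "F \<subseteq> prime_factors (n * \<Prod>F)"
        using that by (subst Prod_primes_dvd_iff[symmetric]) auto
      ultimately show ?thesis by (simp add: Y_def)
    qed
    then show "(\<lambda>(F, n). (n * \<Prod>F, F)) \<in> Fpow primes \<times> {0<..} \<rightarrow> Y" by auto
    have "(F, q div \<Prod>F) \<in> Fpow primes \<times> {0<..}" if "0 < q" "F \<subseteq> prime_factors q" for F q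
    proof -
      have F: "F \<in> Fpow primes"
        using that by (simp add: subset_prime_factors_in_Fpow)
      with that have "\<Prod>F dvd q" by (simp add: Prod_primes_dvd_iff)
      with that have "0 < q div \<Prod>F"
        using Prod_primes_pos[OF F] by (auto simp: div_greater_zero_iff intro: dvd_imp_le)
      with F show ?thesis by simp
    qed
    then show "(\<lambda>(q, F). (F, q div \<Prod>F)) \<in> Y \<rightarrow> Fpow primes \<times> {0<..}"
      by (auto simp: Y_def)
    show "(\<lambda>(q, F). (F, q div \<Prod>F)) ((\<lambda>(F, n). (n * \<Prod>F, F)) x) = x" if x0: "x \<in> Fpow primes \<times> {0<..}" for x
    proof -
      obtain F n where x: "x = (F, n)" "F \<in> Fpow primes" using x0 by (elim SigmaE)
      with Prod_primes_pos[of F] show ?thesis by simp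
    qed
    show "(\<lambda>(F, n). (n * \<Prod>F, F)) ((\<lambda>(q, F). (F, q div \<Prod>F)) x) = x" if x0: "x \<in> Y" for x
    proof -
      obtain q F where x: "x = (q, F)" "0 < q" "F \<subseteq> prime_factors q"
        using x0 unfolding Y_def by (elim SigmaE) (simp only: greaterThan_iff Pow_iff)
      then have "F \<in> Fpow primes" by (simp add: subset_prime_factors_in_Fpow)
      then have "\<Prod>F dvd q" using x by (simp add: Prod_primes_dvd_iff)
      then have "q div \<Prod>F * \<Prod>F = q" by (rule dvd_div_mult_self)
      then show ?thesis unfolding x(1) prod.case by simp
    qed
  qed
  have "f = f' \<circ> (\<lambda>(F, n). (n * \<Prod>F, F))" by (auto simp: f_def f'_def)
  then have ff': "(f has_sum T) (Fpow primes \<times> {0<..}) \<longleftrightarrow> (f' has_sum T) Y" for T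
    using has_sum_reindex_bij_betw[OF bij, of f' T] by (simp add: o_def)
  obtain T where T: "(f has_sum T) (Fpow primes \<times> {0<..})"
    using sm unfolding summable_on_def f_def by blast
  \<comment> \<open>The total \<open>T\<close> is evaluated in two ways: here with \<open>F\<close>
    fixed first, then with \<open>q = n * \<Prod>F\<close> fixed first, where the inner sum over
    \<open>F \<subseteq> prime_factors q\<close> is finite.\<close>
  have "((\<lambda>F. (\<Prod>p\<in>F. h p) * g F) has_sum T) (Fpow primes)"
    by (rule has_sum_SigmaD[OF T]) (auto simp: f_def intro!: has_sum_cmult_right inner)
  moreover have "((\<lambda>q. a q * (\<Prod>p\<in>prime_factors q. 1 + h p)) has_sum T) {0<..}"
  proof (rule has_sum_SigmaD)
    show "(f' has_sum T) (SIGMA q:{0<..}. Pow (prime_factors q))" using T ff' by (simp add: Y_def)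
    fix q :: nat
    show "((\<lambda>F. f' (q, F)) has_sum a q * (\<Prod>p\<in>prime_factors q. 1 + h p)) (Pow (prime_factors q))"
      by (rule has_sum_finiteI)
         (simp_all add: f'_def prod_one_plus_eq_sum_Pow mult.commute[of "a q"] flip: sum_distrib_right)
  qed
  ultimately show ?thesis using total has_sum_unique by blast
qed

lemma has_sum_multiplicative_upto:
  fixes a h :: "nat \<Rightarrow> complex"
  shows "((\<lambda>F. (\<Prod>p\<in>F. h p) * (\<Sum>n\<in>nats_upto (y / real (\<Prod>F)). a (n * \<Prod>F))) has_sum
           (\<Sum>q\<in>nats_upto y. a q * (\<Prod>p\<in>prime_factors q. 1 + h p))) (Fpow primes)"
proof -
  \<comment> \<open>Cutting \<open>a\<close> off at \<open>y\<close> leaves only finitely many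
    non-zero pairs \<open>(F, n)\<close>, since \<open>n\<close> and the members of \<open>F\<close>
    all divide \<open>n * \<Prod>F \<le> y\<close>. Summability is then free.\<close>
  define a' where "a' n = (if real n \<le> y then a n else 0)" for n
  have eq: "n * \<Prod>F \<in> nats_upto y \<longleftrightarrow> n \<in> nats_upto (y / real (\<Prod>F))"
    if "F \<in> Fpow primes" for n F
    using Prod_primes_pos[OF that] pos_le_divide_eq[of "real (\<Prod>F)" "real n" y]
    unfolding in_nats_upto_iff of_nat_mult by (simp only: of_nat_0_less_iff nat_0_less_mult_iff simp_thms)
  show ?thesis
  proof (rule has_sum_multiplicative[where a = a'])
    have "finite {x \<in> Fpow primes \<times> {0<..}. (case x of (F, n) \<Rightarrow> (\<Prod>p\<in>F. h p) * a' (n * \<Prod>F)) \<noteq> 0}"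
    proof (rule finite_subset)
      show "finite (Pow (nats_upto y) \<times> nats_upto y)" by simp
      show "{x \<in> Fpow primes \<times> {0<..}. (case x of (F, n) \<Rightarrow> (\<Prod>p\<in>F. h p) * a' (n * \<Prod>F)) \<noteq> 0}
              \<subseteq> Pow (nats_upto y) \<times> nats_upto y"
      proof clarsimp
        fix F n assume *: "F \<in> Fpow primes" "0 < (n::nat)" "a' (n * \<Prod>F) \<noteq> 0"
        have le: "real (n * \<Prod>F) \<le> y" using * by (auto simp: a'_def split: if_splits)
        have pos: "\<Prod>F > 0" by (rule Prod_primes_pos) fact
        have F: "finite F" "\<And>p. p \<in> F \<Longrightarrow> prime p" using * by (auto simp: Fpow_def)
        have "n \<le> n * \<Prod>F" using pos by simp
        then have "real n \<le> real (n * \<Prod>F)" by (rule of_nat_mono)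
        with le have "real n \<le> y" by linarith
        moreover have "real p \<le> y" if "p \<in> F" for p
        proof -
          have "p dvd \<Prod>F" using dvd_prodI[of F p "\<lambda>x. x"] F that by simp
          then have "p \<le> n * \<Prod>F" using pos *(2) by (intro dvd_imp_le) auto
          then have "real p \<le> real (n * \<Prod>F)" by (rule of_nat_mono)
          with le show ?thesis by linarith
        qed
        ultimately show "F \<subseteq> nats_upto y \<and> n \<in> nats_upto y"
          using * F le by (auto simp: in_nats_upto_iff prime_gt_0_nat)
      qed
    qed
    then show "(\<lambda>(F, n). (\<Prod>p\<in>F. h p) * a' (n * \<Prod>F)) summable_on Fpow primes \<times> {0<..}"
      by (rule finite_nonzero_values_imp_summable_on)
  next
    fix F assume F: "F \<in> Fpow primes"
    show "((\<lambda>n. a' (n * \<Prod>F)) has_sum (\<Sum>n\<in>nats_upto (y / real (\<Prod>F)). a (n * \<Prod>F))) {0<..}"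
    proof (rule has_sum_finite_neutralI)
      show "nats_upto (y / real (\<Prod>F)) \<subseteq> {0<..}" by (auto simp: in_nats_upto_iff)
      show "a' (x * \<Prod>F) = 0" if "x \<in> {0<..} - nats_upto (y / real (\<Prod>F))" for x
      proof -
        have "x * \<Prod>F \<notin> nats_upto y" using that eq[OF F] by blast
        moreover have "x * \<Prod>F > 0" using that Prod_primes_pos[OF F] by simp
        ultimately show ?thesis unfolding in_nats_upto_iff a'_def by auto
      qed
      show "(\<Sum>n\<in>nats_upto (y / real (\<Prod>F)). a (n * \<Prod>F))
              = (\<Sum>n\<in>nats_upto (y / real (\<Prod>F)). a' (n * \<Prod>F))"
      proof (rule sum.cong[OF refl])
        fix n assume "n \<in> nats_upto (y / real (\<Prod>F))"
        then have "n * \<Prod>F \<in> nats_upto y" using eq[OF F] by blast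
        then show "a (n * \<Prod>F) = a' (n * \<Prod>F)" unfolding in_nats_upto_iff a'_def by auto
      qed
    qed simp
  next
    show "((\<lambda>q. a' q * (\<Prod>p\<in>prime_factors q. 1 + h p)) has_sum
            (\<Sum>q\<in>nats_upto y. a q * (\<Prod>p\<in>prime_factors q. 1 + h p))) {0<..}"
      by (rule has_sum_finite_neutralI[where B = "nats_upto y"])
         (auto simp: in_nats_upto_iff a'_def)
  qed
qed

lemma prod_powr_Prod:
  assumes "F \<in> Fpow primes"
  shows "(\<Prod>p\<in>F. real p powr s) = real (\<Prod>F) powr s"
proof -
  have "finite F" using assms by (auto simp: Fpow_def)
  then show ?thesis by (induction F) (auto simp: powr_mult)
qed

text \<open>
  The error bound is required for all \<open>X > 0\<close>, also where \<open>G\<close> is an empty sum: then the terms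
  with \<open>\<Prod>F > y\<close> need no separate tail estimate.
\<close>

lemma norm_infsum_transfer:
  fixes G M :: "real \<Rightarrow> complex" and w :: "nat \<Rightarrow> complex"
  assumes bound: "\<And>X. X > 0 \<Longrightarrow> norm (G X - M X) \<le> C * X powr \<kappa>" and y: "y > 0"
    and w: "(\<lambda>p. norm (w p) * real p powr (-\<kappa>)) summable_on primes"
    and G: "((\<lambda>F. (\<Prod>p\<in>F. w p) * G (y / real (\<Prod>F))) has_sum S) (Fpow primes)"
    and M: "((\<lambda>F. (\<Prod>p\<in>F. w p) * M (y / real (\<Prod>F))) has_sum S') (Fpow primes)"
  shows "norm (S - S') \<le> C * (\<Sum>\<^sub>\<infinity>F\<in>Fpow primes. \<Prod>p\<in>F. norm (w p) * real p powr (-\<kappa>)) * y powr \<kappa>"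
proof -
  define W where "W F = (\<Prod>p\<in>F. norm (w p) * real p powr (-\<kappa>))" for F
  have "(\<lambda>F. norm (\<Prod>p\<in>F. norm (w p) * real p powr (-\<kappa>))) summable_on Fpow primes"
    by (rule abs_summable_on_Fpow_prod) (use w in \<open>simp add: abs_mult\<close>)
  then have W: "W summable_on Fpow primes"
    unfolding W_def[abs_def] by (simp add: abs_prod abs_mult)
  have diff: "((\<lambda>F. (\<Prod>p\<in>F. w p) * (G (y / real (\<Prod>F)) - M (y / real (\<Prod>F)))) has_sum (S - S')) (Fpow primes)"
    using has_sum_add[OF G has_sum_uminusI[OF M]] by (simp add: algebra_simps)
  have "((\<lambda>F. C * W F * y powr \<kappa>) has_sum C * infsum W (Fpow primes) * y powr \<kappa>) (Fpow primes)"
    by (intro has_sum_cmult_left has_sum_cmult_right has_sum_infsum W)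
  from diff this have "norm (S - S') \<le> C * infsum W (Fpow primes) * y powr \<kappa>"
  proof (rule norm_infsum_le)
    fix F assume F: "F \<in> Fpow primes"
    have pos: "real (\<Prod>F) > 0" using Prod_primes_pos[OF F] by (simp only: of_nat_0_less_iff)
    have "norm ((\<Prod>p\<in>F. w p) * (G (y / real (\<Prod>F)) - M (y / real (\<Prod>F))))
            \<le> (\<Prod>p\<in>F. norm (w p)) * (C * (y / real (\<Prod>F)) powr \<kappa>)"
      unfolding norm_mult prod_norm using pos y by (intro mult_left_mono bound prod_nonneg) auto
    \<comment> \<open>A pure power is multiplicative in \<open>\<Prod>F\<close>, so the errors sum
      to an Euler product times \<open>y powr \<kappa>\<close>.\<close>
    also have "(y / real (\<Prod>F)) powr \<kappa> = y powr \<kappa> * real (\<Prod>F) powr (-\<kappa>)"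
      using y pos by (subst powr_divide) (simp_all only: divide_inverse less_imp_le powr_minus)
    also have "real (\<Prod>F) powr (-\<kappa>) = (\<Prod>p\<in>F. real p powr (-\<kappa>))"
      by (rule prod_powr_Prod[OF F, symmetric])
    finally show "norm ((\<Prod>p\<in>F. w p) * (G (y / real (\<Prod>F)) - M (y / real (\<Prod>F)))) \<le> C * W F * y powr \<kappa>"
      by (simp add: W_def prod.distrib mult_ac)
  qed
  then show ?thesis by (simp add: W_def[abs_def])
qed

section \<open>The divisor problem with a bounded weight\<close>

lemma card_nats_upto_bounds:
  assumes "x \<ge> 0"
  shows "\<bar>real (card (nats_upto x)) - x\<bar> \<le> 1" "real (card (nats_upto x)) \<le> x"
  using assms by (simp_all add: nats_upto_eq) linarith+

text \<open>The known bounds for Euler's constant compare the harmonic sum with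
  \<open>ln (n + 1)\<close>, where \<open>n\<close> is the integer part of \<open>s\<close>. Both
  \<open>ln (n + 1) - ln s\<close> and the correction \<open>1 / (2 n)\<close> lie between 0 and
  \<open>1 / s\<close>, and they act in opposite directions.\<close>

lemma sum_inverse_nats_upto:
  assumes "s \<ge> 1"
  shows "\<bar>(\<Sum>n\<in>nats_upto s. 1 / real n) - ln s - euler_mascheroni\<bar> \<le> 1 / s"
proof -
  define n where "n = nat \<lfloor>s\<rfloor>"
  have n: "n \<ge> 1" "real n \<le> s" "s < real n + 1" using assms by (simp_all add: n_def le_nat_floor)
  define m where "m = n - 1"
  have nm: "n = Suc m" using n by (simp add: m_def)
  have sum: "(\<Sum>n\<in>nats_upto s. 1 / real n) = harm n"
    by (simp add: nats_upto_eq n_def harm_def inverse_eq_divide)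
  have "ln (real n + 1) = ln s + ln ((real n + 1) / s)" using n assms by (simp add: ln_div)
  also have "ln ((real n + 1) / s) \<le> (real n + 1) / s - 1"
    using n assms by (intro ln_le_minus_one) simp
  also have "\<dots> \<le> 1 / s" using n assms by (simp add: field_simps)
  finally have u: "ln (real n + 1) \<le> ln s + 1 / s" by simp
  have l: "ln s \<le> ln (real n + 1)" using n assms by simp
  have "1 \<le> real n" using n by simp
  then have "s \<le> 2 * real n" using n by linarith
  moreover have "0 < 2 * real n * s" using n assms by simp
  ultimately have "1 / (2 * real n) \<le> 1 / s" by (intro divide_left_mono) auto
  moreover have "euler_mascheroni \<ge> harm n - ln (real n + 1) + 1 / (2 * (real n + 1))"
    using euler_mascheroni_lower[of m] by (simp add: nm algebra_simps)
  moreover have "euler_mascheroni \<le> harm n - ln (real n + 1) + 1 / (2 * real n)"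
    using euler_mascheroni_upper[of m] by (simp add: nm algebra_simps)
  moreover have "1 / (2 * (real n + 1)) \<ge> 0" by simp
  ultimately show ?thesis unfolding sum abs_le_iff using u l by linarith
qed

lemma sum_nats_upto_divisors:
  fixes f :: "nat \<Rightarrow> nat \<Rightarrow> 'a :: comm_monoid_add"
  shows "(\<Sum>n\<in>nats_upto x. \<Sum>d | d dvd n. f d n)
           = (\<Sum>d\<in>nats_upto x. \<Sum>j\<in>nats_upto (x / real d). f d (d * j))"
proof -
  have fin: "finite {d. d dvd n}" if "n \<in> nats_upto x" for n
    using that by (simp add: in_nats_upto_iff)
  have le: "real d \<le> x" if "real d * real j \<le> x" "0 < j" for d j
  proof -
    have "real d * 1 \<le> real d * real j" using that by (intro mult_left_mono) auto
    with that show ?thesis by linarith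
  qed
  have "(\<Sum>n\<in>nats_upto x. \<Sum>d | d dvd n. f d n) = (\<Sum>(n, d)\<in>(SIGMA n:nats_upto x. {d. d dvd n}). f d n)"
    by (rule sum.Sigma) (use fin in auto)
  also have "\<dots> = (\<Sum>(d, j)\<in>(SIGMA d:nats_upto x. nats_upto (x / real d)). f d (d * j))"
    by (rule sum.reindex_bij_witness[of _ "\<lambda>(d, j). (d * j, d)" "\<lambda>(n, d). (d, n div d)"])
       (auto simp: in_nats_upto_iff field_simps elim!: dvdE intro: le)
  also have "\<dots> = (\<Sum>d\<in>nats_upto x. \<Sum>j\<in>nats_upto (x / real d). f d (d * j))"
    by (rule sum.Sigma[symmetric]) auto
  finally show ?thesis .
qed

text \<open>Dirichlet's hyperbola method. Pairs with \<open>d \<le> s\<close> are grouped by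
  \<open>d\<close>, which needs only the number of admissible \<open>j\<close>. The others have
  \<open>j \<le> s\<close> and are grouped by \<open>j\<close>, which needs only partial sums of
  \<psi>.\<close>

lemma hyperbola_sum:
  fixes \<psi> :: "nat \<Rightarrow> complex"
  assumes x: "x \<ge> 1" and s: "s = sqrt x"
  shows "(\<Sum>d\<in>nats_upto x. \<Sum>j\<in>nats_upto (x / real d). \<psi> d)
           = (\<Sum>d\<in>nats_upto s. of_nat (card (nats_upto (x / real d))) * \<psi> d)
           + (\<Sum>j\<in>nats_upto s. (\<Sum>d\<in>nats_upto (x / real j). \<psi> d) - (\<Sum>d\<in>nats_upto s. \<psi> d))"
proof -
  have s1: "s \<ge> 1" and ss: "s * s = x" using x s by auto
  have sx: "s \<le> x" using s1 ss mult_left_mono[of 1 s s] by simp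
  have sub: "nats_upto s \<subseteq> nats_upto x" using sx by (auto simp: in_nats_upto_iff)
  have "(\<Sum>d\<in>nats_upto x. \<Sum>j\<in>nats_upto (x / real d). \<psi> d)
          = (\<Sum>d\<in>nats_upto x - nats_upto s. \<Sum>j\<in>nats_upto (x / real d). \<psi> d)
          + (\<Sum>d\<in>nats_upto s. \<Sum>j\<in>nats_upto (x / real d). \<psi> d)"
    by (rule sum.subset_diff[OF sub]) simp
  also have "(\<Sum>d\<in>nats_upto x - nats_upto s. \<Sum>j\<in>nats_upto (x / real d). \<psi> d)
      = (\<Sum>(d, j)\<in>(SIGMA d:nats_upto x - nats_upto s. nats_upto (x / real d)). \<psi> d)"
    by (rule sum.Sigma) auto
  also have "\<dots> = (\<Sum>(j, d)\<in>(SIGMA j:nats_upto s. nats_upto (x / real j) - nats_upto s). \<psi> d)"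
  proof (rule sum.reindex_bij_witness[of _ prod.swap prod.swap])
    fix z assume "z \<in> (SIGMA d:nats_upto x - nats_upto s. nats_upto (x / real d))"
    then obtain d j where z: "z = (d, j)" "0 < d" "s < real d" "0 < j" "real j \<le> x / real d"
      by (auto simp: in_nats_upto_iff)
    have "real j * real d \<le> s * s" using z ss by (simp add: field_simps)
    \<comment> \<open>Both factors cannot exceed \<open>s = sqrt x\<close>, as their product is at
      most \<open>x\<close>.\<close>
    moreover have "real j * real d > s * s" if "s < real j"
      using that z s1 by (intro mult_strict_mono) auto
    ultimately have "real j \<le> s" by (meson leI not_le)
    then show "prod.swap z \<in> (SIGMA j:nats_upto s. nats_upto (x / real j) - nats_upto s)"
      using z by (auto simp: in_nats_upto_iff field_simps)
  next
    fix z assume "z \<in> (SIGMA j:nats_upto s. nats_upto (x / real j) - nats_upto s)"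
    then obtain d j where z: "z = (j, d)" "0 < d" "s < real d" "0 < j" "real j \<le> s" "real d \<le> x / real j"
      by (auto simp: in_nats_upto_iff)
    have "x / real j \<le> x / 1" using z x by (intro divide_left_mono) auto
    then have "real d \<le> x" using z by simp
    then show "prod.swap z \<in> (SIGMA d:nats_upto x - nats_upto s. nats_upto (x / real d))"
      using z by (auto simp: in_nats_upto_iff field_simps)
  qed (auto)
  also have "\<dots> = (\<Sum>j\<in>nats_upto s. \<Sum>d\<in>nats_upto (x / real j) - nats_upto s. \<psi> d)"
    by (rule sum.Sigma[symmetric]) auto
  also have "\<dots> = (\<Sum>j\<in>nats_upto s. (\<Sum>d\<in>nats_upto (x / real j). \<psi> d) - (\<Sum>d\<in>nats_upto s. \<psi> d))"
  proof (intro sum.cong sum_diff)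
    fix j assume "j \<in> nats_upto s"
    then have j: "0 < real j" "real j \<le> s" by (auto simp: in_nats_upto_iff)
    then have "real j * s \<le> s * s" using s1 by (intro mult_right_mono) auto
    then have "s \<le> x / real j" using j ss by (simp add: field_simps)
    then show "nats_upto s \<subseteq> nats_upto (x / real j)" by (auto simp: in_nats_upto_iff)
  qed auto
  finally show ?thesis by (simp add: add.commute)
qed

section \<open>Riesz means as integrals of summatory functions\<close>

lemma has_integral_step_sum:
  fixes a :: "nat \<Rightarrow> complex"
  assumes "X \<ge> 1"
  shows "((\<lambda>t. \<Sum>n\<in>nats_upto t. a n) has_integral (\<Sum>n\<in>nats_upto X. a n * of_real (X - real n))) {1..X}"
proof -
  have "((\<lambda>t. \<Sum>n\<in>nats_upto X. if real n \<le> t then a n else 0) has_integral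
          (\<Sum>n\<in>nats_upto X. a n * of_real (X - real n))) {1..X}"
  proof (rule has_integral_sum)
    fix n assume n: "n \<in> nats_upto X"
    \<comment> \<open>The term \<open>a n\<close> is present in the step function exactly from
      \<open>t = n\<close> on, and the length \<open>X - n\<close> of that range becomes its
      weight.\<close>
    have "((\<lambda>t. a n) has_integral (measure lborel {real n..X} *\<^sub>R a n)) {real n..X}"
      using has_integral_const_real[of "a n" "real n" X] by simp
    also have "measure lborel {real n..X} *\<^sub>R a n = a n * of_real (X - real n)"
      using n by (simp add: in_nats_upto_iff scaleR_conv_of_real mult.commute)
    finally have "((\<lambda>t. a n) has_integral a n * of_real (X - real n)) {real n..X}" .
    then have "((\<lambda>t. if t \<in> {real n..X} then a n else 0) has_integral a n * of_real (X - real n)) {1..X}"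
      by (subst has_integral_restrict) (use n in \<open>auto simp: in_nats_upto_iff\<close>)
    then show "((\<lambda>t. if real n \<le> t then a n else 0) has_integral a n * of_real (X - real n)) {1..X}"
      by (rule has_integral_eq[rotated]) auto
  qed simp
  then show ?thesis
  proof (rule has_integral_eq[rotated])
    fix t assume t: "t \<in> {1..X}"
    have "(\<Sum>n\<in>nats_upto X. if real n \<le> t then a n else 0) = (\<Sum>n\<in>{n\<in>nats_upto X. real n \<le> t}. a n)"
      by (simp add: sum.inter_filter)
    also have "{n\<in>nats_upto X. real n \<le> t} = nats_upto t"
      using t by (auto simp: in_nats_upto_iff)
    finally show "(\<Sum>n\<in>nats_upto X. if real n \<le> t then a n else 0) = (\<Sum>n\<in>nats_upto t. a n)" .
  qed
qed

text \<open>Integrating the pointwise bound from 1 to \<open>X\<close> gains one power of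
  \<open>X\<close>. The value \<open>M 1\<close> at the lower end is left over and is absorbed
  because \<open>X powr (1 + \<kappa>) \<ge> 1\<close>.\<close>

lemma riesz_mean_bound:
  fixes a :: "nat \<Rightarrow> complex" and m M :: "real \<Rightarrow> complex"
  assumes S: "\<And>t. t \<ge> 1 \<Longrightarrow> norm ((\<Sum>n\<in>nats_upto t. a n) - m t) \<le> K * t powr \<kappa>"
    and M: "\<And>t. t \<ge> 1 \<Longrightarrow> (M has_vector_derivative m t) (at t)"
    and K: "K \<ge> 0" and \<kappa>: "\<kappa> \<ge> 0" and X: "X \<ge> 1"
  shows "norm ((\<Sum>n\<in>nats_upto X. a n * of_real (X - real n)) - M X) \<le> (K + norm (M 1)) * X powr (1 + \<kappa>)"
proof -
  have "(m has_integral (M X - M 1)) {1..X}"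
    by (rule fundamental_theorem_of_calculus) (use X in \<open>simp_all add: M has_vector_derivative_at_within\<close>)
  then have int: "((\<lambda>t. (\<Sum>n\<in>nats_upto t. a n) - m t) has_integral
          ((\<Sum>n\<in>nats_upto X. a n * of_real (X - real n)) - (M X - M 1))) (cbox 1 X)"
    unfolding cbox_interval by (rule has_integral_diff[OF has_integral_step_sum[OF X]])
  have bound: "norm ((\<Sum>n\<in>nats_upto t. a n) - m t) \<le> K * X powr \<kappa>" if "t \<in> cbox 1 X" for t
  proof -
    have t: "1 \<le> t" "t \<le> X" using that by auto
    have "norm ((\<Sum>n\<in>nats_upto t. a n) - m t) \<le> K * t powr \<kappa>" by (rule S) fact
    also have "\<dots> \<le> K * X powr \<kappa>" using t \<kappa> K by (intro mult_left_mono powr_mono2) auto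
    finally show ?thesis .
  qed
  have "norm ((\<Sum>n\<in>nats_upto X. a n * of_real (X - real n)) - (M X - M 1))
               \<le> K * X powr \<kappa> * measure lborel (cbox 1 X)"
    by (rule has_integral_bound[OF _ int bound]) (use K in auto)
  also have "\<dots> \<le> K * X powr \<kappa> * X" using X K by (intro mult_left_mono) auto
  also have "\<dots> = K * X powr (1 + \<kappa>)" using X by (simp add: powr_add)
  finally have 1: "norm ((\<Sum>n\<in>nats_upto X. a n * of_real (X - real n)) - (M X - M 1)) \<le> K * X powr (1 + \<kappa>)" .
  have "1 \<le> X powr (1 + \<kappa>)" using X \<kappa> by (intro ge_one_powr_ge_zero) auto
  then have "norm (M 1) * 1 \<le> norm (M 1) * X powr (1 + \<kappa>)" by (intro mult_left_mono) auto
  moreover have "norm ((\<Sum>n\<in>nats_upto X. a n * of_real (X - real n)) - M X)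
     \<le> norm ((\<Sum>n\<in>nats_upto X. a n * of_real (X - real n)) - (M X - M 1)) + norm (M 1)"
    using norm_triangle_ineq4[of "(\<Sum>n\<in>nats_upto X. a n * of_real (X - real n)) - (M X - M 1)" "M 1"]
    by (simp add: algebra_simps)
  ultimately show ?thesis using 1 by (simp add: algebra_simps)
qed

text \<open>Below \<open>X = 1\<close> the Riesz mean is empty, so the main term is itself the
  error. Its logarithm is absorbed by \<open>X powr (1 - \<theta>)\<close>, which is possible
  because \<theta> < 1.\<close>

lemma norm_log_quadratic_le:
  fixes \<alpha> c :: complex
  assumes "0 < X" "X < 1" "\<theta> < 1"
  shows "norm (of_real (X\<^sup>2) * (\<alpha> * of_real (ln X) + c)) \<le> (norm \<alpha> / (1 - \<theta>) + norm c) * X powr (1 + \<theta>)"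
proof -
  have "ln (1 / X) \<le> (1 / X) powr (1 - \<theta>) / (1 - \<theta>)"
    using assms by (intro ln_powr_bound) auto
  then have l: "\<bar>ln X\<bar> \<le> X powr (\<theta> - 1) / (1 - \<theta>)"
    using assms by (simp add: ln_div powr_divide powr_diff)
  have X2: "X\<^sup>2 = X powr 2" using assms by simp
  have "X\<^sup>2 * \<bar>ln X\<bar> \<le> X powr 2 * (X powr (\<theta> - 1) / (1 - \<theta>))"
    unfolding X2 by (intro mult_left_mono l) auto
  also have "\<dots> = X powr (2 + (\<theta> - 1)) / (1 - \<theta>)" by (simp only: powr_add times_divide_eq_right)
  also have "2 + (\<theta> - 1) = 1 + \<theta>" by simp
  finally have e1: "X\<^sup>2 * \<bar>ln X\<bar> \<le> X powr (1 + \<theta>) / (1 - \<theta>)" .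
  have e2: "X\<^sup>2 \<le> X powr (1 + \<theta>)"
    unfolding X2 using assms powr_mono'[of "1 + \<theta>" 2 X] by simp
  have "norm (of_real (X\<^sup>2) * (\<alpha> * of_real (ln X) + c)) \<le> X\<^sup>2 * (norm \<alpha> * \<bar>ln X\<bar> + norm c)"
    unfolding norm_mult norm_of_real
    by (intro mult_mono order_trans[OF norm_triangle_ineq]) (auto simp: norm_mult)
  also have "\<dots> = norm \<alpha> * (X\<^sup>2 * \<bar>ln X\<bar>) + norm c * X\<^sup>2" by (simp add: algebra_simps)
  also have "\<dots> \<le> norm \<alpha> * (X powr (1 + \<theta>) / (1 - \<theta>)) + norm c * X powr (1 + \<theta>)"
    by (intro add_mono mult_left_mono e1 e2) auto
  finally show ?thesis by (simp add: algebra_simps)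
qed

text \<open>The assumed main term is the derivative of
  \<open>t\<^sup>2 * (\<alpha> * ln t + c)\<close>. The range \<open>X \<ge> 1\<close> is handled by
  integration and \<open>X < 1\<close> by the size of the main term; the maximum of the two
  constants serves everywhere.\<close>

lemma riesz_mean_log_bound:
  fixes a :: "nat \<Rightarrow> complex" and \<alpha> c :: complex
  assumes S: "\<And>t. t \<ge> 1 \<Longrightarrow>
      norm ((\<Sum>n\<in>nats_upto t. a n) - (2 * \<alpha> * of_real (t * ln t) + (\<alpha> + 2 * c) * of_real t)) \<le> K * t powr \<theta>"
    and K: "K \<ge> 0" and \<theta>: "0 \<le> \<theta>" "\<theta> < 1"
  shows "\<exists>C. \<forall>X>0. norm ((\<Sum>n\<in>nats_upto X. a n * of_real (X - real n))
            - of_real (X\<^sup>2) * (\<alpha> * of_real (ln X) + c)) \<le> C * X powr (1 + \<theta>)"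
proof (intro exI allI impI)
  fix X :: real assume X: "X > 0"
  define M where "M X = of_real (X\<^sup>2) * (\<alpha> * of_real (ln X) + c)" for X
  define C1 where "C1 = K + norm (M 1)"
  define C2 where "C2 = norm \<alpha> / (1 - \<theta>) + norm c"
  have C: "C1 \<ge> 0" "C2 \<ge> 0" using K \<theta> by (auto simp: C1_def C2_def)
  have "norm ((\<Sum>n\<in>nats_upto X. a n * of_real (X - real n)) - M X) \<le> max C1 C2 * X powr (1 + \<theta>)"
  proof (cases "X \<ge> 1")
    case True
    have "norm ((\<Sum>n\<in>nats_upto X. a n * of_real (X - real n)) - M X) \<le> C1 * X powr (1 + \<theta>)"
      unfolding C1_def
    proof (rule riesz_mean_bound[OF S _ K \<theta>(1) True])
      fix t :: real assume t: "t \<ge> 1"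
      have M: "M = (\<lambda>t. \<alpha> * of_real (t\<^sup>2 * ln t) + c * of_real (t\<^sup>2))"
        by (simp add: M_def fun_eq_iff algebra_simps)
      have d1: "((\<lambda>t. t\<^sup>2 * ln t) has_real_derivative (2 * t * ln t + t)) (at t)"
        using t by (auto intro!: derivative_eq_intros simp: power2_eq_square)
      have d2: "((\<lambda>t. t\<^sup>2) has_real_derivative (2 * t)) (at t)"
        by (auto intro!: derivative_eq_intros)
      have "(M has_vector_derivative (\<alpha> * of_real (2 * t * ln t + t) + c * of_real (2 * t))) (at t)"
        unfolding M
        by (intro has_vector_derivative_add has_vector_derivative_mult_right has_vector_derivative_of_real d1 d2)
      then show "(M has_vector_derivative (2 * \<alpha> * of_real (t * ln t) + (\<alpha> + 2 * c) * of_real t)) (at t)"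
        by (simp add: algebra_simps)
    qed
    also have "\<dots> \<le> max C1 C2 * X powr (1 + \<theta>)" by (intro mult_right_mono) auto
    finally show ?thesis .
  next
    case False
    then have "norm ((\<Sum>n\<in>nats_upto X. a n * of_real (X - real n)) - M X) = norm (M X)"
      by (simp add: nats_upto_empty)
    also have "\<dots> \<le> C2 * X powr (1 + \<theta>)"
      unfolding M_def C2_def using X False \<theta> by (intro norm_log_quadratic_le) auto
    also have "\<dots> \<le> max C1 C2 * X powr (1 + \<theta>)" by (intro mult_right_mono) auto
    finally show ?thesis .
  qed
  then show "norm ((\<Sum>n\<in>nats_upto X. a n * of_real (X - real n))
      - of_real (X\<^sup>2) * (\<alpha> * of_real (ln X) + c))
    \<le> max (K + norm (of_real (1\<^sup>2) * (\<alpha> * of_real (ln 1) + c))) (norm \<alpha> / (1 - \<theta>) + norm c) * X powr (1 + \<theta>)"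
    unfolding M_def C1_def C2_def .
qed

section \<open>The hyperbola method for a bounded completely multiplicative function\<close>

locale mean_value =
  fixes \<psi> :: "nat \<Rightarrow> complex" and \<alpha> b :: complex and K :: real
  assumes norm_le_1: "norm (\<psi> n) \<le> 1"
    and mult: "\<psi> (m * n) = \<psi> m * \<psi> n"
    and one: "\<psi> 1 = 1"
    and partial_sum: "x \<ge> 1 \<Longrightarrow> norm ((\<Sum>n\<in>nats_upto x. \<psi> n) - \<alpha> * of_real x) \<le> K"
    and log_partial_sum:
      "x \<ge> 1 \<Longrightarrow> norm ((\<Sum>n\<in>nats_upto x. \<psi> n / of_nat n) - (\<alpha> * of_real (ln x) + b)) \<le> K / x"
begin

text \<open>With \<open>s = sqrt x\<close>, the part \<open>d \<le> s\<close> yields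
  \<open>x * (\<alpha> * ln s + b)\<close>, the part \<open>j \<le> s\<close> yields
  \<open>\<alpha> * x * (ln s + euler_mascheroni)\<close>, and the overlap removes
  \<open>\<alpha> * s * s = \<alpha> * x\<close>. Collecting the multiples of \<open>x\<close> gives
  this constant.\<close>

definition \<beta> :: complex where
  "\<beta> = b + \<alpha> * (euler_mascheroni - 1)"

lemma K_nonneg: "K \<ge> 0"
  using partial_sum[of 1] norm_ge_zero order_trans by blast

lemma psi_Prod: "finite F \<Longrightarrow> \<psi> (\<Prod>F) = (\<Prod>p\<in>F. \<psi> p)"
  by (induction F rule: finite_induct) (use one mult in auto)

text \<open>Six errors of size \<open>s = sqrt x\<close> make up the constant: rounding the counts
  of \<open>j\<close> (\<open>n1\<close>), the logarithmic sum over \<open>d\<close>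
  (\<open>n2\<close>), the partial sums at \<open>x / j\<close> (\<open>n3\<close>), the harmonic
  sum over \<open>j\<close> (\<open>n4\<close>), and the overlap, once for the partial sum at
  \<open>s\<close> (\<open>n5\<close>) and once for rounding \<open>s\<close> to the count
  \<open>c\<close> (\<open>n6\<close>).\<close>

lemma divisor_sum:
  assumes x: "x \<ge> 1"
  shows "norm ((\<Sum>n\<in>nats_upto x. \<Sum>d | d dvd n. \<psi> d) - (\<alpha> * of_real (x * ln x) + \<beta> * of_real x))
           \<le> (1 + 3 * K + 2 * norm \<alpha>) * sqrt x"
proof -
  define s where "s = sqrt x"
  have s: "s \<ge> 1" "s * s = x" using x by (auto simp: s_def)
  have lns: "ln x = 2 * ln s" using s ln_mult[of s s] by simp
  define A where "A x = (\<Sum>n\<in>nats_upto x. \<psi> n)" for x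
  define B where "B = (\<Sum>n\<in>nats_upto s. \<psi> n / of_nat n)"
  define c where "c = card (nats_upto s)"
  define Hs where "Hs = (\<Sum>j\<in>nats_upto s. 1 / real j)"
  define T1 where "T1 = (\<Sum>d\<in>nats_upto s. of_nat (card (nats_upto (x / real d))) * \<psi> d)"
  have cs: "real c \<le> s" "\<bar>real c - s\<bar> \<le> 1" using s card_nats_upto_bounds[of s] by (auto simp: c_def)
  have D: "(\<Sum>n\<in>nats_upto x. \<Sum>d | d dvd n. \<psi> d) = T1 + (\<Sum>j\<in>nats_upto s. A (x / real j) - A s)"
    unfolding sum_nats_upto_divisors hyperbola_sum[OF x s_def] T1_def A_def ..
  have n1: "norm (T1 - of_real x * B) \<le> s"
  proof -
    have "T1 - of_real x * B = (\<Sum>d\<in>nats_upto s. of_real (real (card (nats_upto (x / real d))) - x / real d) * \<psi> d)"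
      unfolding T1_def B_def sum_distrib_left sum_subtractf[symmetric]
      by (intro sum.cong) (simp_all add: algebra_simps)
    also have "norm \<dots> \<le> (\<Sum>d\<in>nats_upto s. 1)"
    proof (intro sum_norm_le)
      fix d assume "d \<in> nats_upto s"
      have "norm (of_real (real (card (nats_upto (x / real d))) - x / real d) * \<psi> d)
              = \<bar>real (card (nats_upto (x / real d))) - x / real d\<bar> * norm (\<psi> d)"
        unfolding norm_mult norm_of_real ..
      also have "\<dots> \<le> 1 * 1"
        by (intro mult_mono card_nats_upto_bounds norm_le_1) (use x in auto)
      finally show "norm (of_real (real (card (nats_upto (x / real d))) - x / real d) * \<psi> d) \<le> 1" by simp
    qed
    also have "\<dots> \<le> s" using cs by (simp add: c_def)
    finally show ?thesis .
  qed
  have n2: "norm (of_real x * (B - (\<alpha> * of_real (ln s) + b))) \<le> K * s"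
  proof -
    have "norm (of_real x * (B - (\<alpha> * of_real (ln s) + b))) \<le> x * (K / s)"
      unfolding norm_mult by (rule mult_mono) (use x log_partial_sum[OF s(1)] in \<open>simp_all add: B_def\<close>)
    also have "\<dots> = K * s" using s by (simp add: field_simps)
    finally show ?thesis .
  qed
  have n3: "norm (\<Sum>j\<in>nats_upto s. A (x / real j) - \<alpha> * of_real (x / real j)) \<le> K * s"
  proof -
    have "norm (\<Sum>j\<in>nats_upto s. A (x / real j) - \<alpha> * of_real (x / real j)) \<le> (\<Sum>j\<in>nats_upto s. K)"
    proof (intro sum_norm_le)
      fix j assume "j \<in> nats_upto s"
      then have j: "0 < real j" "real j \<le> s" by (auto simp: in_nats_upto_iff)
      have "real j * 1 \<le> s * s" using j s by (intro mult_mono) auto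
      then have "x / real j \<ge> 1" using j s by simp
      then show "norm (A (x / real j) - \<alpha> * of_real (x / real j)) \<le> K"
        unfolding A_def by (rule partial_sum)
    qed
    also have "\<dots> \<le> K * s" using cs K_nonneg by (simp add: c_def mult.commute mult_left_mono)
    finally show ?thesis .
  qed
  have n4: "norm (\<alpha> * of_real (x * (Hs - ln s - euler_mascheroni))) \<le> norm \<alpha> * s"
  proof -
    have "\<bar>x * (Hs - ln s - euler_mascheroni)\<bar> \<le> x * (1 / s)"
      unfolding abs_mult by (rule mult_mono) (use x sum_inverse_nats_upto[OF s(1)] in \<open>simp_all add: Hs_def\<close>)
    also have "\<dots> = s" using s by (simp add: field_simps)
    finally show ?thesis unfolding norm_mult norm_of_real by (intro mult_left_mono) auto
  qed
  have n5: "norm (of_nat c * (A s - \<alpha> * of_real s)) \<le> K * s"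
    unfolding norm_mult A_def using cs K_nonneg partial_sum[of s] s
      mult_mono[of "real c" s "norm ((\<Sum>n\<in>nats_upto s. \<psi> n) - \<alpha> * of_real s)" K]
    by (simp add: mult.commute)
  have n6: "norm (\<alpha> * of_real (s * (real c - s))) \<le> norm \<alpha> * s"
    unfolding norm_mult norm_of_real abs_mult using s cs
    by (intro mult_left_mono) (auto intro: mult_left_le)
  have "(\<Sum>j\<in>nats_upto s. A (x / real j) - A s)
      = (\<Sum>j\<in>nats_upto s. A (x / real j) - \<alpha> * of_real (x / real j)) + \<alpha> * of_real (x * Hs) - of_nat c * A s"
    by (simp add: sum_subtractf Hs_def c_def sum_distrib_left)
  then have "(\<Sum>n\<in>nats_upto x. \<Sum>d | d dvd n. \<psi> d) - (\<alpha> * of_real (x * ln x) + \<beta> * of_real x)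
      = (T1 - of_real x * B) + of_real x * (B - (\<alpha> * of_real (ln s) + b))
        + (\<Sum>j\<in>nats_upto s. A (x / real j) - \<alpha> * of_real (x / real j))
        + \<alpha> * of_real (x * (Hs - ln s - euler_mascheroni))
        - of_nat c * (A s - \<alpha> * of_real s) - \<alpha> * of_real (s * (real c - s))"
    unfolding D lns \<beta>_def by (simp add: algebra_simps flip: s(2))
  also have "norm \<dots> \<le> s + K * s + K * s + norm \<alpha> * s + K * s + norm \<alpha> * s"
    by (intro order_trans[OF norm_triangle_ineq4] order_trans[OF norm_triangle_ineq] add_mono n1 n2 n3 n4 n5 n6)
  finally show ?thesis by (simp add: s_def algebra_simps)
qed

text \<open>The main term is the antiderivative of \<open>\<alpha> * t * ln t + \<beta> * t\<close>;
  the \<open>- \<alpha> / 4\<close> comes from integrating \<open>t * ln t\<close> by parts.\<close>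

lemma riesz_divisor_sum:
  assumes \<theta>: "1 / 2 \<le> \<theta>" "\<theta> < 1"
  shows "\<exists>C. \<forall>X>0. norm ((\<Sum>n\<in>nats_upto X. (\<Sum>d | d dvd n. \<psi> d) * of_real (X - real n))
            - of_real (X\<^sup>2) * (\<alpha> / 2 * of_real (ln X) + (\<beta> / 2 - \<alpha> / 4))) \<le> C * X powr (1 + \<theta>)"
proof (rule riesz_mean_log_bound)
  fix t :: real assume t: "t \<ge> 1"
  have "sqrt t \<le> t powr \<theta>" using t \<theta> by (simp add: powr_half_sqrt[symmetric] powr_mono)
  then have "(1 + 3 * K + 2 * norm \<alpha>) * sqrt t \<le> (1 + 3 * K + 2 * norm \<alpha>) * t powr \<theta>"
    using K_nonneg by (intro mult_left_mono) auto
  moreover have "2 * (\<alpha> / 2) = \<alpha>" "\<alpha> / 2 + 2 * (\<beta> / 2 - \<alpha> / 4) = \<beta>" by simp_all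
  ultimately show "norm ((\<Sum>n\<in>nats_upto t. \<Sum>d | d dvd n. \<psi> d) - (2 * (\<alpha> / 2) * of_real (t * ln t)
      + (\<alpha> / 2 + 2 * (\<beta> / 2 - \<alpha> / 4)) * of_real t)) \<le> (1 + 3 * K + 2 * norm \<alpha>) * t powr \<theta>"
    using divisor_sum[OF t] by (simp only:)
qed (use K_nonneg \<theta> in auto)

lemma riesz_partial_sum:
  assumes \<theta>: "0 \<le> \<theta>" "\<theta> < 1"
  shows "\<exists>C. \<forall>X>0. norm ((\<Sum>n\<in>nats_upto X. \<psi> n * of_real (X - real n))
            - of_real (X\<^sup>2) * (\<alpha> / 2)) \<le> C * X powr (1 + \<theta>)"
proof -
  \<comment> \<open>This is the previous shape with logarithmic coefficient 0 and
    \<open>c = \<alpha> / 2\<close>.\<close>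
  have "norm ((\<Sum>n\<in>nats_upto t. \<psi> n) - (2 * 0 * of_real (t * ln t) + (0 + 2 * (\<alpha> / 2)) * of_real t))
      \<le> K * t powr \<theta>" if t: "t \<ge> 1" for t
  proof -
    have "K * 1 \<le> K * t powr \<theta>" using K_nonneg t \<theta> by (intro mult_left_mono ge_one_powr_ge_zero) auto
    with partial_sum[OF t] show ?thesis by simp
  qed
  from riesz_mean_log_bound[OF this K_nonneg \<theta>] show ?thesis by simp
qed

text \<open>The extension of \<open>partial_sum\<close> to \<open>X < 1\<close>, where the sum is
  empty and \<open>\<alpha> * X\<close> is dominated by \<open>X powr \<theta>\<close>.\<close>

lemma partial_sum_powr:
  assumes \<theta>: "0 \<le> \<theta>" "\<theta> < 1" and X: "X > 0"
  shows "norm ((\<Sum>n\<in>nats_upto X. \<psi> n) - \<alpha> * of_real X) \<le> (K + norm \<alpha>) * X powr \<theta>"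
proof (cases "X \<ge> 1")
  case True
  have "norm ((\<Sum>n\<in>nats_upto X. \<psi> n) - \<alpha> * of_real X) \<le> (K + norm \<alpha>) * 1"
    using partial_sum[OF True] by (simp add: add_increasing2)
  also have "\<dots> \<le> (K + norm \<alpha>) * X powr \<theta>"
    using K_nonneg True \<theta> by (intro mult_left_mono ge_one_powr_ge_zero) auto
  finally show ?thesis .
next
  case False
  have "norm ((\<Sum>n\<in>nats_upto X. \<psi> n) - \<alpha> * of_real X) = norm \<alpha> * X powr 1"
    using False X by (simp add: nats_upto_empty norm_mult)
  also have "\<dots> \<le> (K + norm \<alpha>) * X powr \<theta>"
    using K_nonneg False \<theta> X powr_mono'[of \<theta> 1 X] by (intro mult_mono) auto
  finally show ?thesis .
qed

end

section \<open>Transfer to sums weighted by products over prime factors\<close>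

locale weighted_mean_value = mean_value +
  fixes h :: "nat \<Rightarrow> complex" and \<theta> :: real
  assumes \<theta>: "1 / 2 \<le> \<theta>" "\<theta> < 1"
    and h_summable: "(\<lambda>p. norm (h p) * real p powr (-\<theta>)) summable_on primes"
    and h_le_1: "prime p \<Longrightarrow> norm (h p) \<le> 1"
begin

definition weight :: "nat \<Rightarrow> complex" where
  "weight q = (\<Prod>p\<in>prime_factors q. 1 + h p)"

definition local_factor :: "nat \<Rightarrow> complex" where
  "local_factor p = h p * \<psi> p / of_nat p"

definition density :: complex where
  "density = euler_sum local_factor primes"

text \<open>For the Euler product with factors \<open>1 + h p * \<psi> p * p powr (-s)\<close>, this
  is minus its logarithmic derivative at \<open>s = 1\<close>.\<close>

definition log_density :: complex where
  "log_density = (\<Sum>\<^sub>\<infinity>p\<in>primes. of_real (ln (real p)) * local_factor p / (1 + local_factor p))"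

lemma norm_local_factor_le:
  assumes "prime p"
  shows "norm (local_factor p) \<le> norm (h p) / real p"
proof -
  have "norm (local_factor p) = norm (h p) * norm (\<psi> p) / real p" by (simp add: local_factor_def norm_mult norm_divide)
  also have "\<dots> \<le> norm (h p) * 1 / real p"
    by (intro divide_right_mono mult_left_mono norm_le_1) auto
  finally show ?thesis by simp
qed

lemma norm_local_factor_le_half:
  assumes "prime p"
  shows "norm (local_factor p) \<le> 1 / 2"
proof -
  have "norm (h p) / real p \<le> 1 / 2"
    using h_le_1[OF assms] prime_ge_2_nat[OF assms] by (intro frac_le) auto
  with norm_local_factor_le[OF assms] show ?thesis by linarith
qed

lemma one_plus_local_factor_nonzero: "prime p \<Longrightarrow> 1 + local_factor p \<noteq> 0"
  using norm_local_factor_le_half[of p] by (auto simp: add_eq_0_iff)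

text \<open>The gap between \<theta> and 1 pays for the logarithm: \<open>ln p\<close> is at most a
  constant times \<open>p powr (1 - \<theta>)\<close>.\<close>

lemma log_local_factor_summable: "(\<lambda>p. \<bar>ln (real p)\<bar> * norm (local_factor p)) summable_on primes"
proof (rule summable_on_comparison_test)
  show "(\<lambda>p. (1 / (1 - \<theta>)) * (norm (h p) * real p powr (-\<theta>))) summable_on primes"
    by (intro summable_on_cmult_right h_summable)
  fix p :: nat assume "p \<in> primes"
  then have p: "prime p" "real p \<ge> 1" using prime_ge_1_nat by auto
  have "ln (real p) \<le> real p powr (1 - \<theta>) / (1 - \<theta>)"
    using p \<theta> by (intro ln_powr_bound) auto
  then have "\<bar>ln (real p)\<bar> * norm (local_factor p) \<le> (real p powr (1 - \<theta>) / (1 - \<theta>)) * (norm (h p) / real p)"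
    using p \<theta> by (intro mult_mono norm_local_factor_le) auto
  also have "real p powr (1 - \<theta>) = real p * real p powr (-\<theta>)"
    using p powr_add[of "real p" 1 "-\<theta>"] by simp
  finally show "\<bar>ln (real p)\<bar> * norm (local_factor p) \<le> (1 / (1 - \<theta>)) * (norm (h p) * real p powr (-\<theta>))"
    using p by (simp add: field_simps)
qed auto

lemma local_factor_summable: "(\<lambda>p. norm (local_factor p)) summable_on primes"
proof (rule summable_on_comparison_test[OF h_summable])
  fix p :: nat assume "p \<in> primes"
  then have p: "prime p" "real p \<ge> 1" using prime_ge_1_nat by auto
  have "norm (h p) / real p = norm (h p) * real p powr (-1)"
    using p by (simp add: powr_minus divide_inverse)
  also have "\<dots> \<le> norm (h p) * real p powr (-\<theta>)"
    using p \<theta> by (intro mult_left_mono powr_mono) auto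
  finally show "norm (local_factor p) \<le> norm (h p) * real p powr (-\<theta>)"
    using norm_local_factor_le[OF p(1)] by linarith
qed auto

lemma weight_summable:
  assumes "\<And>p. prime p \<Longrightarrow> norm (w p) = norm (h p) * norm (\<psi> p) * real p powr r"
  shows "(\<lambda>p. norm (w p) * real p powr (-(r + \<theta>))) summable_on primes"
proof (rule summable_on_comparison_test[OF h_summable])
  fix p :: nat assume "p \<in> primes"
  then have p: "prime p" "real p \<ge> 1" using prime_ge_1_nat by auto
  have "norm (w p) * real p powr (-(r + \<theta>)) = (norm (h p) * norm (\<psi> p)) * (real p powr r * real p powr (-(r + \<theta>)))"
    by (simp add: assms[OF p(1)])
  also have "real p powr r * real p powr (-(r + \<theta>)) = real p powr (-\<theta>)"
    by (simp flip: powr_add)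
  also have "norm (h p) * norm (\<psi> p) * real p powr (-\<theta>) \<le> norm (h p) * 1 * real p powr (-\<theta>)"
    by (intro mult_right_mono mult_left_mono norm_le_1) auto
  finally show "norm (w p) * real p powr (-(r + \<theta>)) \<le> norm (h p) * real p powr (-\<theta>)" by simp
qed auto

lemma has_sum_density: "((\<lambda>F. \<Prod>p\<in>F. local_factor p) has_sum density) (Fpow primes)"
  unfolding density_def by (rule has_sum_euler_sum[OF local_factor_summable])

lemma ln_Prod_primes: "F \<in> Fpow primes \<Longrightarrow> ln (real (\<Prod>F)) = (\<Sum>p\<in>F. ln (real p))"
  by (auto simp: Fpow_def intro!: ln_prod dest: prime_gt_0_nat)

lemma has_sum_density_log:
  "((\<lambda>F. (\<Prod>p\<in>F. local_factor p) * of_real (ln (real (\<Prod>F)))) has_sum density * log_density) (Fpow primes)"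
proof -
  have "((\<lambda>F. (\<Prod>p\<in>F. local_factor p) * of_real (\<Sum>p\<in>F. ln (real p))) has_sum density * log_density) (Fpow primes)"
    unfolding density_def log_density_def
    by (rule has_sum_Fpow_prod_times_sum[OF local_factor_summable log_local_factor_summable]) (use one_plus_local_factor_nonzero in auto)
  also have "?this \<longleftrightarrow> ?thesis"
    by (intro has_sum_cong) (simp only: ln_Prod_primes)
  finally show ?thesis .
qed

lemma prod_weights:
  assumes "F \<in> Fpow primes"
  shows "(\<Prod>p\<in>F. h p * \<psi> p * of_nat p ^ r) = (\<Prod>p\<in>F. h p) * (\<psi> (\<Prod>F) * of_nat (\<Prod>F) ^ r)"
    and "(\<Prod>p\<in>F. h p * \<psi> p * of_nat p ^ r) = (\<Prod>p\<in>F. local_factor p) * of_nat (\<Prod>F) ^ Suc r"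
proof -
  have F: "finite F" "\<And>p. p \<in> F \<Longrightarrow> p \<noteq> 0" using assms by (auto simp: Fpow_def dest: prime_gt_0_nat)
  show "(\<Prod>p\<in>F. h p * \<psi> p * of_nat p ^ r) = (\<Prod>p\<in>F. h p) * (\<psi> (\<Prod>F) * of_nat (\<Prod>F) ^ r)"
    using F by (simp add: psi_Prod prod.distrib prod_power_distrib)
  show "(\<Prod>p\<in>F. h p * \<psi> p * of_nat p ^ r) = (\<Prod>p\<in>F. local_factor p) * of_nat (\<Prod>F) ^ Suc r"
    unfolding of_nat_prod prod_power_distrib prod.distrib[symmetric]
    using F by (intro prod.cong) (auto simp: local_factor_def)
qed

text \<open>Here \<open>r\<close> is the degree of homogeneity of the summand: restricting to
  multiples of \<open>P\<close> pulls out \<open>\<psi> P * P ^ r\<close> and rescales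
  \<open>y\<close> to \<open>y / P\<close>. It is 1 for the Riesz means and 0 for the plain sum. In
  the main term the exponent is \<open>Suc r\<close>, because \<open>local_factor\<close> already
  contains a division by \<open>p\<close>.\<close>

lemma weighted_sum_transfer:
  fixes G M :: "real \<Rightarrow> complex" and r :: nat
  assumes bound: "\<And>X. X > 0 \<Longrightarrow> norm (G X - M X) \<le> C * X powr (real r + \<theta>)"
    and hom: "\<And>y P. P > 0 \<Longrightarrow>
      (\<Sum>n\<in>nats_upto (y / real P). a y (n * P)) = \<psi> P * of_nat P ^ r * G (y / real P)"
    and M: "\<And>y. y > 0 \<Longrightarrow> ((\<lambda>F. (\<Prod>p\<in>F. local_factor p) * of_nat (\<Prod>F) ^ Suc r * M (y / real (\<Prod>F)))
      has_sum S y) (Fpow primes)"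
  shows "\<exists>C. \<forall>y>0. norm ((\<Sum>q\<in>nats_upto y. a y q * weight q) - S y) \<le> C * y powr (real r + \<theta>)"
proof (intro exI allI impI)
  fix y :: real assume y: "y > 0"
  define w where "w p = h p * \<psi> p * of_nat p ^ r" for p
  have w: "(\<lambda>p. norm (w p) * real p powr (-(real r + \<theta>))) summable_on primes"
    by (rule weight_summable) (auto simp: w_def norm_mult norm_power powr_realpow dest: prime_gt_0_nat)
  show "norm ((\<Sum>q\<in>nats_upto y. a y q * weight q) - S y)
    \<le> C * (\<Sum>\<^sub>\<infinity>F\<in>Fpow primes. \<Prod>p\<in>F. norm (h p * \<psi> p * of_nat p ^ r) * real p powr (-(real r + \<theta>)))
        * y powr (real r + \<theta>)"
    unfolding w_def[symmetric]
  proof (rule norm_infsum_transfer[OF bound y w])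
    have "((\<lambda>F. (\<Prod>p\<in>F. h p) * (\<Sum>n\<in>nats_upto (y / real (\<Prod>F)). a y (n * \<Prod>F))) has_sum
           (\<Sum>q\<in>nats_upto y. a y q * weight q)) (Fpow primes)"
      unfolding weight_def by (rule has_sum_multiplicative_upto)
    also have "?this \<longleftrightarrow> ((\<lambda>F. (\<Prod>p\<in>F. w p) * G (y / real (\<Prod>F))) has_sum (\<Sum>q\<in>nats_upto y. a y q * weight q)) (Fpow primes)"
      by (intro has_sum_cong) (simp only: hom Prod_primes_pos w_def prod_weights(1), simp only: mult.assoc)
    finally show "((\<lambda>F. (\<Prod>p\<in>F. w p) * G (y / real (\<Prod>F))) has_sum (\<Sum>q\<in>nats_upto y. a y q * weight q)) (Fpow primes)" .
    have "((\<lambda>F. (\<Prod>p\<in>F. w p) * M (y / real (\<Prod>F))) has_sum S y) (Fpow primes)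
        \<longleftrightarrow> ((\<lambda>F. (\<Prod>p\<in>F. local_factor p) * of_nat (\<Prod>F) ^ Suc r * M (y / real (\<Prod>F))) has_sum S y) (Fpow primes)"
      by (intro has_sum_cong) (simp only: w_def prod_weights(2))
    then show "((\<lambda>F. (\<Prod>p\<in>F. w p) * M (y / real (\<Prod>F))) has_sum S y) (Fpow primes)" using M[OF y] by blast
  qed
qed

text \<open>With \<open>n = q * j\<close> and trivial weights this is the Riesz mean of
  \<open>\<Sum>d|n. \<psi> d\<close>.\<close>

definition divisor_mean :: "real \<Rightarrow> complex" where
  "divisor_mean y = (\<Sum>q\<in>nats_upto y. \<psi> q * (\<Sum>j\<in>nats_upto (y / real q). of_real (y - real q * real j)) * weight q)"

definition riesz_mean :: "real \<Rightarrow> complex" where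
  "riesz_mean y = (\<Sum>q\<in>nats_upto y. \<psi> q * of_real (y - real q) * weight q)"

definition plain_mean :: "real \<Rightarrow> complex" where
  "plain_mean y = (\<Sum>q\<in>nats_upto y. \<psi> q * weight q)"

text \<open>At \<open>y / P\<close> the logarithm splits into \<open>ln y - ln P\<close>. Summed
  against the local factors, the first part yields \<open>density\<close> and the second the product
  \<open>density * log_density\<close>.\<close>

lemma divisor_mean_asymptotics:
  "\<exists>C. \<forall>y>0. norm (divisor_mean y - of_real (y\<^sup>2) *
      (density * (\<alpha> / 2 * of_real (ln y) + (\<beta> / 2 - \<alpha> / 4)) - \<alpha> / 2 * (density * log_density))) \<le> C * y powr (1 + \<theta>)"
proof -
  define G where "G X = (\<Sum>n\<in>nats_upto X. (\<Sum>d | d dvd n. \<psi> d) * of_real (X - real n))" for X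
  define M where "M X = of_real (X\<^sup>2) * (\<alpha> / 2 * of_real (ln X) + (\<beta> / 2 - \<alpha> / 4))" for X
  obtain C where C: "\<And>X. X > 0 \<Longrightarrow> norm (G X - M X) \<le> C * X powr (real 1 + \<theta>)"
    using riesz_divisor_sum[OF \<theta>] unfolding G_def M_def of_nat_1 by blast
  define a where "a y q = \<psi> q * (\<Sum>j\<in>nats_upto (y / real q). of_real (y - real q * real j))" for y q
  have "\<exists>C. \<forall>y>0. norm ((\<Sum>q\<in>nats_upto y. a y q * weight q) - of_real (y\<^sup>2) *
      (density * (\<alpha> / 2 * of_real (ln y) + (\<beta> / 2 - \<alpha> / 4)) + - (\<alpha> / 2 * (density * log_density))))
    \<le> C * y powr (real 1 + \<theta>)"
  proof (rule weighted_sum_transfer[OF C])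
    fix y :: real and P :: nat assume P: "P > 0"
    have "(\<Sum>n\<in>nats_upto (y / real P). a y (n * P))
            = (\<Sum>d\<in>nats_upto (y / real P). \<Sum>j\<in>nats_upto (y / real P / real d).
                 \<psi> P * of_nat P * (\<psi> d * of_real (y / real P - real (d * j))))"
    proof (intro sum.cong refl)
      fix n assume "n \<in> nats_upto (y / real P)"
      have "a y (n * P) = (\<Sum>j\<in>nats_upto (y / real P / real n). \<psi> (n * P) * of_real (y - real (n * P) * real j))"
        unfolding a_def sum_distrib_left by (simp add: mult.commute)
      also have "\<dots> = (\<Sum>j\<in>nats_upto (y / real P / real n). \<psi> P * of_nat P * (\<psi> n * of_real (y / real P - real (n * j))))"
      proof (intro sum.cong refl)
        fix j
        have "y - real (n * P) * real j = real P * (y / real P - real (n * j))"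
          using P by (simp add: field_simps)
        then show "\<psi> (n * P) * of_real (y - real (n * P) * real j)
                     = \<psi> P * of_nat P * (\<psi> n * of_real (y / real P - real (n * j)))"
          by (simp only: mult of_real_mult of_real_of_nat_eq mult_ac)
      qed
      finally show "a y (n * P) = (\<Sum>j\<in>nats_upto (y / real P / real n). \<psi> P * of_nat P * (\<psi> n * of_real (y / real P - real (n * j))))" .
    qed
    also have "\<dots> = \<psi> P * of_nat P ^ 1 * G (y / real P)"
      unfolding G_def sum_distrib_right power_one_right
      unfolding sum_nats_upto_divisors[of "\<lambda>d n. \<psi> d * of_real (y / real P - real n)" "y / real P"]
      by (simp only: sum_distrib_left)
    finally show "(\<Sum>n\<in>nats_upto (y / real P). a y (n * P)) = \<psi> P * of_nat P ^ 1 * G (y / real P)" .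
  next
    fix y :: real assume y: "y > 0"
    have "((\<lambda>F. of_real (y\<^sup>2) * ((\<Prod>p\<in>F. local_factor p) * (\<alpha> / 2 * of_real (ln y) + (\<beta> / 2 - \<alpha> / 4))
              + - (\<alpha> / 2 * ((\<Prod>p\<in>F. local_factor p) * of_real (ln (real (\<Prod>F)))))))
        has_sum of_real (y\<^sup>2) * (density * (\<alpha> / 2 * of_real (ln y) + (\<beta> / 2 - \<alpha> / 4)) + - (\<alpha> / 2 * (density * log_density))))
        (Fpow primes)"
      by (intro has_sum_cmult_right has_sum_add has_sum_uminusI has_sum_cmult_left has_sum_density has_sum_density_log)
    then show "((\<lambda>F. (\<Prod>p\<in>F. local_factor p) * of_nat (\<Prod>F) ^ Suc 1 * M (y / real (\<Prod>F)))
        has_sum of_real (y\<^sup>2) * (density * (\<alpha> / 2 * of_real (ln y) + (\<beta> / 2 - \<alpha> / 4)) + - (\<alpha> / 2 * (density * log_density))))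
        (Fpow primes)"
    proof (rule has_sum_cong[THEN iffD1, rotated])
      fix F assume F: "F \<in> Fpow primes"
      define P where "P = \<Prod>F"
      have P: "real P > 0" using Prod_primes_pos[OF F] by (simp add: P_def del: of_nat_prod)
      have "M (y / real P) = of_real (y\<^sup>2) / of_nat P ^ 2 * (\<alpha> / 2 * of_real (ln y - ln (real P)) + (\<beta> / 2 - \<alpha> / 4))"
        using P y by (simp add: M_def ln_div power_divide)
      then have "(\<Prod>p\<in>F. local_factor p) * of_nat P ^ Suc 1 * M (y / real P)
          = of_real (y\<^sup>2) * ((\<Prod>p\<in>F. local_factor p) * (\<alpha> / 2 * of_real (ln y - ln (real P)) + (\<beta> / 2 - \<alpha> / 4)))"
        using P by (simp add: power2_eq_square)
      also have "\<dots> = of_real (y\<^sup>2) * ((\<Prod>p\<in>F. local_factor p) * (\<alpha> / 2 * of_real (ln y) + (\<beta> / 2 - \<alpha> / 4))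
              + - (\<alpha> / 2 * ((\<Prod>p\<in>F. local_factor p) * of_real (ln (real P)))))"
        by (simp add: algebra_simps)
      finally show "of_real (y\<^sup>2) * ((\<Prod>p\<in>F. local_factor p) * (\<alpha> / 2 * of_real (ln y) + (\<beta> / 2 - \<alpha> / 4))
              + - (\<alpha> / 2 * ((\<Prod>p\<in>F. local_factor p) * of_real (ln (real (\<Prod>F))))))
          = (\<Prod>p\<in>F. local_factor p) * of_nat (\<Prod>F) ^ Suc 1 * M (y / real (\<Prod>F))"
        unfolding P_def by (rule sym)
    qed
  qed
  then show ?thesis by (simp add: divisor_mean_def a_def)
qed

lemma riesz_mean_asymptotics:
  "\<exists>C. \<forall>y>0. norm (riesz_mean y - of_real (y\<^sup>2) * (\<alpha> / 2 * density)) \<le> C * y powr (1 + \<theta>)"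
proof -
  define G where "G X = (\<Sum>n\<in>nats_upto X. \<psi> n * of_real (X - real n))" for X
  define M where "M X = of_real (X\<^sup>2) * (\<alpha> / 2)" for X :: real
  have "0 \<le> \<theta>" using \<theta> by simp
  then obtain C where C: "\<And>X. X > 0 \<Longrightarrow> norm (G X - M X) \<le> C * X powr (real 1 + \<theta>)"
    using riesz_partial_sum[OF _ \<theta>(2)] unfolding G_def M_def of_nat_1 by blast
  have "\<exists>C. \<forall>y>0. norm ((\<Sum>q\<in>nats_upto y. \<psi> q * of_real (y - real q) * weight q)
      - of_real (y\<^sup>2) * (\<alpha> / 2 * density)) \<le> C * y powr (real 1 + \<theta>)"
  proof (rule weighted_sum_transfer[OF C])
    fix y :: real and P :: nat assume P: "P > 0"
    show "(\<Sum>n\<in>nats_upto (y / real P). \<psi> (n * P) * of_real (y - real (n * P))) = \<psi> P * of_nat P ^ 1 * G (y / real P)"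
      unfolding G_def sum_distrib_left power_one_right
    proof (intro sum.cong refl)
      fix n
      have "y - real (n * P) = real P * (y / real P - real n)" using P by (simp add: field_simps)
      then show "\<psi> (n * P) * of_real (y - real (n * P)) = \<psi> P * of_nat P * (\<psi> n * of_real (y / real P - real n))"
        by (simp only: mult of_real_mult of_real_of_nat_eq mult_ac)
    qed
  next
    fix y :: real assume y: "y > 0"
    have "((\<lambda>F. of_real (y\<^sup>2) * (\<alpha> / 2 * (\<Prod>p\<in>F. local_factor p))) has_sum of_real (y\<^sup>2) * (\<alpha> / 2 * density)) (Fpow primes)"
      by (intro has_sum_cmult_right has_sum_density)
    then show "((\<lambda>F. (\<Prod>p\<in>F. local_factor p) * of_nat (\<Prod>F) ^ Suc 1 * M (y / real (\<Prod>F)))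
        has_sum of_real (y\<^sup>2) * (\<alpha> / 2 * density)) (Fpow primes)"
    proof (rule has_sum_cong[THEN iffD1, rotated])
      fix F assume "F \<in> Fpow primes"
      then have "of_nat (\<Prod>F) \<noteq> (0 :: complex)" using Prod_primes_pos by (metis of_nat_eq_0_iff less_irrefl)
      then show "of_real (y\<^sup>2) * (\<alpha> / 2 * (\<Prod>p\<in>F. local_factor p))
          = (\<Prod>p\<in>F. local_factor p) * of_nat (\<Prod>F) ^ Suc 1 * M (y / real (\<Prod>F))"
        by (simp add: M_def power_divide power2_eq_square del: of_nat_prod)
    qed
  qed
  then show ?thesis by (simp add: riesz_mean_def)
qed

lemma plain_mean_asymptotics:
  "\<exists>C. \<forall>y>0. norm (plain_mean y - of_real y * (\<alpha> * density)) \<le> C * y powr \<theta>"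
proof -
  define G where "G X = (\<Sum>n\<in>nats_upto X. \<psi> n)" for X
  have C: "norm (G X - \<alpha> * of_real X) \<le> (K + norm \<alpha>) * X powr (real 0 + \<theta>)" if "X > 0" for X
    using partial_sum_powr[of \<theta> X] \<theta> that by (simp add: G_def)
  have "\<exists>C. \<forall>y>0. norm ((\<Sum>q\<in>nats_upto y. \<psi> q * weight q) - of_real y * (\<alpha> * density)) \<le> C * y powr (real 0 + \<theta>)"
  proof (rule weighted_sum_transfer[OF C])
    fix y :: real and P :: nat
    show "(\<Sum>n\<in>nats_upto (y / real P). \<psi> (n * P)) = \<psi> P * of_nat P ^ 0 * G (y / real P)"
      by (simp add: G_def mult sum_distrib_left mult.commute)
  next
    fix y :: real assume y: "y > 0"
    have "((\<lambda>F. of_real y * (\<alpha> * (\<Prod>p\<in>F. local_factor p))) has_sum of_real y * (\<alpha> * density)) (Fpow primes)"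
      by (intro has_sum_cmult_right has_sum_density)
    then show "((\<lambda>F. (\<Prod>p\<in>F. local_factor p) * of_nat (\<Prod>F) ^ Suc 0 * (\<alpha> * of_real (y / real (\<Prod>F))))
        has_sum of_real y * (\<alpha> * density)) (Fpow primes)"
    proof (rule has_sum_cong[THEN iffD1, rotated])
      fix F assume "F \<in> Fpow primes"
      then have "of_nat (\<Prod>F) \<noteq> (0 :: complex)" using Prod_primes_pos by (metis of_nat_eq_0_iff less_irrefl)
      then show "of_real y * (\<alpha> * (\<Prod>p\<in>F. local_factor p))
          = (\<Prod>p\<in>F. local_factor p) * of_nat (\<Prod>F) ^ Suc 0 * (\<alpha> * of_real (y / real (\<Prod>F)))"
        by (simp del: of_nat_prod)
    qed
  qed
  then show ?thesis by (simp add: plain_mean_def)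
qed

text \<open>The pairs with \<open>q * j \<le> 2 * Q\<close> include some with \<open>q > Q\<close>,
  which do not belong to the sum. For these only \<open>j = 1\<close> occurs, so they cancel in
  \<open>divisor_mean (2 * Q) - riesz_mean (2 * Q)\<close>. In units of \<open>4 * Q\<^sup>2\<close>
  the multiples of \<alpha> add up to \<open>- 1/2 - 1 + 1/8 + 1/4 = - 9/8\<close>; they come from
  the divisor mean, the Riesz mean at \<open>2 * Q\<close>, the Riesz mean at \<open>Q\<close> and
  the plain mean.\<close>

theorem quadratic_weight_mean:
  "\<exists>C. \<forall>Q\<ge>1. norm ((\<Sum>q\<in>nats_upto Q. \<psi> q * weight q *
         of_real (real q - 2 * Q + 2 * (\<Sum>j\<in>nats_upto (2 * Q / real q). 2 * Q - real q * real j)))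
      - 4 * of_real (Q\<^sup>2) * (density * (\<alpha> * (of_real (ln (2 * Q)) - 9 / 8) + \<beta>) - \<alpha> * (density * log_density)))
      \<le> C * Q powr (1 + \<theta>)"
proof -
  define MT where "MT y = of_real (y\<^sup>2) * (density * (\<alpha> / 2 * of_real (ln y) + (\<beta> / 2 - \<alpha> / 4)) - \<alpha> / 2 * (density * log_density))" for y
  define MU where "MU y = of_real (y\<^sup>2) * (\<alpha> / 2 * density)" for y :: real
  define MV where "MV y = of_real y * (\<alpha> * density)" for y :: real
  obtain CT where CT: "\<And>y. y > 0 \<Longrightarrow> norm (divisor_mean y - MT y) \<le> CT * y powr (1 + \<theta>)"
    using divisor_mean_asymptotics unfolding MT_def by blast
  obtain CU where CU: "\<And>y. y > 0 \<Longrightarrow> norm (riesz_mean y - MU y) \<le> CU * y powr (1 + \<theta>)"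
    using riesz_mean_asymptotics unfolding MU_def by blast
  obtain CV where CV: "\<And>y. y > 0 \<Longrightarrow> norm (plain_mean y - MV y) \<le> CV * y powr \<theta>"
    using plain_mean_asymptotics unfolding MV_def by blast
  define C where "C = (2 * CT + 2 * CU) * 2 powr (1 + \<theta>) + CU + CV"
  show ?thesis
  proof (intro exI allI impI)
    fix Q :: real assume Q: "Q \<ge> 1"
    have split: "(\<Sum>q\<in>nats_upto (2 * Q). z q) = (\<Sum>q\<in>nats_upto (2 * Q) - nats_upto Q. z q) + (\<Sum>q\<in>nats_upto Q. z q)"
      for z :: "nat \<Rightarrow> complex"
      by (rule sum.subset_diff) (use Q in \<open>auto simp: in_nats_upto_iff\<close>)
    have "(\<Sum>q\<in>nats_upto (2 * Q) - nats_upto Q. \<psi> q * (\<Sum>j\<in>nats_upto (2 * Q / real q). of_real (2 * Q - real q * real j)) * weight q)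
        = (\<Sum>q\<in>nats_upto (2 * Q) - nats_upto Q. \<psi> q * of_real (2 * Q - real q) * weight q)"
    proof (intro sum.cong refl)
      fix q assume "q \<in> nats_upto (2 * Q) - nats_upto Q"
      then have q: "0 < real q" "Q < real q" "real q \<le> 2 * Q" by (auto simp: in_nats_upto_iff)
      have "nats_upto (2 * Q / real q) = {1}"
      proof -
        have "2 * Q / real q \<ge> 1" "2 * Q / real q < 2" using q by (simp_all add: field_simps)
        then have "\<lfloor>2 * Q / real q\<rfloor> = 1" by (intro floor_unique) auto
        then show ?thesis by (simp add: nats_upto_eq)
      qed
      then show "\<psi> q * (\<Sum>j\<in>nats_upto (2 * Q / real q). of_real (2 * Q - real q * real j)) * weight q
          = \<psi> q * of_real (2 * Q - real q) * weight q" by simp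
    qed
    then have TU: "divisor_mean (2 * Q) - riesz_mean (2 * Q) = (\<Sum>q\<in>nats_upto Q. \<psi> q * weight q *
        (of_real (\<Sum>j\<in>nats_upto (2 * Q / real q). 2 * Q - real q * real j) - of_real (2 * Q - real q)))"
      unfolding divisor_mean_def riesz_mean_def split by (simp add: algebra_simps flip: sum_subtractf)
    have UV: "riesz_mean Q + of_real Q * plain_mean Q = (\<Sum>q\<in>nats_upto Q. \<psi> q * weight q * of_real (2 * Q - real q))"
      unfolding riesz_mean_def plain_mean_def sum_distrib_left sum.distrib[symmetric] by (intro sum.cong) (auto simp: algebra_simps)
    \<comment> \<open>With \<open>J\<close> for the sum over \<open>j\<close>, the identity used is
      \<open>q - 2 * Q + 2 * J = 2 * (J - (2 * Q - q)) + (2 * Q - q)\<close>; subtracting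
      \<open>2 * Q - q\<close> from \<open>J\<close> drops its term \<open>j = 1\<close>.\<close>
    have "(\<Sum>q\<in>nats_upto Q. \<psi> q * weight q *
         of_real (real q - 2 * Q + 2 * (\<Sum>j\<in>nats_upto (2 * Q / real q). 2 * Q - real q * real j)))
      = 2 * (divisor_mean (2 * Q) - riesz_mean (2 * Q)) + (riesz_mean Q + of_real Q * plain_mean Q)"
    proof -
      define J where "J q = (\<Sum>j\<in>nats_upto (2 * Q / real q). 2 * Q - real q * real j)" for q
      show ?thesis
        unfolding TU UV J_def[symmetric] sum_distrib_left[of 2 _ "nats_upto Q"] sum.distrib[symmetric]
        by (intro sum.cong) (simp_all add: algebra_simps)
    qed
    moreover have "4 * of_real (Q\<^sup>2) * (density * (\<alpha> * (of_real (ln (2 * Q)) - 9 / 8) + \<beta>) - \<alpha> * (density * log_density))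
        = 2 * (MT (2 * Q) - MU (2 * Q)) + (MU Q + of_real Q * MV Q)"
      unfolding MT_def MU_def MV_def by (simp add: power2_eq_square field_simps)
    ultimately have "(\<Sum>q\<in>nats_upto Q. \<psi> q * weight q *
         of_real (real q - 2 * Q + 2 * (\<Sum>j\<in>nats_upto (2 * Q / real q). 2 * Q - real q * real j)))
      - 4 * of_real (Q\<^sup>2) * (density * (\<alpha> * (of_real (ln (2 * Q)) - 9 / 8) + \<beta>) - \<alpha> * (density * log_density))
      = 2 * (divisor_mean (2 * Q) - MT (2 * Q)) - 2 * (riesz_mean (2 * Q) - MU (2 * Q)) + (riesz_mean Q - MU Q) + of_real Q * (plain_mean Q - MV Q)"
      by (simp add: algebra_simps)
    also have "norm \<dots> \<le> 2 * (CT * (2 * Q) powr (1 + \<theta>)) + 2 * (CU * (2 * Q) powr (1 + \<theta>))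
        + CU * Q powr (1 + \<theta>) + Q * (CV * Q powr \<theta>)"
    proof -
      have tri: "norm (a - b + c + d) \<le> norm a + norm b + norm c + norm d" for a b c d :: complex
        using norm_triangle_ineq[of "a - b + c" d] norm_triangle_ineq[of "a - b" c] norm_triangle_ineq4[of a b] by linarith
      have "norm (2 * (divisor_mean (2 * Q) - MT (2 * Q))) \<le> 2 * (CT * (2 * Q) powr (1 + \<theta>))"
        unfolding norm_mult using CT[of "2 * Q"] Q by simp
      moreover have "norm (2 * (riesz_mean (2 * Q) - MU (2 * Q))) \<le> 2 * (CU * (2 * Q) powr (1 + \<theta>))"
        unfolding norm_mult using CU[of "2 * Q"] Q by simp
      moreover have "norm (riesz_mean Q - MU Q) \<le> CU * Q powr (1 + \<theta>)" using CU[of Q] Q by simp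
      moreover have "norm (of_real Q * (plain_mean Q - MV Q)) \<le> Q * (CV * Q powr \<theta>)"
        unfolding norm_mult using CV[of Q] Q by (intro mult_mono) auto
      ultimately show ?thesis
        by (intro order_trans[OF tri] add_mono)
    qed
    also have "\<dots> = C * Q powr (1 + \<theta>)"
      using Q by (simp add: C_def powr_mult powr_add algebra_simps)
    finally show "norm ((\<Sum>q\<in>nats_upto Q. \<psi> q * weight q *
         of_real (real q - 2 * Q + 2 * (\<Sum>j\<in>nats_upto (2 * Q / real q). 2 * Q - real q * real j)))
      - 4 * of_real (Q\<^sup>2) * (density * (\<alpha> * (of_real (ln (2 * Q)) - 9 / 8) + \<beta>) - \<alpha> * (density * log_density)))
      \<le> C * Q powr (1 + \<theta>)" .
  qed
qed

end

section \<open>Dirichlet characters\<close>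

context
  fixes k :: nat
  assumes k: "k > 0"
begin

lemma character_cong:
  assumes "\<psi> \<in> dirichlet_characters k" "[m = n] (mod int k)"
  shows "\<psi> m = \<psi> n"
proof -
  have per: "\<psi> (n + int k) = \<psi> n" for n using assms by (auto simp: dirichlet_characters_def)
  have nat: "\<psi> (n + int k * int j) = \<psi> n" for n j
    by (induction j) (use per[of "n + int k * int _"] in \<open>auto simp: algebra_simps\<close>)
  obtain c where c: "m = n + int k * c" using assms(2) by (metis cong_iff_lin cong_sym)
  show ?thesis
  proof (cases "c \<ge> 0")
    case True
    then show ?thesis using nat[of n "nat c"] c by simp
  next
    case False
    then show ?thesis using nat[of m "nat (-c)"] c by (simp add: algebra_simps)
  qed
qed

lemma character_mult: "\<psi> \<in> dirichlet_characters k \<Longrightarrow> \<psi> (m * n) = \<psi> m * \<psi> n"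
  by (simp add: dirichlet_characters_def)

lemma character_nonzero_iff: "\<psi> \<in> dirichlet_characters k \<Longrightarrow> \<psi> n \<noteq> 0 \<longleftrightarrow> coprime n (int k)"
  by (simp add: dirichlet_characters_def)

lemma character_one:
  assumes "\<psi> \<in> dirichlet_characters k"
  shows "\<psi> 1 = 1"
  using character_mult[OF assms, of 1 1] character_nonzero_iff[OF assms, of 1] by simp

lemma character_power: "\<psi> \<in> dirichlet_characters k \<Longrightarrow> \<psi> (n ^ i) = \<psi> n ^ i"
  by (induction i) (simp_all add: character_mult character_one)

lemma int_euler_theorem:
  assumes "coprime n (int k)"
  shows "[n ^ totient k = 1] (mod int k)"
proof -
  define r where "r = nat (n mod int k)"
  have r: "int r = n mod int k" using k by (simp add: r_def)
  have "coprime (int r) (int k)" using assms k by (simp add: r coprime_mod_left_iff)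
  then have "[r ^ totient k = 1] (mod k)" by (intro euler_theorem) simp
  then have "[int (r ^ totient k) = int 1] (mod int k)" by (simp only: cong_int_iff)
  then have "[(n mod int k) ^ totient k = 1] (mod int k)" by (simp add: r)
  then show ?thesis by (simp add: cong_def power_mod)
qed

lemma character_root_of_unity:
  assumes "\<psi> \<in> dirichlet_characters k" "coprime n (int k)"
  shows "\<psi> n ^ totient k = 1"
  using character_cong[OF assms(1) int_euler_theorem[OF assms(2)]] character_one[OF assms(1)]
  by (simp add: character_power[OF assms(1)])

lemma norm_character:
  assumes "\<psi> \<in> dirichlet_characters k"
  shows "norm (\<psi> n) = (if coprime n (int k) then 1 else 0)"
proof (cases "coprime n (int k)")
  case True
  have "norm (\<psi> n) ^ totient k = 1"
    using character_root_of_unity[OF assms True] by (simp flip: norm_power)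
  then have "norm (\<psi> n) = 1" using k power_eq_iff_eq_base[of "totient k" "norm (\<psi> n)" 1] by simp
  then show ?thesis using True by simp
qed (use character_nonzero_iff[OF assms, of n] in auto)

lemma principal_character_in: "principal_character k \<in> dirichlet_characters k"
proof -
  have "coprime (n + int k) (int k) \<longleftrightarrow> coprime n (int k)" for n
    unfolding coprime_iff_gcd_eq_1 by (simp only: gcd_add1)
  then show ?thesis by (simp add: dirichlet_characters_def principal_character_def)
qed

text \<open>A character is determined by its values on one residue system, and each value is 0 or a
  root of unity of fixed order.\<close>

lemma finite_dirichlet_characters: "finite (dirichlet_characters k)"
proof (rule finite_imageD)
  let ?R = "insert 0 {z :: complex. z ^ totient k = 1}"
  have "finite {z :: complex. z ^ totient k = 1}"
    using k by (intro finite_roots_unity) (simp add: Suc_le_eq)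
  then have "finite ?R" by (rule finite.insertI)
  then have "finite (PiE {0..<int k} (\<lambda>_. ?R))" by (rule finite_PiE[OF finite_atLeastLessThan_int])
  moreover have "(\<lambda>\<psi>. restrict \<psi> {0..<int k}) ` dirichlet_characters k \<subseteq> PiE {0..<int k} (\<lambda>_. ?R)"
  proof (rule image_subsetI)
    fix \<psi> assume "\<psi> \<in> dirichlet_characters k"
    then have "\<psi> n \<in> ?R" for n
      using character_nonzero_iff[of \<psi> n] character_root_of_unity[of \<psi> n] by blast
    then show "restrict \<psi> {0..<int k} \<in> PiE {0..<int k} (\<lambda>_. ?R)" unfolding restrict_PiE_iff by blast
  qed
  ultimately show "finite ((\<lambda>\<psi>. restrict \<psi> {0..<int k}) ` dirichlet_characters k)"
    by (rule finite_subset[rotated])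
  show "inj_on (\<lambda>\<psi>. restrict \<psi> {0..<int k}) (dirichlet_characters k)"
  proof (rule inj_onI, rule ext)
    fix \<psi> \<phi> n assume *: "\<psi> \<in> dirichlet_characters k" "\<phi> \<in> dirichlet_characters k"
      "restrict \<psi> {0..<int k} = restrict \<phi> {0..<int k}"
    have "n mod int k \<in> {0..<int k}" using k by simp
    then have "\<psi> (n mod int k) = \<phi> (n mod int k)" using *(3) by (metis restrict_apply')
    moreover have "[n mod int k = n] (mod int k)" by (simp add: cong_def)
    ultimately show "\<psi> n = \<phi> n" using character_cong[OF *(1)] character_cong[OF *(2)] by metis
  qed
qed

text \<open>
  Characters are found as simultaneous eigenfunctions of all translations \<open>F \<mapsto> F(x \<cdot>)\<close>
  by units \<open>x\<close>: these operators commute and have finite order, so each of them has the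
  averages below as eigenprojections.
\<close>

definition unit_function :: "(int \<Rightarrow> complex) \<Rightarrow> bool" where
  "unit_function F \<longleftrightarrow> (\<forall>m n. [m = n] (mod int k) \<longrightarrow> F m = F n) \<and>
     (\<forall>n. \<not> coprime n (int k) \<longrightarrow> F n = 0) \<and> (\<exists>n. F n \<noteq> 0)"

lemma sum_roots_of_unity_powers:
  assumes "0 < i" "i < m"
  shows "(\<Sum>j<m. cis (2 * pi * real j / real m) ^ i) = 0"
proof -
  define w where "w = cis (2 * pi * real i / real m)"
  have m: "m > 0" using assms by simp
  have "cis (2 * pi * real j / real m) ^ i = w ^ j" for j
    by (simp add: w_def Complex.DeMoivre mult_ac)
  then have "(\<Sum>j<m. cis (2 * pi * real j / real m) ^ i) = (\<Sum>j<m. w ^ j)" by simp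
  moreover have "w \<noteq> 1"
  proof
    assume "w = 1"
    then have "cis (2 * pi * real i / real m) = cis (2 * pi * real 0 / real m)" by (simp add: w_def)
    then have "i = 0"
      using inj_onD[OF bij_betw_imp_inj_on[OF Complex.bij_betw_roots_unity[OF m]], of i 0] assms m by simp
    then show False using assms by simp
  qed
  moreover have "w ^ m = 1"
    using m cis_multiple_2pi[of "real i"] by (simp only: w_def Complex.DeMoivre) simp
  ultimately show ?thesis using geometric_sum[of w m] by simp
qed

text \<open>The averages for all \<open>m\<close>-th roots of unity add up to \<open>m * F\<close>,
  so at a point where \<open>F\<close> does not vanish one of them does not vanish either.\<close>

lemma exists_eigenprojection:
  assumes F: "unit_function F" and x: "coprime x (int k)"
  defines "m \<equiv> totient k"
  shows "\<exists>z. z ^ m = 1 \<and> unit_function (\<lambda>n. \<Sum>i<m. z ^ i * F (x ^ i * n)) \<and>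
           (\<forall>n. z * (\<Sum>i<m. z ^ i * F (x ^ i * (x * n))) = (\<Sum>i<m. z ^ i * F (x ^ i * n)))"
proof -
  have m: "m > 0" using k by (simp add: m_def)
  have Fc: "F a = F b" if "[a = b] (mod int k)" for a b using F that by (auto simp: unit_function_def)
  obtain n0 where n0: "F n0 \<noteq> 0" using F by (auto simp: unit_function_def)
  define z where "z j = cis (2 * pi * real j / real m)" for j
  have zm: "z j ^ m = 1" for j
    using m cis_multiple_2pi[of "real j"] by (simp only: z_def Complex.DeMoivre) simp
  have "(\<Sum>j<m. \<Sum>i<m. z j ^ i * F (x ^ i * n0)) = (\<Sum>i<m. (\<Sum>j<m. z j ^ i) * F (x ^ i * n0))"
    by (subst sum.swap) (simp add: sum_distrib_right)
  also have "\<dots> = (\<Sum>i<m. if i = 0 then of_nat m * F n0 else 0)"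
  proof (intro sum.cong refl)
    fix i assume "i \<in> {..<m}"
    then show "(\<Sum>j<m. z j ^ i) * F (x ^ i * n0) = (if i = 0 then of_nat m * F n0 else 0)"
      using sum_roots_of_unity_powers[of i m] by (auto simp: z_def)
  qed
  also have "\<dots> = of_nat m * F n0" using m by simp
  finally have "(\<Sum>j<m. \<Sum>i<m. z j ^ i * F (x ^ i * n0)) \<noteq> 0" using n0 m by simp
  then obtain j where j: "(\<Sum>i<m. z j ^ i * F (x ^ i * n0)) \<noteq> 0" by (meson sum.neutral)
  have "unit_function (\<lambda>n. \<Sum>i<m. z j ^ i * F (x ^ i * n))"
    unfolding unit_function_def
  proof (intro conjI allI impI)
    fix a b assume "[a = b] (mod int k)"
    then have "F (x ^ i * a) = F (x ^ i * b)" for i by (intro Fc cong_scalar_left)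
    then show "(\<Sum>i<m. z j ^ i * F (x ^ i * a)) = (\<Sum>i<m. z j ^ i * F (x ^ i * b))" by simp
  next
    fix n assume "\<not> coprime n (int k)"
    then have "F (x ^ i * n) = 0" for i using F by (auto simp: unit_function_def)
    then show "(\<Sum>i<m. z j ^ i * F (x ^ i * n)) = 0" by simp
  qed (use j in blast)
  moreover have "z j * (\<Sum>i<m. z j ^ i * F (x ^ i * (x * n))) = (\<Sum>i<m. z j ^ i * F (x ^ i * n))" for n
  proof -
    \<comment> \<open>The translation shifts the average by one index. The term \<open>i = m\<close>
      that enters equals the term \<open>i = 0\<close> that leaves, since \<open>z j ^ m = 1\<close>
      and \<open>x ^ m\<close> is 1 modulo \<open>k\<close>.\<close>
    have "z j * (\<Sum>i<m. z j ^ i * F (x ^ i * (x * n))) = (\<Sum>i<m. z j ^ Suc i * F (x ^ Suc i * n))"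
      by (simp add: sum_distrib_left mult_ac)
    also have "\<dots> + z j ^ 0 * F (x ^ 0 * n) = (\<Sum>i<Suc m. z j ^ i * F (x ^ i * n))"
      by (subst sum.lessThan_Suc_shift) (simp add: add.commute)
    also have "\<dots> = (\<Sum>i<m. z j ^ i * F (x ^ i * n)) + F (x ^ m * n)"
      by (simp add: zm)
    also have "F (x ^ m * n) = F n"
      using int_euler_theorem[OF x] cong_scalar_right[of "x ^ m" 1 "int k" n] by (intro Fc) (simp add: m_def)
    finally show ?thesis by simp
  qed
  ultimately show ?thesis using zm by blast
qed

text \<open>Translations commute, so projecting onto an eigenspace of a further unit preserves all
  relations obtained before. The relation for \<open>a\<close> is carried along so that its
  eigenvalue can be prescribed.\<close>

lemma exists_simultaneous_eigenfunction:
  assumes "finite S" "\<And>x. x \<in> S \<Longrightarrow> coprime x (int k)"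
    and "unit_function F" "\<And>n. F (a * n) = \<mu> * F n"
  shows "\<exists>G. unit_function G \<and> (\<forall>n. G (a * n) = \<mu> * G n) \<and> (\<forall>x\<in>S. \<exists>\<nu>. \<forall>n. G (x * n) = \<nu> * G n)"
  using assms(1,2)
proof (induction S rule: finite_induct)
  case empty
  then show ?case using assms by blast
next
  case (insert x S)
  then obtain F where F: "unit_function F" "\<And>n. F (a * n) = \<mu> * F n"
    and S: "\<And>y. y \<in> S \<Longrightarrow> \<exists>\<nu>. \<forall>n. F (y * n) = \<nu> * F n" by auto
  define m where "m = totient k"
  obtain z where z: "z ^ m = 1" "unit_function (\<lambda>n. \<Sum>i<m. z ^ i * F (x ^ i * n))"
    "\<And>n. z * (\<Sum>i<m. z ^ i * F (x ^ i * (x * n))) = (\<Sum>i<m. z ^ i * F (x ^ i * n))"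
    using exists_eigenprojection[OF F(1), of x] insert.prems unfolding m_def by auto
  define G where "G n = (\<Sum>i<m. z ^ i * F (x ^ i * n))" for n
  have transfer: "G (y * n) = \<nu> * G n" if "\<And>n. F (y * n) = \<nu> * F n" for y \<nu> n
  proof -
    have "F (x ^ i * (y * n)) = \<nu> * F (x ^ i * n)" for i
      using that[of "x ^ i * n"] by (simp add: mult_ac)
    then show ?thesis by (simp add: G_def sum_distrib_left mult_ac)
  qed
  have z0: "z \<noteq> 0"
  proof
    assume "z = 0"
    then show False using z(1) k by (simp add: m_def power_0_left split: if_splits)
  qed
  have "G (x * n) = inverse z * G n" for n
    using z(3)[of n] z0 unfolding G_def by (simp add: field_simps)
  moreover have "\<exists>\<nu>. \<forall>n. G (y * n) = \<nu> * G n" if "y \<in> S" for y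
    using S[OF that] transfer by blast
  moreover have "\<forall>n. G (a * n) = \<mu> * G n" using transfer[OF F(2)] by blast
  moreover have "unit_function G" using z(2) unfolding G_def .
  ultimately show ?case by (intro exI[of _ G]) auto
qed

text \<open>The construction starts from the difference \<open>F\<close> of the indicator of 1
  modulo \<open>k\<close> and its translate by \<open>a\<close>, which is non-zero because
  \<open>a\<close> is not 1 modulo \<open>k\<close>. Being a difference, it has no component with
  eigenvalue 1 under \<open>a\<close>, so the simultaneous eigenfunction grown from it separates
  \<open>a\<close> from 1.\<close>

lemma exists_separating_character:
  assumes a: "coprime a (int k)" "\<not> [a = 1] (mod int k)"
  shows "\<exists>\<psi>\<in>dirichlet_characters k. \<psi> a \<noteq> 1"
proof -
  define m where "m = totient k"
  define \<delta> :: "int \<Rightarrow> complex" where "\<delta> n = (if [n = 1] (mod int k) then 1 else 0)" for n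
  define F where "F n = \<delta> (a * n) - \<delta> n" for n
  have \<delta>c: "\<delta> x = \<delta> y" if "[x = y] (mod int k)" for x y
    using that unfolding \<delta>_def cong_def by simp
  have F: "unit_function F"
    unfolding unit_function_def
  proof (intro conjI allI impI)
    fix x y assume xy: "[x = y] (mod int k)"
    then show "F x = F y" unfolding F_def by (metis \<delta>c cong_scalar_left)
  next
    fix n assume n: "\<not> coprime n (int k)"
    have "\<not> [n = 1] (mod int k)" "\<not> [a * n = 1] (mod int k)"
      using n by (metis cong_imp_coprime cong_sym coprime_1_left coprime_mult_left_iff)+
    then show "F n = 0" by (simp add: F_def \<delta>_def)
  next
    show "\<exists>n. F n \<noteq> 0" using a by (intro exI[of _ 1]) (simp add: F_def \<delta>_def)
  qed
  obtain z where z: "z ^ m = 1" "unit_function (\<lambda>n. \<Sum>i<m. z ^ i * F (a ^ i * n))"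
    "\<And>n. z * (\<Sum>i<m. z ^ i * F (a ^ i * (a * n))) = (\<Sum>i<m. z ^ i * F (a ^ i * n))"
    using exists_eigenprojection[OF F a(1)] unfolding m_def by auto
  \<comment> \<open>For \<open>z = 1\<close> the average telescopes to
    \<open>\<delta> (a ^ m * n) - \<delta> n\<close>, which vanishes by Euler's theorem.\<close>
  have z1: "z \<noteq> 1"
  proof
    assume "z = 1"
    have "(\<Sum>i<m. z ^ i * F (a ^ i * n)) = (\<Sum>i<m. \<delta> (a ^ Suc i * n) - \<delta> (a ^ i * n))" for n
      using \<open>z = 1\<close> by (simp add: F_def mult_ac)
    also have "\<dots> n = \<delta> (a ^ m * n) - \<delta> (a ^ 0 * n)" for n by (rule sum_lessThan_telescope)
    also have "\<dots> n = 0" for n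
      using int_euler_theorem[OF a(1)] \<delta>c[OF cong_scalar_right, of "a ^ m" 1 n] by (simp add: m_def)
    finally show False using z(2) by (auto simp: unit_function_def)
  qed
  have z0: "z \<noteq> 0"
  proof
    assume "z = 0"
    then show False using z(1) k by (simp add: m_def power_0_left split: if_splits)
  qed
  define S where "S = {x \<in> {0..<int k}. coprime x (int k)}"
  have "\<exists>G. unit_function G \<and> (\<forall>n. G (a * n) = inverse z * G n) \<and> (\<forall>x\<in>S. \<exists>\<nu>. \<forall>n. G (x * n) = \<nu> * G n)"
  proof (rule exists_simultaneous_eigenfunction[OF _ _ z(2)])
    show "(\<Sum>i<m. z ^ i * F (a ^ i * (a * n))) = inverse z * (\<Sum>i<m. z ^ i * F (a ^ i * n))" for n
      using z(3)[of n] z0 by (simp add: field_simps)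
  qed (auto simp: S_def intro: finite_subset[of _ "{0..<int k}"])
  then obtain G where G: "unit_function G" "\<And>n. G (a * n) = inverse z * G n"
    and GS: "\<And>x. x \<in> S \<Longrightarrow> \<exists>\<nu>. \<forall>n. G (x * n) = \<nu> * G n" by blast
  have Gc: "G x = G y" if "[x = y] (mod int k)" for x y using G(1) that by (auto simp: unit_function_def)
  have Gz: "G x = 0" if "\<not> coprime x (int k)" for x using G(1) that by (auto simp: unit_function_def)
  have eigen: "\<exists>\<nu>. \<forall>n. G (x * n) = \<nu> * G n" if x: "coprime x (int k)" for x
  proof -
    have "x mod int k \<in> S" using x k by (auto simp: S_def)
    then obtain \<nu> where "\<forall>n. G ((x mod int k) * n) = \<nu> * G n" using GS by blast
    moreover have "G (x * n) = G ((x mod int k) * n)" for n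
      by (intro Gc cong_scalar_right) (simp add: cong_def)
    ultimately show ?thesis by auto
  qed
  \<comment> \<open>The eigenvalue of \<open>x\<close>, read off at \<open>n = 1\<close>, is
    \<open>G x / G 1\<close>; so \<open>G\<close> is multiplicative up to normalisation.\<close>
  have prod: "G (x * n) * G 1 = G x * G n" for x n
  proof (cases "coprime x (int k)")
    case True
    then obtain \<nu> where \<nu>: "\<And>n. G (x * n) = \<nu> * G n" using eigen by blast
    show ?thesis using \<nu>[of 1] \<nu>[of n] by simp
  next
    case False
    then show ?thesis by (simp add: Gz)
  qed
  obtain n0 where n0: "G n0 \<noteq> 0" using G(1) by (auto simp: unit_function_def)
  \<comment> \<open>Multiplying by an inverse of \<open>x\<close> leads back to \<open>G n0\<close>,
    so the eigenvalue of \<open>x\<close> is non-zero; and \<open>G 1 = 0\<close> would force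
    \<open>G n0 = 0\<close>.\<close>
  have nz: "G x \<noteq> 0" if x: "coprime x (int k)" for x
  proof -
    obtain y where y: "[x * y = 1] (mod int k)" using cong_solve_coprime_int[OF x] by blast
    have "coprime y (int k)"
      using y by (metis cong_imp_coprime cong_sym coprime_1_left coprime_mult_left_iff)
    have "G (x * (y * n0)) = G n0"
      using cong_scalar_right[OF y, of n0] by (intro Gc) (simp add: mult.assoc)
    moreover obtain \<nu> where "\<And>n. G (y * n) = \<nu> * G n"
      using eigen[OF \<open>coprime y (int k)\<close>] by blast
    moreover obtain \<mu> where "\<And>n. G (x * n) = \<mu> * G n"
      using eigen[OF x] by blast
    moreover have "G n0 * G 1 = G n0 * G 1" ..
    ultimately have \<mu>: "\<mu> \<noteq> 0" "G x = \<mu> * G 1" using n0 by (auto simp: mult.commute[of _ 1]) (metis mult.right_neutral)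
    have "G 1 \<noteq> 0"
    proof
      assume "G 1 = 0"
      moreover have "coprime n0 (int k)" using n0 Gz by blast
      ultimately show False using eigen[of n0] n0 by (metis mult.right_neutral mult_zero_right)
    qed
    with \<mu> show ?thesis by simp
  qed
  have G1: "G 1 \<noteq> 0" by (rule nz) simp
  define \<psi> where "\<psi> n = G n / G 1" for n
  have "\<psi> \<in> dirichlet_characters k"
    unfolding dirichlet_characters_def mem_Collect_eq
  proof (intro conjI allI)
    show "\<psi> (n + int k) = \<psi> n" for n
      unfolding \<psi>_def by (subst Gc[of "n + int k" n]) (auto simp: cong_def)
    show "\<psi> (x * n) = \<psi> x * \<psi> n" for x n
      using prod[of x n] G1 by (simp add: \<psi>_def field_simps)
    show "(\<psi> n \<noteq> 0) = coprime n (int k)" for n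
      using nz Gz G1 by (auto simp: \<psi>_def)
  qed
  moreover have "\<psi> a \<noteq> 1"
    using G(2)[of 1] G1 z1 by (simp add: \<psi>_def)
  ultimately show ?thesis by blast
qed


section \<open>Orthogonality relations\<close>

lemma bij_betw_mult_character:
  assumes \<phi>: "\<phi> \<in> dirichlet_characters k"
  shows "bij_betw (\<lambda>\<psi> n. \<phi> n * \<psi> n) (dirichlet_characters k) (dirichlet_characters k)"
proof (rule bij_betwI[where g = "\<lambda>\<psi> n. cnj (\<phi> n) * \<psi> n"])
  have "(\<lambda>n. \<phi> n * \<psi> n) \<in> dirichlet_characters k"
    if "\<phi> \<in> dirichlet_characters k" "\<psi> \<in> dirichlet_characters k" for \<phi> \<psi>
    using that by (simp add: dirichlet_characters_def)
  moreover have "(\<lambda>n. cnj (\<phi> n)) \<in> dirichlet_characters k"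
    using \<phi> by (simp add: dirichlet_characters_def)
  ultimately show "(\<lambda>\<psi> n. \<phi> n * \<psi> n) \<in> dirichlet_characters k \<rightarrow> dirichlet_characters k"
    "(\<lambda>\<psi> n. cnj (\<phi> n) * \<psi> n) \<in> dirichlet_characters k \<rightarrow> dirichlet_characters k"
    using \<phi> by auto
  have 1: "cnj (\<phi> n) * \<phi> n = 1" if "coprime n (int k)" for n
    using norm_character[OF \<phi>, of n] that complex_norm_square[of "\<phi> n"] by (simp add: mult.commute)
  have 2: "cnj (\<phi> n) * (\<phi> n * \<psi> n) = \<psi> n" "\<phi> n * (cnj (\<phi> n) * \<psi> n) = \<psi> n"
    if "\<psi> \<in> dirichlet_characters k" for \<psi> n
  proof -
    show a: "cnj (\<phi> n) * (\<phi> n * \<psi> n) = \<psi> n"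
    proof (cases "coprime n (int k)")
      case True
      then show ?thesis by (simp add: 1 flip: mult.assoc)
    next
      case False
      then have "\<psi> n = 0" using character_nonzero_iff[OF that] by blast
      then show ?thesis by simp
    qed
    then show "\<phi> n * (cnj (\<phi> n) * \<psi> n) = \<psi> n" by (simp add: mult.left_commute)
  qed
  show "(\<lambda>n. cnj (\<phi> n) * (\<phi> n * \<psi> n)) = \<psi>" "(\<lambda>n. \<phi> n * (cnj (\<phi> n) * \<psi> n)) = \<psi>"
    if "\<psi> \<in> dirichlet_characters k" for \<psi>
    using 2[OF that] by (simp_all add: fun_eq_iff)
qed

text \<open>Multiplication by a character that separates \<open>a\<close> from 1 permutes the
  characters, while it multiplies the sum by a factor other than 1.\<close>

lemma sum_characters_eq_0:
  assumes "\<not> [a = 1] (mod int k)"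
  shows "(\<Sum>\<psi>\<in>dirichlet_characters k. \<psi> a) = 0"
proof (cases "coprime a (int k)")
  case True
  then obtain \<phi> where \<phi>: "\<phi> \<in> dirichlet_characters k" "\<phi> a \<noteq> 1"
    using exists_separating_character assms by blast
  have "(\<Sum>\<psi>\<in>dirichlet_characters k. \<psi> a) = (\<Sum>\<psi>\<in>dirichlet_characters k. \<phi> a * \<psi> a)"
    using sum.reindex_bij_betw[OF bij_betw_mult_character[OF \<phi>(1)], of "\<lambda>\<psi>. \<psi> a"] by simp
  also have "\<dots> = \<phi> a * (\<Sum>\<psi>\<in>dirichlet_characters k. \<psi> a)" by (simp add: sum_distrib_left)
  finally have "(1 - \<phi> a) * (\<Sum>\<psi>\<in>dirichlet_characters k. \<psi> a) = 0" by (simp add: algebra_simps)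
  then show ?thesis using \<phi>(2) by simp
next
  case False
  then show ?thesis using character_nonzero_iff by (intro sum.neutral) blast
qed

lemma character_sum_residues:
  assumes \<psi>: "\<psi> \<in> dirichlet_characters k"
  shows "(\<Sum>n\<in>{0..<int k}. \<psi> n) = (if \<psi> = principal_character k then of_nat (totient k) else 0)"
proof (cases "\<psi> = principal_character k")
  case True
  have "(\<Sum>n\<in>{0..<int k}. \<psi> n) = (\<Sum>n\<in>int ` {0..<k}. if coprime n (int k) then 1 else 0)"
    by (simp add: True principal_character_def image_int_atLeastLessThan)
  also have "\<dots> = (\<Sum>n\<in>{0..<k}. if coprime n k then 1 else 0)"
    by (subst sum.reindex) (auto simp: o_def)
  also have "\<dots> = of_nat (card {n\<in>{0..<k}. coprime n k})"
    by (simp add: sum.If_cases Int_def)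
  also have "card {n\<in>{0..<k}. coprime n k} = totient k"
  \<comment> \<open>For \<open>k = 1\<close> the coprime residue is 0, whereas
    \<open>totatives 1\<close> is \<open>{1}\<close>; only the cardinalities agree.\<close>
  proof (cases "k = 1")
    case True
    then have "{n\<in>{0..<k}. coprime n k} = {0}" by auto
    then show ?thesis using True by simp
  next
    case False
    then have "{n\<in>{0..<k}. coprime n k} = totatives k"
      using k by (auto simp: totatives_def intro!: Nat.gr0I le_neq_implies_less)
    then show ?thesis by (simp add: totient_def)
  qed
  finally show ?thesis using True by simp
next
  case False
  then obtain b where "\<psi> b \<noteq> principal_character k b" by (auto simp: fun_eq_iff)
  then have b: "coprime b (int k)" "\<psi> b \<noteq> 1"
    using character_nonzero_iff[OF \<psi>, of b] by (auto simp: principal_character_def split: if_splits)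
  have inj: "inj_on (\<lambda>n. (b * n) mod int k) {0..<int k}"
  proof (rule inj_onI)
    fix x y assume xy: "x \<in> {0..<int k}" "y \<in> {0..<int k}" "(b * x) mod int k = (b * y) mod int k"
    then have "[x = y] (mod int k)"
      using b(1) by (simp add: cong_def[symmetric] cong_mult_lcancel)
    then show "x = y" using xy by (simp add: cong_def)
  qed
  have "(\<lambda>n. (b * n) mod int k) ` {0..<int k} = {0..<int k}"
    by (rule endo_inj_surj[OF _ _ inj]) (use k in auto)
  with inj have bij: "bij_betw (\<lambda>n. (b * n) mod int k) {0..<int k} {0..<int k}"
    by (simp add: bij_betw_def)
  have "\<psi> ((b * n) mod int k) = \<psi> b * \<psi> n" for n
    using character_cong[OF \<psi>, of "(b * n) mod int k" "b * n"] character_mult[OF \<psi>] by (simp add: cong_def)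
  then have "(\<Sum>n\<in>{0..<int k}. \<psi> n) = \<psi> b * (\<Sum>n\<in>{0..<int k}. \<psi> n)"
    using sum.reindex_bij_betw[OF bij, of \<psi>] by (simp add: sum_distrib_left)
  then have "(1 - \<psi> b) * (\<Sum>n\<in>{0..<int k}. \<psi> n) = 0" by (simp add: algebra_simps)
  then show ?thesis using b False by simp
qed

text \<open>The double sum over residues and characters receives a contribution only from the
  residue 1 in one order, and only from the principal character in the other.\<close>

lemma card_dirichlet_characters: "card (dirichlet_characters k) = totient k"
proof -
  have "(\<Sum>n\<in>{0..<int k}. \<Sum>\<psi>\<in>dirichlet_characters k. \<psi> n)
          = (\<Sum>n\<in>{0..<int k}. if n = 1 mod int k then of_nat (card (dirichlet_characters k)) else 0)"
  proof (intro sum.cong refl)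
    fix n assume n: "n \<in> {0..<int k}"
    show "(\<Sum>\<psi>\<in>dirichlet_characters k. \<psi> n)
        = (if n = 1 mod int k then of_nat (card (dirichlet_characters k)) else 0)"
    proof (cases "n = 1 mod int k")
      case True
      then have "\<psi> n = 1" if "\<psi> \<in> dirichlet_characters k" for \<psi>
        using character_cong[OF that, of n 1] character_one[OF that] by (simp add: cong_def)
      then have "(\<Sum>\<psi>\<in>dirichlet_characters k. \<psi> n) = (\<Sum>\<psi>\<in>dirichlet_characters k. 1)"
        by (intro sum.cong refl)
      then show ?thesis using True by simp
    next
      case False
      then show ?thesis using n by (simp add: sum_characters_eq_0 cong_def)
    qed
  qed
  also have "\<dots> = of_nat (card (dirichlet_characters k))" using k by simp
  also have "(\<Sum>n\<in>{0..<int k}. \<Sum>\<psi>\<in>dirichlet_characters k. \<psi> n)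
        = (\<Sum>\<psi>\<in>dirichlet_characters k. if \<psi> = principal_character k then of_nat (totient k) else (0 :: complex))"
    by (subst sum.swap) (intro sum.cong refl character_sum_residues)
  also have "\<dots> = of_nat (totient k)"
    using principal_character_in finite_dirichlet_characters by simp
  finally show ?thesis by (simp only: of_nat_eq_iff)
qed

lemma character_orthogonality:
  assumes u: "[u * ubar = 1] (mod int k)"
  shows "(\<Sum>\<psi>\<in>dirichlet_characters k. \<psi> ubar * \<psi> n) = (if [n = u] (mod int k) then of_nat (totient k) else 0)"
proof -
  have iff: "[ubar * n = 1] (mod int k) \<longleftrightarrow> [n = u] (mod int k)"
  proof
    assume *: "[ubar * n = 1] (mod int k)"
    have "[u * ubar * n = n] (mod int k)" using cong_scalar_right[OF u, of n] by simp
    moreover have "[u * (ubar * n) = u * 1] (mod int k)" by (rule cong_scalar_left[OF *])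
    ultimately show "[n = u] (mod int k)"
      by (metis cong_sym cong_trans mult.assoc mult.right_neutral)
  next
    assume "[n = u] (mod int k)"
    then have "[ubar * n = ubar * u] (mod int k)" by (rule cong_scalar_left)
    with u show "[ubar * n = 1] (mod int k)" by (metis cong_trans mult.commute)
  qed
  have "(\<Sum>\<psi>\<in>dirichlet_characters k. \<psi> ubar * \<psi> n) = (\<Sum>\<psi>\<in>dirichlet_characters k. \<psi> (ubar * n))"
    by (intro sum.cong) (simp_all add: character_mult)
  also have "\<dots> = (if [ubar * n = 1] (mod int k) then of_nat (totient k) else 0)"
  proof (cases "[ubar * n = 1] (mod int k)")
    case True
    then have "\<psi> (ubar * n) = 1" if "\<psi> \<in> dirichlet_characters k" for \<psi>
      using character_cong[OF that True] character_one[OF that] by simp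
    then have "(\<Sum>\<psi>\<in>dirichlet_characters k. \<psi> (ubar * n)) = (\<Sum>\<psi>\<in>dirichlet_characters k. 1)"
      by (intro sum.cong refl)
    then show ?thesis using True by (simp add: card_dirichlet_characters)
  qed (simp add: sum_characters_eq_0)
  finally show ?thesis by (simp add: iff)
qed

section \<open>Non-principal characters: bounded partial sums and the value of L at 1\<close>

context
  fixes \<psi> :: "int \<Rightarrow> complex"
  assumes \<psi>: "\<psi> \<in> dirichlet_characters k" and nonprincipal: "\<psi> \<noteq> principal_character k"
begin

lemma character_partial_sum_period:
  "(\<Sum>n\<in>{1..N + k}. \<psi> (int n)) = (\<Sum>n\<in>{1..N}. \<psi> (int n))"
proof (induction N)
  case 0
  have "(\<Sum>n\<in>{1..k}. \<psi> (int n)) = (\<Sum>n\<in>{0..<k}. \<psi> (int n))"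
  proof (rule sum.reindex_bij_witness[of _ "\<lambda>n. if n = 0 then k else n" "\<lambda>n. if n = k then 0 else n"])
    fix n assume "n \<in> {1..k}"
    show "\<psi> (int (if n = k then 0 else n)) = \<psi> (int n)"
      using character_cong[OF \<psi>, of 0 "int k"] by (simp add: cong_def)
  qed (use k in auto)
  also have "\<dots> = (\<Sum>n\<in>int ` {0..<k}. \<psi> n)" by (subst sum.reindex) auto
  also have "\<dots> = 0"
    using character_sum_residues[OF \<psi>] nonprincipal by (simp add: image_int_atLeastLessThan)
  finally show ?case by simp
next
  case (Suc N)
  have "\<psi> (int (Suc N + k)) = \<psi> (int (Suc N))"
    by (rule character_cong[OF \<psi>]) (simp only: cong_def of_nat_add mod_add_self2)
  with Suc show ?case by simp
qed

text \<open>Full periods sum to 0 and can be removed until fewer than \<open>k\<close> terms of norm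
  at most 1 remain.\<close>

lemma norm_character_partial_sum_le: "norm (\<Sum>n\<in>{1..N}. \<psi> (int n)) \<le> real k"
proof (induction N rule: less_induct)
  case (less N)
  show ?case
  proof (cases "N < k")
    case True
    have "norm (\<Sum>n\<in>{1..N}. \<psi> (int n)) \<le> (\<Sum>n\<in>{1..N}. 1)"
      by (intro sum_norm_le) (simp add: norm_character[OF \<psi>])
    with True show ?thesis by simp
  next
    case False
    then show ?thesis
      using less[of "N - k"] k character_partial_sum_period[of "N - k"] by simp
  qed
qed

text \<open>Summation by parts. The corrected sums \<open>R N\<close> have increments
  \<open>S (N + 1) * (1 / (N + 1) - 1 / (N + 2))\<close>, whose bounds telescope; the two boundary
  terms raise the total to \<open>2 * k / (M + 1)\<close>.\<close>

lemma character_log_sum_diff: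
  assumes "M \<le> N"
  shows "norm ((\<Sum>n\<in>{1..N}. \<psi> (int n) / of_nat n) - (\<Sum>n\<in>{1..M}. \<psi> (int n) / of_nat n))
           \<le> 2 * real k / real (M + 1)"
proof -
  define S where "S N = (\<Sum>n\<in>{1..N}. \<psi> (int n))" for N :: nat
  define P where "P N = (\<Sum>n\<in>{1..N}. \<psi> (int n) / of_nat n)" for N :: nat
  define R where "R N = P N - S N / of_nat (N + 1)" for N
  have S: "norm (S N) \<le> real k" for N unfolding S_def by (rule norm_character_partial_sum_le)
  have SR: "norm (S N / of_nat (N + 1)) \<le> real k / real (N + 1)" for N
    unfolding norm_divide norm_of_nat by (intro divide_right_mono S) auto
  have "norm (R N - R M) \<le> real k / real (M + 1) - real k / real (N + 1)"
    using assms
  proof (induction N rule: dec_induct)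
    case (step N)
    have a: "of_nat (Suc N) + 1 \<noteq> (0 :: complex)" "of_nat N + 1 \<noteq> (0 :: complex)"
      using of_nat_neq_0[of "Suc N", where 'a = complex] of_nat_neq_0[of N, where 'a = complex]
      by (simp_all add: add.commute)
    have "R (Suc N) - R N = S (Suc N) * of_real (1 / real (N + 1) - 1 / real (Suc N + 1))"
      using a by (simp add: R_def P_def S_def divide_simps) (simp add: algebra_simps)
    then have "norm (R (Suc N) - R N) = norm (S (Suc N)) * (1 / real (N + 1) - 1 / real (Suc N + 1))"
      unfolding \<open>R (Suc N) - R N = _\<close> norm_mult norm_of_real by (simp add: frac_le)
    also have "\<dots> \<le> real k * (1 / real (N + 1) - 1 / real (Suc N + 1))"
      by (intro mult_right_mono S) (simp add: frac_le)
    finally have "norm (R (Suc N) - R N) \<le> real k / real (N + 1) - real k / real (Suc N + 1)"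
      by (simp only: right_diff_distrib times_divide_eq_right mult_1_right)
    with step.IH norm_triangle_ineq[of "R N - R M" "R (Suc N) - R N"] show ?case by simp
  qed simp
  moreover have "P N - P M = (R N - R M) + S N / of_nat (N + 1) - S M / of_nat (M + 1)"
    by (simp add: R_def)
  then have "norm (P N - P M) \<le> norm (R N - R M) + norm (S N / of_nat (N + 1)) + norm (S M / of_nat (M + 1))"
    by (metis norm_triangle_ineq4 norm_triangle_ineq order_trans add_right_mono)
  ultimately have "norm (P N - P M) \<le> 2 * real k / real (M + 1)"
    using SR[of N] SR[of M] by linarith
  then show ?thesis by (simp add: P_def)
qed

lemma dirichlet_L_one_LIMSEQ: "(\<lambda>N. \<Sum>n\<in>{1..N}. \<psi> (int n) / of_nat n) \<longlonglongrightarrow> dirichlet_L \<psi> 1"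
proof -
  have Cauchy: "Cauchy (\<lambda>N. \<Sum>n\<in>{1..N}. \<psi> (int n) / of_nat n)"
  proof (rule CauchyI')
    fix e :: real assume e: "e > 0"
    obtain M :: nat where M: "2 * real k / e < real M" using reals_Archimedean2 by blast
    show "\<exists>M. \<forall>m\<ge>M. \<forall>n>m. dist (\<Sum>n\<in>{1..m}. \<psi> (int n) / of_nat n) (\<Sum>n\<in>{1..n}. \<psi> (int n) / of_nat n) < e"
      unfolding dist_norm
    proof (intro exI allI impI)
      fix m n assume mn: "M \<le> m" "m < n"
      have "norm ((\<Sum>n\<in>{1..m}. \<psi> (int n) / of_nat n) - (\<Sum>n\<in>{1..n}. \<psi> (int n) / of_nat n)) \<le> 2 * real k / real (m + 1)"
        using character_log_sum_diff[of m n] mn by (simp add: norm_minus_commute)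
      also have "\<dots> < e"
      proof -
        have "2 * real k < e * real M" using M e by (simp add: field_simps)
        also have "\<dots> \<le> e * real (m + 1)" using mn e by (intro mult_left_mono) auto
        finally show ?thesis by (simp add: field_simps)
      qed
      finally show "norm ((\<Sum>n\<in>{1..m}. \<psi> (int n) / of_nat n) - (\<Sum>n\<in>{1..n}. \<psi> (int n) / of_nat n)) < e" .
    qed
  qed
  then obtain l where l: "(\<lambda>N. \<Sum>n\<in>{1..N}. \<psi> (int n) / of_nat n) \<longlonglongrightarrow> l"
    using Cauchy_convergent convergent_def by blast
  have "(\<Sum>n<N. \<psi> (int (Suc n)) / of_nat (Suc n) powr 1) = (\<Sum>n\<in>{1..N}. \<psi> (int n) / of_nat n)" for N
    by (rule sum.reindex_bij_witness[of _ "\<lambda>n. n - 1" Suc]) auto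
  with l have "(\<lambda>n. \<psi> (int (Suc n)) / of_nat (Suc n) powr 1) sums l"
    by (simp add: sums_def)
  then show ?thesis using l by (simp add: dirichlet_L_def sums_iff)
qed

text \<open>Letting \<open>N\<close> tend to infinity in the tail bound makes the limit
  \<open>dirichlet_L \<psi> 1\<close> the constant \<open>b\<close>; boundedness of the partial sums
  gives \<alpha> = 0.\<close>

lemma mean_value_character: "mean_value (\<lambda>n. \<psi> (int n)) 0 (dirichlet_L \<psi> 1) (2 * real k)"
proof
  fix x :: real assume x: "x \<ge> 1"
  show "norm ((\<Sum>n\<in>nats_upto x. \<psi> (int n)) - 0 * of_real x) \<le> 2 * real k"
    using norm_character_partial_sum_le[of "nat \<lfloor>x\<rfloor>"] by (simp add: nats_upto_eq)
  define M where "M = nat \<lfloor>x\<rfloor>"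
  have M: "x \<le> real (M + 1)" using x by (simp add: M_def) linarith
  have "norm (dirichlet_L \<psi> 1 - (\<Sum>n\<in>{1..M}. \<psi> (int n) / of_nat n)) \<le> 2 * real k / real (M + 1)"
  proof (rule Lim_norm_ubound)
    show "((\<lambda>N. (\<Sum>n\<in>{1..N}. \<psi> (int n) / of_nat n) - (\<Sum>n\<in>{1..M}. \<psi> (int n) / of_nat n))
        \<longlongrightarrow> dirichlet_L \<psi> 1 - (\<Sum>n\<in>{1..M}. \<psi> (int n) / of_nat n)) sequentially"
      by (intro tendsto_diff dirichlet_L_one_LIMSEQ tendsto_const)
    show "\<forall>\<^sub>F N in sequentially. norm ((\<Sum>n\<in>{1..N}. \<psi> (int n) / of_nat n) - (\<Sum>n\<in>{1..M}. \<psi> (int n) / of_nat n))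
        \<le> 2 * real k / real (M + 1)"
      by (rule eventually_sequentiallyI[of M]) (rule character_log_sum_diff)
  qed simp
  also have "\<dots> \<le> 2 * real k / x" using x M by (intro divide_left_mono) auto
  finally show "norm ((\<Sum>n\<in>nats_upto x. \<psi> (int n) / of_nat n) - (0 * of_real (ln x) + dirichlet_L \<psi> 1)) \<le> 2 * real k / x"
    by (simp add: nats_upto_eq M_def norm_minus_commute)
qed (simp_all add: character_mult[OF \<psi>] character_one[OF \<psi>] norm_character[OF \<psi>])

end

end

lemma mean_value_one: "mean_value (\<lambda>_. 1) 1 euler_mascheroni 1"
proof
  fix x :: real assume x: "x \<ge> 1"
  have "(\<Sum>n\<in>nats_upto x. 1) - 1 * of_real x = (of_real (real (card (nats_upto x)) - x) :: complex)" by simp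
  then show "norm ((\<Sum>n\<in>nats_upto x. 1) - 1 * complex_of_real x) \<le> 1"
    using card_nats_upto_bounds[of x] x by (simp only: norm_of_real)
  have "(\<Sum>n\<in>nats_upto x. 1 / of_nat n) - (1 * of_real (ln x) + euler_mascheroni)
      = (of_real ((\<Sum>n\<in>nats_upto x. 1 / real n) - ln x - euler_mascheroni) :: complex)" by simp
  then show "norm ((\<Sum>n\<in>nats_upto x. 1 / of_nat n) - (1 * complex_of_real (ln x) + euler_mascheroni)) \<le> 1 / x"
    using sum_inverse_nats_upto[OF x] by (simp only: norm_of_real)
qed auto

section \<open>Values at 2 and Euler products\<close>

lemma nat_powr_summable_on:
  assumes "s > 1" "A \<subseteq> {0<..}"
  shows "(\<lambda>n. real n powr (-s)) summable_on A"
proof -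
  have "summable (\<lambda>n. real n powr (-s))" using assms by (subst summable_real_powr_iff) simp
  then have "(\<lambda>n. real n powr (-s)) summable_on UNIV" by (intro norm_summable_imp_summable_on) simp
  then show ?thesis by (rule summable_on_subset) simp
qed

lemma primes_subset_pos: "primes \<subseteq> {0<..}"
  by (auto dest: prime_gt_0_nat)

lemma summable_on_times_real:
  fixes c :: "'a \<Rightarrow> real" and d :: "'b \<Rightarrow> real"
  assumes c: "c summable_on A" and d: "d summable_on B"
    and "\<And>x. x \<in> A \<Longrightarrow> c x \<ge> 0" "\<And>y. y \<in> B \<Longrightarrow> d y \<ge> 0"
  shows "(\<lambda>(x, y). c x * d y) summable_on A \<times> B"
proof (rule summable_on_SigmaI[where g = "\<lambda>x. c x * infsum d B"])
  fix x assume "x \<in> A"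
  show "((\<lambda>y. case (x, y) of (x, y) \<Rightarrow> c x * d y) has_sum c x * infsum d B) B"
    using has_sum_cmult_right[OF has_sum_infsum[OF d], of "c x"] by simp
qed (use assms in \<open>auto intro: summable_on_cmult_left\<close>)

lemma ln_le_sqrt: "n > 0 \<Longrightarrow> ln (real n) \<le> 2 * real n powr (1 / 2)"
  using ln_powr_bound[of "real n" "1 / 2"] by simp

locale bounded_multiplicative =
  fixes \<psi> :: "nat \<Rightarrow> complex"
  assumes norm_le_1: "norm (\<psi> n) \<le> 1" and mult: "\<psi> (m * n) = \<psi> m * \<psi> n" and one: "\<psi> 1 = 1"
begin

definition series_at_2 :: complex where
  "series_at_2 = (\<Sum>\<^sub>\<infinity>n\<in>{0<..}. \<psi> n / of_nat n ^ 2)"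

definition log_series_at_2 :: complex where
  "log_series_at_2 = (\<Sum>\<^sub>\<infinity>n\<in>{0<..}. of_real (ln (real n)) * \<psi> n / of_nat n ^ 2)"

text \<open>\<open>1 + m p\<close> is the Euler factor of the reciprocal of
  \<open>series_at_2\<close>.\<close>

definition m :: "nat \<Rightarrow> complex" where
  "m p = - \<psi> p / of_nat p ^ 2"

lemma norm_term_le:
  assumes "n > 0"
  shows "norm (\<psi> n / of_nat n ^ 2) \<le> real n powr (-2)"
    and "norm (of_real (ln (real n)) * \<psi> n / of_nat n ^ 2) \<le> 2 * real n powr (-(3 / 2))"
proof -
  have n2: "real n powr (-2) = 1 / real n ^ 2"
    using assms by (simp add: powr_minus powr_numeral field_simps)
  show 1: "norm (\<psi> n / of_nat n ^ 2) \<le> real n powr (-2)"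
    unfolding n2 using norm_le_1[of n] by (simp add: norm_divide norm_power divide_right_mono)
  have "norm (of_real (ln (real n)) * \<psi> n / of_nat n ^ 2) = ln (real n) * norm (\<psi> n / of_nat n ^ 2)"
    using assms by (simp add: norm_mult norm_divide)
  also have "\<dots> \<le> (2 * real n powr (1 / 2)) * real n powr (-2)"
    using assms by (intro mult_mono ln_le_sqrt 1) auto
  also have "\<dots> = 2 * real n powr (-(3 / 2))"
    by (simp add: mult.assoc flip: powr_add)
  finally show "norm (of_real (ln (real n)) * \<psi> n / of_nat n ^ 2) \<le> 2 * real n powr (-(3 / 2))" .
qed

lemma series_at_2_has_sum: "((\<lambda>n. \<psi> n / of_nat n ^ 2) has_sum series_at_2) {0<..}"
proof -
  have "(\<lambda>n. norm (\<psi> n / of_nat n ^ 2)) summable_on {0<..}"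
    by (rule summable_on_comparison_test[OF nat_powr_summable_on[of 2]]) (use norm_term_le in auto)
  then show ?thesis unfolding series_at_2_def by (intro has_sum_infsum) (rule abs_summable_summable)
qed

lemma log_series_at_2_has_sum: "((\<lambda>n. of_real (ln (real n)) * \<psi> n / of_nat n ^ 2) has_sum log_series_at_2) {0<..}"
proof -
  have "(\<lambda>n. 2 * real n powr (-(3 / 2))) summable_on {0<..}"
    by (intro summable_on_cmult_right nat_powr_summable_on) auto
  then have "(\<lambda>n. norm (of_real (ln (real n)) * \<psi> n / of_nat n ^ 2)) summable_on {0<..}"
    by (rule summable_on_comparison_test) (use norm_term_le in auto)
  then show ?thesis unfolding log_series_at_2_def by (intro has_sum_infsum) (rule abs_summable_summable)
qed

lemma norm_m_le: "p > 0 \<Longrightarrow> norm (m p) \<le> real p powr (-2)"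
  using norm_term_le(1)[of p] by (simp add: m_def norm_divide)

lemma m_summable: "(\<lambda>p. norm (m p)) summable_on primes"
  by (rule summable_on_comparison_test[OF nat_powr_summable_on[of 2]])
     (use norm_m_le primes_subset_pos in auto)

lemma log_m_summable: "(\<lambda>p. \<bar>ln (real p)\<bar> * norm (m p)) summable_on primes"
proof (rule summable_on_comparison_test)
  show "(\<lambda>p. 2 * real p powr (-(3 / 2))) summable_on primes"
    by (intro summable_on_cmult_right nat_powr_summable_on primes_subset_pos) auto
  fix p assume "p \<in> primes"
  then have p: "p > 0" using primes_subset_pos by auto
  then show "\<bar>ln (real p)\<bar> * norm (m p) \<le> 2 * real p powr (-(3 / 2))"
    using norm_term_le(2)[of p] by (simp add: m_def norm_mult norm_divide)
qed auto

lemma norm_m_le_half: "prime p \<Longrightarrow> norm (m p) \<le> 1 / 2"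
proof -
  assume p: "prime p"
  then have "real p \<ge> 2" using prime_ge_2_nat by auto
  then have "real p ^ 2 \<ge> 2 ^ 2" by (intro power_mono) auto
  moreover have "norm (m p) \<le> 1 / real p ^ 2"
    using norm_le_1[of p] by (simp add: m_def norm_divide norm_power divide_right_mono)
  moreover have "1 / real p ^ 2 \<le> 1 / 2" using calculation(1) by (intro frac_le) auto
  ultimately show ?thesis by linarith
qed

lemma one_plus_m_nonzero: "prime p \<Longrightarrow> 1 + m p \<noteq> 0"
  using norm_m_le_half[of p] by (auto simp: add_eq_0_iff)

text \<open>The exponent \<open>3 / 2\<close> is small enough to leave room for a factor
  \<open>ln n\<close> beside \<open>n ^ 2\<close>, and large enough for the series over
  \<open>n\<close> and over squarefree numbers to converge.\<close>

lemma moebius_pair_summable: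
  fixes a :: "nat \<Rightarrow> complex"
  assumes "\<And>n. n > 0 \<Longrightarrow> norm (a n) \<le> C * real n powr (-(3 / 2))"
  shows "(\<lambda>(F, n). (\<Prod>p\<in>F. -1) * a (n * \<Prod>F)) summable_on Fpow primes \<times> {0<..}"
proof (rule abs_summable_summable, rule summable_on_comparison_test)
  have "(\<lambda>F. norm (\<Prod>p\<in>F. real p powr (-(3 / 2)))) summable_on Fpow primes"
    by (rule abs_summable_on_Fpow_prod)
       (use nat_powr_summable_on[of "3 / 2" primes] primes_subset_pos in auto)
  then have "(\<lambda>F. \<bar>C\<bar> * norm (\<Prod>p\<in>F. real p powr (-(3 / 2)))) summable_on Fpow primes"
    by (rule summable_on_cmult_right)
  then show "(\<lambda>(F, n). \<bar>C\<bar> * norm (\<Prod>p\<in>F. real p powr (-(3 / 2))) * real n powr (-(3 / 2)))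
      summable_on Fpow primes \<times> {0<..}"
    by (rule summable_on_times_real) (auto intro: nat_powr_summable_on)
  fix x assume "x \<in> Fpow primes \<times> {0::nat<..}"
  then obtain F n where x: "x = (F, n)" and F: "F \<in> Fpow primes" and n: "n > 0" by auto
  have P: "\<Prod>F > 0" by (rule Prod_primes_pos[OF F])
  have "norm ((\<Prod>p\<in>F. -1) * a (n * \<Prod>F)) = norm (a (n * \<Prod>F))"
    by (simp add: norm_mult norm_power)
  also have "\<dots> \<le> C * real (n * \<Prod>F) powr (-(3 / 2))" using n P by (intro assms) simp
  also have "\<dots> \<le> \<bar>C\<bar> * real (n * \<Prod>F) powr (-(3 / 2))" by (intro mult_right_mono) auto
  also have "real (n * \<Prod>F) powr (-(3 / 2)) = (\<Prod>p\<in>F. real p powr (-(3 / 2))) * real n powr (-(3 / 2))"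
    unfolding prod_powr_Prod[OF F] of_nat_mult by (subst powr_mult) (simp_all only: mult.commute of_nat_0_le_iff)
  finally show "norm (case x of (F, n) \<Rightarrow> (\<Prod>p\<in>F. -1) * a (n * \<Prod>F))
      \<le> (case x of (F, n) \<Rightarrow> \<bar>C\<bar> * norm (\<Prod>p\<in>F. real p powr (-(3 / 2))) * real n powr (-(3 / 2)))"
    by (simp add: x prod_nonneg abs_prod mult.assoc)
qed auto

lemma prod_m:
  assumes "F \<in> Fpow primes"
  shows "(\<Prod>p\<in>F. m p) = (\<Prod>p\<in>F. -1) * (\<psi> (\<Prod>F) / of_nat (\<Prod>F) ^ 2)"
proof -
  have "finite F" using assms by (simp add: Fpow_def)
  then have "\<psi> (\<Prod>F) = (\<Prod>p\<in>F. \<psi> p)" by (induction F rule: finite_induct) (use one mult in auto)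
  moreover have "(\<Prod>p\<in>F. m p) = (\<Prod>p\<in>F. -1 * (\<psi> p / of_nat p ^ 2))" by (simp add: m_def)
  moreover have "(\<Prod>p\<in>F. of_nat p ^ 2) = (of_nat (\<Prod>F) ^ 2 :: complex)" by (simp add: prod_power_distrib)
  ultimately show ?thesis by (simp only: prod.distrib prod_dividef)
qed

text \<open>With \<open>h p = -1\<close> the expanded product is the divisor sum of the Moebius
  function, which vanishes except at \<open>q = 1\<close>.\<close>

lemma has_sum_at_1:
  "((\<lambda>q. a q * (\<Prod>p\<in>prime_factors q. 1 + (- 1 :: complex))) has_sum a 1) {0::nat<..}"
proof (rule has_sum_finite_neutralI[where B = "{1}"])
  fix q :: nat assume "q \<in> {0<..} - {1}"
  then have "q > 1" by auto
  then obtain p where "prime p" "p dvd q" using prime_factor_nat[of q] by auto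
  then have "p \<in> prime_factors q" using \<open>q > 1\<close> by (auto simp: prime_factors_dvd)
  then show "a q * (\<Prod>p\<in>prime_factors q. 1 + (- 1 :: complex)) = 0" by auto
qed auto

text \<open>Moebius inversion: \<open>has_sum_multiplicative\<close> with \<open>h p = -1\<close>
  leaves only the term at 1. It also shows that neither factor is 0.\<close>

lemma series_at_2_times_euler_sum: "series_at_2 * euler_sum m primes = 1"
proof -
  define a where "a n = \<psi> n / of_nat n ^ 2" for n
  have "((\<lambda>F. (\<Prod>p\<in>F. -1) * (\<psi> (\<Prod>F) / of_nat (\<Prod>F) ^ 2 * series_at_2)) has_sum a 1) (Fpow primes)"
  proof (rule has_sum_multiplicative[OF _ _ has_sum_at_1])
    show "(\<lambda>(F, n). (\<Prod>p\<in>F. -1) * a (n * \<Prod>F)) summable_on Fpow primes \<times> {0<..}"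
    proof (rule moebius_pair_summable)
      fix n :: nat assume n: "n > 0"
      have "real n powr (-2) \<le> 1 * real n powr (-(3 / 2))" using n by (simp add: powr_mono)
      then show "norm (a n) \<le> 1 * real n powr (-(3 / 2))"
        using norm_term_le(1)[OF n] unfolding a_def by linarith
    qed
    fix F assume "F \<in> Fpow primes"
    have "((\<lambda>n. \<psi> (\<Prod>F) / of_nat (\<Prod>F) ^ 2 * (\<psi> n / of_nat n ^ 2)) has_sum \<psi> (\<Prod>F) / of_nat (\<Prod>F) ^ 2 * series_at_2) {0<..}"
      by (intro has_sum_cmult_right series_at_2_has_sum)
    then show "((\<lambda>n. a (n * \<Prod>F)) has_sum \<psi> (\<Prod>F) / of_nat (\<Prod>F) ^ 2 * series_at_2) {0<..}"
      unfolding a_def mult of_nat_mult power_mult_distrib by (simp only: mult.commute times_divide_times_eq)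
  qed
  also have "?this \<longleftrightarrow> ((\<lambda>F. (\<Prod>p\<in>F. m p) * series_at_2) has_sum a 1) (Fpow primes)"
    by (intro has_sum_cong) (simp only: prod_m mult.assoc)
  finally have "((\<lambda>F. (\<Prod>p\<in>F. m p) * series_at_2) has_sum a 1) (Fpow primes)" .
  moreover have "((\<lambda>F. (\<Prod>p\<in>F. m p) * series_at_2) has_sum euler_sum m primes * series_at_2) (Fpow primes)"
    by (intro has_sum_cmult_left has_sum_euler_sum m_summable)
  ultimately have "euler_sum m primes * series_at_2 = a 1" by (metis has_sum_unique)
  then show ?thesis using one by (simp add: a_def mult.commute)
qed

text \<open>The logarithmic derivative is found without differentiating. Inverting the series with
  the additional factor \<open>ln n\<close> gives its term at 1, which is 0; splitting
  \<open>ln (n * P)\<close> turns this into a linear relation between the two series, and the Euler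
  product in it can be cancelled.\<close>

lemma log_series_at_2_eq: "log_series_at_2 = series_at_2 * (\<Sum>\<^sub>\<infinity>p\<in>primes. - (of_real (ln (real p)) * m p / (1 + m p)))"
proof -
  define a where "a n = of_real (ln (real n)) * \<psi> n / of_nat n ^ 2" for n
  define S where "S = (\<Sum>\<^sub>\<infinity>p\<in>primes. of_real (ln (real p)) * m p / (1 + m p))"
  define E where "E = euler_sum m primes"
  have "((\<lambda>F. (\<Prod>p\<in>F. -1) * (\<psi> (\<Prod>F) / of_nat (\<Prod>F) ^ 2 * (log_series_at_2 + of_real (ln (real (\<Prod>F))) * series_at_2))) has_sum a 1) (Fpow primes)"
  proof (rule has_sum_multiplicative[OF _ _ has_sum_at_1])
    show "(\<lambda>(F, n). (\<Prod>p\<in>F. -1) * a (n * \<Prod>F)) summable_on Fpow primes \<times> {0<..}"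
      by (rule moebius_pair_summable[of _ 2]) (use norm_term_le(2) in \<open>simp add: a_def\<close>)
    fix F assume F: "F \<in> Fpow primes"
    define P where "P = \<Prod>F"
    have P: "P > 0" using Prod_primes_pos[OF F] by (simp add: P_def)
    have "((\<lambda>n. \<psi> P / of_nat P ^ 2 * (of_real (ln (real n)) * \<psi> n / of_nat n ^ 2 + of_real (ln (real P)) * (\<psi> n / of_nat n ^ 2)))
        has_sum \<psi> P / of_nat P ^ 2 * (log_series_at_2 + of_real (ln (real P)) * series_at_2)) {0<..}"
      by (intro has_sum_cmult_right has_sum_add series_at_2_has_sum log_series_at_2_has_sum)
    also have "?this \<longleftrightarrow> ((\<lambda>n. a (n * P)) has_sum \<psi> P / of_nat P ^ 2 * (log_series_at_2 + of_real (ln (real P)) * series_at_2)) {0<..}"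
    proof (rule has_sum_cong)
      fix n :: nat assume n: "n \<in> {0<..}"
      then have "ln (real (n * P)) = ln (real n) + ln (real P)" using P by (simp add: ln_mult)
      moreover have "of_nat n \<noteq> (0 :: complex)" "of_nat P \<noteq> (0 :: complex)" using n P by auto
      ultimately show "\<psi> P / of_nat P ^ 2 * (of_real (ln (real n)) * \<psi> n / of_nat n ^ 2 + of_real (ln (real P)) * (\<psi> n / of_nat n ^ 2))
          = a (n * P)"
        by (simp add: a_def mult power_mult_distrib field_simps)
    qed
    finally show "((\<lambda>n. a (n * \<Prod>F)) has_sum \<psi> (\<Prod>F) / of_nat (\<Prod>F) ^ 2 * (log_series_at_2 + of_real (ln (real (\<Prod>F))) * series_at_2)) {0<..}"
      unfolding P_def .
  qed
  also have "?this \<longleftrightarrow> ((\<lambda>F. (\<Prod>p\<in>F. m p) * log_series_at_2 + (\<Prod>p\<in>F. m p) * of_real (\<Sum>p\<in>F. ln (real p)) * series_at_2) has_sum a 1) (Fpow primes)"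
  proof (rule has_sum_cong)
    fix F assume F: "F \<in> Fpow primes"
    then have ln: "ln (real (\<Prod>F)) = (\<Sum>p\<in>F. ln (real p))"
      by (auto simp: Fpow_def intro!: ln_prod dest: prime_gt_0_nat)
    show "(\<Prod>p\<in>F. -1) * (\<psi> (\<Prod>F) / of_nat (\<Prod>F) ^ 2 * (log_series_at_2 + of_real (ln (real (\<Prod>F))) * series_at_2))
        = (\<Prod>p\<in>F. m p) * log_series_at_2 + (\<Prod>p\<in>F. m p) * of_real (\<Sum>p\<in>F. ln (real p)) * series_at_2"
      unfolding ln prod_m[OF F] by (simp only: distrib_left mult.assoc)
  qed
  finally have 1: "((\<lambda>F. (\<Prod>p\<in>F. m p) * log_series_at_2 + (\<Prod>p\<in>F. m p) * of_real (\<Sum>p\<in>F. ln (real p)) * series_at_2) has_sum a 1) (Fpow primes)" .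
  have "((\<lambda>F. \<Prod>p\<in>F. m p) has_sum E) (Fpow primes)"
    unfolding E_def by (rule has_sum_euler_sum[OF m_summable])
  moreover have "((\<lambda>F. (\<Prod>p\<in>F. m p) * of_real (\<Sum>p\<in>F. ln (real p))) has_sum E * S) (Fpow primes)"
    unfolding E_def S_def
    by (rule has_sum_Fpow_prod_times_sum[OF m_summable log_m_summable]) (use one_plus_m_nonzero in auto)
  ultimately have "((\<lambda>F. (\<Prod>p\<in>F. m p) * log_series_at_2 + (\<Prod>p\<in>F. m p) * of_real (\<Sum>p\<in>F. ln (real p)) * series_at_2) has_sum
      E * log_series_at_2 + E * S * series_at_2) (Fpow primes)"
    by (intro has_sum_add has_sum_cmult_left)
  then have "E * log_series_at_2 + E * S * series_at_2 = a 1" using 1 by (rule has_sum_unique)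
  then have "E * (log_series_at_2 + S * series_at_2) = 0" by (simp add: a_def algebra_simps)
  moreover have "E \<noteq> 0" using series_at_2_times_euler_sum by (auto simp: E_def)
  ultimately have "log_series_at_2 + S * series_at_2 = 0" by simp
  then have "log_series_at_2 = series_at_2 * (- S)" using eq_neg_iff_add_eq_0[of log_series_at_2 "S * series_at_2"] by (simp add: mult.commute)
  also have "- S = (\<Sum>\<^sub>\<infinity>p\<in>primes. - (of_real (ln (real p)) * m p / (1 + m p)))"
    unfolding S_def by (rule infsum_uminus[symmetric])
  finally show ?thesis .
qed

text \<open>Each factor is the quotient of \<open>1 + g p\<close> and \<open>1 + m p\<close>, also
  off \<open>A\<close>, where the two coincide. The product is therefore a quotient of two Euler
  sums, the second of which is the inverse of \<open>series_at_2\<close>.\<close>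

lemma euler_product_over:
  assumes A: "A \<subseteq> primes" and inv: "(\<lambda>p. 1 / real p) summable_on A"
  defines "g \<equiv> (\<lambda>p. if p \<in> A then - \<psi> p / of_nat p else m p)"
  shows "(\<lambda>p. if p \<in> A then (1 - \<psi> p / of_nat p) * inverse (1 - \<psi> p / of_nat p ^ 2) else 1)
           has_prod (euler_sum g primes * series_at_2)"
proof -
  have gA: "norm (g p) \<le> 1 / real p" if "p \<in> A" for p
    using that norm_le_1[of p] by (simp add: g_def norm_divide divide_right_mono)
  have "(\<lambda>p. norm (g p)) summable_on A"
    by (rule summable_on_comparison_test[OF inv]) (use gA in auto)
  moreover have "(\<lambda>p. norm (g p)) summable_on primes - A"
    by (rule summable_on_comparison_test[OF summable_on_Diff_real[OF m_summable]]) (auto simp: g_def)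
  ultimately have "(\<lambda>p. norm (g p)) summable_on (A \<union> (primes - A))"
    by (rule summable_on_Un_disjoint) auto
  then have g: "(\<lambda>p. norm (g p)) summable_on primes" using A by (simp add: Un_absorb1)
  have half: "norm (g p) \<le> 1 / 2" if "p \<in> primes" for p
  proof (cases "p \<in> A")
    case True
    have "real p \<ge> 2" using that prime_ge_2_nat by auto
    then have "1 / real p \<le> 1 / 2" by (intro frac_le) auto
    then show ?thesis using gA[OF True] by linarith
  qed (use that norm_m_le_half in \<open>auto simp: g_def\<close>)
  have nz: "1 + g p \<noteq> 0" if "p \<in> primes" for p
    using half[OF that] by (auto simp: add_eq_0_iff)
  have E: "euler_sum m primes \<noteq> 0" "euler_sum m primes = inverse series_at_2"
    using series_at_2_times_euler_sum inverse_unique[OF series_at_2_times_euler_sum] by auto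
  define f where "f p = (if p \<in> A then (1 - \<psi> p / of_nat p) * inverse (1 - \<psi> p / of_nat p ^ 2) else 1)" for p
  have f: "f p = (1 + g p) / (1 + m p)" if "p \<in> primes" for p
    using that one_plus_m_nonzero[of p] by (auto simp: f_def g_def m_def divide_inverse)
  have f1: "f p = 1" if "p \<notin> primes" for p
    using that A by (auto simp: f_def)
  have fnz: "f p \<noteq> 0" for p
    using f[of p] f1[of p] nz[of p] one_plus_m_nonzero[of p] by (cases "p \<in> primes") auto
  have "(\<Prod>i\<le>n. f i) = (\<Prod>p\<in>{p\<in>primes. p \<le> n}. 1 + g p) / (\<Prod>p\<in>{p\<in>primes. p \<le> n}. 1 + m p)" for n
  proof -
    have "(\<Prod>i\<le>n. f i) = (\<Prod>p\<in>{p\<in>primes. p \<le> n}. f p)"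
      by (rule prod.mono_neutral_right) (use f1 in auto)
    also have "\<dots> = (\<Prod>p\<in>{p\<in>primes. p \<le> n}. (1 + g p) / (1 + m p))"
      by (intro prod.cong) (use f in auto)
    finally show ?thesis by (simp add: prod_dividef)
  qed
  moreover have "(\<lambda>n. (\<Prod>p\<in>{p\<in>primes. p \<le> n}. 1 + g p) / (\<Prod>p\<in>{p\<in>primes. p \<le> n}. 1 + m p))
      \<longlonglongrightarrow> euler_sum g primes / euler_sum m primes"
    by (intro tendsto_divide euler_sum_LIMSEQ g m_summable E)
  ultimately have lim: "(\<lambda>n. \<Prod>i\<le>n. f i) \<longlonglongrightarrow> euler_sum g primes * series_at_2"
    using E by (simp add: divide_inverse)
  \<comment> \<open>Convergence of an infinite product requires a non-zero limit.\<close>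
  moreover have "euler_sum g primes * series_at_2 \<noteq> 0"
    using euler_sum_nonzero[OF g half] series_at_2_times_euler_sum by auto
  ultimately have "convergent_prod f"
    using convergent_prod_iff_nz_lim[of f] fnz by blast
  then have "f has_prod (euler_sum g primes * series_at_2)"
    using lim by (rule convergent_prod_tendsto_imp_has_prod)
  then show ?thesis unfolding f_def .
qed

end

section \<open>The values of L and the logarithmic derivative of zeta at 2\<close>

lemma has_sum_pos_nat_iff_Suc: "((\<lambda>n. f (Suc n)) has_sum S) UNIV \<longleftrightarrow> (f has_sum S) {0<..}"
proof -
  have "range Suc = {0<..}" by (auto simp: image_iff) (metis Suc_pred)
  then show ?thesis using has_sum_reindex[of Suc UNIV f S] by (simp add: o_def)
qed

lemma nat_powr_2: "n > 0 \<Longrightarrow> (of_nat n :: complex) powr 2 = of_nat n ^ 2"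
  using powr_nat'[of "of_nat n :: complex" 2] by simp

lemma (in bounded_multiplicative) series_at_2_sums: "(\<lambda>n. \<psi> (Suc n) / of_nat (Suc n) powr 2) sums series_at_2"
  using has_sum_imp_sums[OF series_at_2_has_sum[unfolded has_sum_pos_nat_iff_Suc[symmetric]]]
  by (simp only: nat_powr_2 zero_less_Suc)

lemma (in bounded_multiplicative) log_series_at_2_sums:
  "(\<lambda>n. of_real (ln (real (Suc n))) * \<psi> (Suc n) / of_nat (Suc n) powr 2) sums log_series_at_2"
  using has_sum_imp_sums[OF log_series_at_2_has_sum[unfolded has_sum_pos_nat_iff_Suc[symmetric]]]
  by (simp only: nat_powr_2 zero_less_Suc)

lemma bounded_multiplicative_character:
  assumes "k > 0" "\<psi> \<in> dirichlet_characters k"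
  shows "bounded_multiplicative (\<lambda>n. \<psi> (int n))"
  using assms
  by unfold_locales (simp_all add: norm_character character_mult[OF assms(1)] character_one[OF assms(1)])

lemma dirichlet_L_at_2:
  assumes "k > 0" "\<psi> \<in> dirichlet_characters k"
  shows "dirichlet_L \<psi> 2 = bounded_multiplicative.series_at_2 (\<lambda>n. \<psi> (int n))"
  unfolding dirichlet_L_def
  by (rule sums_unique[OF bounded_multiplicative.series_at_2_sums[OF bounded_multiplicative_character[OF assms]], symmetric])

interpretation trivial: bounded_multiplicative "\<lambda>_. 1"
  by unfold_locales auto

lemma zeta_2: "zeta 2 = trivial.series_at_2"
  unfolding zeta_def by (rule sums_unique[OF trivial.series_at_2_sums, symmetric])

lemma deriv_zeta_2: "deriv zeta 2 = - trivial.log_series_at_2"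
proof -
  define f where "f n s = 1 / of_nat (Suc n) powr s" for n and s :: complex
  define f' where "f' n s = - (Ln (of_nat (Suc n)) / of_nat (Suc n) powr s)" for n and s :: complex
  \<comment> \<open>On this open neighbourhood of 2 a single convergent series, with exponent
    \<open>3 / 2\<close>, dominates all terms, which permits termwise differentiation.\<close>
  define S where "S = {s. Re s > 3 / 2}"
  have S: "open S" unfolding S_def by (rule open_halfspace_Re_gt)
  have "\<exists>g g'. \<forall>x\<in>S. ((\<lambda>n. f n x) sums g x) \<and> ((\<lambda>n. f' n x) sums g' x) \<and> (g has_field_derivative g' x) (at x)"
  proof (rule series_and_derivative_comparison_complex[OF S])
    fix n s
    have nz: "of_nat (Suc n) \<noteq> (0 :: complex)" by (rule of_nat_neq_0)
    have f: "f n = (\<lambda>s. of_nat (Suc n) powr (- s))" by (simp add: f_def fun_eq_iff powr_minus divide_inverse)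
    have "((\<lambda>s. of_nat (Suc n) powr (- s)) has_field_derivative
        (Ln (of_nat (Suc n)) * of_nat (Suc n) powr (- s)) * (- 1)) (at s)"
      by (rule DERIV_chain2[where g = uminus, OF has_field_derivative_powr_right[OF nz]]) (auto intro!: derivative_eq_intros)
    then show "(f n has_field_derivative f' n s) (at s)"
      unfolding f by (simp add: f'_def powr_minus divide_inverse)
  next
    fix s assume "s \<in> S"
    define h where "h n = complex_of_real (real (Suc n) powr (-(3 / 2)))" for n
    have "summable (\<lambda>n. real (Suc n) powr (-(3 / 2)))"
      by (subst summable_Suc_iff) (subst summable_real_powr_iff, simp)
    then have "summable h" unfolding h_def by (rule summable_of_real)
    moreover have "range h \<subseteq> \<real>\<^sub>\<ge>\<^sub>0" by (auto simp: h_def)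
    moreover have "norm (f n y) \<le> norm (h n)" if "y \<in> S" for n y
    proof -
      have "norm (of_nat (Suc n) powr y) = real (Suc n) powr Re y"
        using norm_powr_real_powr[of "of_nat (Suc n)" y] by simp
      then have "norm (f n y) = real (Suc n) powr (- Re y)"
        by (simp only: f_def norm_divide norm_one powr_minus inverse_eq_divide)
      also have "\<dots> \<le> real (Suc n) powr (-(3 / 2))" using that by (intro powr_mono) (auto simp: S_def)
      finally show ?thesis by (simp add: h_def)
    qed
    ultimately show "\<exists>d h. 0 < d \<and> summable h \<and> range h \<subseteq> \<real>\<^sub>\<ge>\<^sub>0 \<and>
        (\<forall>\<^sub>F n in sequentially. \<forall>y\<in>ball s d \<inter> S. cmod (f n y) \<le> cmod (h n))"
      by (intro exI[of _ 1] exI[of _ h]) auto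
  qed
  then obtain g g' where g: "\<And>s. s \<in> S \<Longrightarrow> (\<lambda>n. f n s) sums g s"
    "\<And>s. s \<in> S \<Longrightarrow> (\<lambda>n. f' n s) sums g' s" "\<And>s. s \<in> S \<Longrightarrow> (g has_field_derivative g' s) (at s)" by blast
  have 2: "2 \<in> S" by (simp add: S_def)
  have "zeta s = g s" if "s \<in> S" for s
    using g(1)[OF that] by (simp add: zeta_def f_def sums_iff)
  then have "(zeta has_field_derivative g' 2) (at 2)"
    using has_field_derivative_transform_within_open[OF g(3)[OF 2] S 2] by metis
  then have "deriv zeta 2 = g' 2" by (rule DERIV_imp_deriv)
  moreover have "(\<lambda>n. f' n 2) = (\<lambda>n. - (of_real (ln (real (Suc n))) * 1 / of_nat (Suc n) powr 2))"
    by (simp add: f'_def fun_eq_iff Ln_of_nat del: of_nat_Suc)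
  then have "(\<lambda>n. f' n 2) sums (- trivial.log_series_at_2)"
    using sums_minus[OF trivial.log_series_at_2_sums] by simp
  ultimately show ?thesis using g(2)[OF 2] sums_unique2 by metis
qed

lemma prime_log_summable: "(\<lambda>p. ln (real p) / (real p ^ 2 - 1)) summable_on primes"
proof (rule summable_on_comparison_test)
  show "(\<lambda>p. 4 * real p powr (-(3 / 2))) summable_on primes"
    by (intro summable_on_cmult_right nat_powr_summable_on primes_subset_pos) auto
  fix p assume "p \<in> primes"
  then have p: "p > 0" "real p \<ge> 2" using prime_ge_2_nat primes_subset_pos by auto
  then have p2: "real p ^ 2 \<ge> 2" using power_mono[of 2 "real p" 2] by simp
  then have "ln (real p) / (real p ^ 2 - 1) \<le> ln (real p) / (real p ^ 2 / 2)"
    using p by (intro divide_left_mono) auto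
  also have "\<dots> = 2 * norm (of_real (ln (real p)) * 1 / of_nat p ^ 2 :: complex)"
    using p by (simp add: norm_divide norm_power)
  also have "\<dots> \<le> 2 * (2 * real p powr (-(3 / 2)))"
    using trivial.norm_term_le(2)[OF p(1)] by (intro mult_left_mono) auto
  finally show "ln (real p) / (real p ^ 2 - 1) \<le> 4 * real p powr (-(3 / 2))" by simp
  show "ln (real p) / (real p ^ 2 - 1) \<ge> 0" using p p2 by simp
qed

lemma log_deriv_zeta_2:
  "- deriv zeta 2 / zeta 2 = of_real (\<Sum>\<^sub>\<infinity>p\<in>primes. ln (real p) / (real p ^ 2 - 1))"
proof -
  have nz: "trivial.series_at_2 \<noteq> 0" using trivial.series_at_2_times_euler_sum by auto
  have "- deriv zeta 2 / zeta 2 = (\<Sum>\<^sub>\<infinity>p\<in>primes. - (of_real (ln (real p)) * trivial.m p / (1 + trivial.m p)))"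
    using trivial.log_series_at_2_eq nz by (simp add: zeta_2 deriv_zeta_2)
  also have "\<dots> = (\<Sum>\<^sub>\<infinity>p\<in>primes. of_real (ln (real p) / (real p ^ 2 - 1)))"
  proof (rule infsum_cong)
    fix p assume "p \<in> primes"
    then have "real p > 1" using prime_gt_1_nat by auto
    then have "real p ^ 2 > 1" by (simp add: one_less_power)
    then have "of_nat p ^ 2 \<noteq> (1 :: complex)" "of_nat p \<noteq> (0 :: complex)"
      by (metis of_nat_1 of_nat_eq_iff of_nat_power less_irrefl) (use \<open>real p > 1\<close> in auto)
    then show "- (of_real (ln (real p)) * trivial.m p / (1 + trivial.m p)) = complex_of_real (ln (real p) / (real p ^ 2 - 1))"
      by (simp add: trivial.m_def divide_simps)
  qed
  also have "\<dots> = of_real (\<Sum>\<^sub>\<infinity>p\<in>primes. ln (real p) / (real p ^ 2 - 1))"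
    by (intro infsumI has_sum_of_real has_sum_infsum prime_log_summable)
  finally show ?thesis .
qed

section \<open>Neighbours in the Farey sequence\<close>

lemma quotient_of_coprime_nat:
  assumes "coprime a q" "0 < q"
  shows "quotient_of (of_nat a / of_nat q) = (int a, int q)"
proof -
  have "of_nat a / of_nat q = Fract (int a) (int q)"
    by (simp add: Fract_of_int_quotient)
  then show ?thesis using assms by (simp add: quotient_of_Fract normalize_stable)
qed

lemma rat_less_iff_nat:
  assumes "0 < q" "0 < y"
  shows "(of_nat x / of_nat y :: rat) < of_nat a / of_nat q \<longleftrightarrow> x * q < a * y"
proof -
  have "(of_nat x / of_nat y :: rat) < of_nat a / of_nat q \<longleftrightarrow> of_nat (x * q) < (of_nat (a * y) :: rat)"
    using assms by (simp add: field_simps)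
  then show ?thesis by (simp only: of_nat_less_iff)
qed

lemma cong_1_imp_dvd_diff_nat:
  fixes n q :: nat
  assumes "[n = 1] (mod q)" "n \<ge> 1"
  shows "q dvd n - 1"
proof -
  have "[int n = int 1] (mod int q)" using assms(1) by (simp only: cong_int_iff)
  then have "int q dvd int n - int 1" by (simp only: cong_iff_dvd_diff)
  also have "int n - int 1 = int (n - 1)" using assms(2) by simp
  finally show ?thesis by (simp only: of_nat_dvd_iff)
qed

lemma coprime_of_unit_determinant:
  fixes a b c d :: nat
  assumes "a * d = b * c + 1"
  shows "coprime b d" "coprime a c"
proof -
  have "e dvd 1" if "e dvd a * d" "e dvd b * c" for e
    using that dvd_add_right_iff[of e "b * c" 1] by (simp only: assms)
  then show "coprime b d" "coprime a c"
    by (blast intro: coprimeI dvd_mult dvd_mult2)+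
qed

context
  fixes Q :: nat
begin

definition farey_rep :: "rat \<Rightarrow> nat \<Rightarrow> nat \<Rightarrow> bool" where
  "farey_rep x a q \<longleftrightarrow> x = of_nat a / of_nat q \<and> coprime a q \<and> 0 < a \<and> a \<le> q \<and> q \<le> Q"

lemma farey_set_iff: "x \<in> farey_set Q \<longleftrightarrow> (\<exists>a q. farey_rep x a q)"
  by (auto simp: farey_set_def farey_rep_def)

lemma farey_repI: "coprime a q \<Longrightarrow> 0 < a \<Longrightarrow> a \<le> q \<Longrightarrow> q \<le> Q \<Longrightarrow> farey_rep (of_nat a / of_nat q) a q"
  by (simp add: farey_rep_def)

lemma farey_rep_denom: "farey_rep x a q \<Longrightarrow> nat (snd (quotient_of x)) = q"
  by (auto simp: farey_rep_def quotient_of_coprime_nat)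

lemma finite_farey_set: "finite (farey_set Q)"
proof (rule finite_subset)
  show "farey_set Q \<subseteq> (\<lambda>(a, q). of_nat a / of_nat q) ` ({..Q} \<times> {..Q})"
    by (auto simp: farey_set_def)
qed auto

lemma farey_strict_mono:
  assumes "1 \<le> i" "i < j" "j \<le> farey_length Q"
  shows "farey Q i < farey Q j"
  unfolding farey_def
  by (rule sorted_wrt_nth_less[OF strict_sorted_list_of_set]) (use assms in \<open>auto simp: farey_length_def\<close>)

lemma farey_mono:
  assumes "1 \<le> i" "i \<le> j" "j \<le> farey_length Q"
  shows "farey Q i \<le> farey Q j"
  using farey_strict_mono[of i j] assms by (cases "i = j") auto

lemma farey_image: "farey Q ` {1..farey_length Q} = farey_set Q"
proof -
  let ?xs = "sorted_list_of_set (farey_set Q)"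
  have "farey Q ` {1..farey_length Q} = (\<lambda>i. ?xs ! i) ` {..<length ?xs}"
  proof safe
    fix i assume "i \<in> {1..farey_length Q}"
    then show "farey Q i \<in> (\<lambda>i. ?xs ! i) ` {..<length ?xs}"
      by (auto simp: farey_def farey_length_def intro!: imageI)
  next
    fix i assume "i < length ?xs"
    then show "?xs ! i \<in> farey Q ` {1..farey_length Q}"
      by (intro image_eqI[of _ _ "Suc i"]) (auto simp: farey_def farey_length_def)
  qed
  also have "\<dots> = set ?xs" by (auto simp: set_conv_nth)
  finally show ?thesis using finite_farey_set by simp
qed

lemma farey_in: "i \<in> {1..farey_length Q} \<Longrightarrow> farey Q i \<in> farey_set Q"
  using farey_image by blast

lemma farey_inj:
  assumes "i \<in> {1..farey_length Q}" "j \<in> {1..farey_length Q}" "farey Q i = farey Q j"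
  shows "i = j"
  using farey_strict_mono[of i j] farey_strict_mono[of j i] assms
  by (cases i j rule: linorder_cases) auto

lemma farey_less_imp_le_pred:
  assumes "i \<in> {1..farey_length Q}" "y \<in> farey_set Q" "y < farey Q i"
  shows "i > 1 \<and> y \<le> farey Q (i - 1)"
proof -
  obtain j where j: "j \<in> {1..farey_length Q}" "y = farey Q j" using assms(2) farey_image by blast
  have "j < i" using assms farey_mono[of i j] j by (cases "i \<le> j") auto
  then show ?thesis using farey_mono[of j "i - 1"] j assms by auto
qed

lemma farey_greater_imp_succ_le:
  assumes "i \<in> {1..farey_length Q}" "y \<in> farey_set Q" "farey Q i < y"
  shows "i < farey_length Q \<and> farey Q (i + 1) \<le> y"
proof -
  obtain j where j: "j \<in> {1..farey_length Q}" "y = farey Q j" using assms(2) farey_image by blast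
  have "i < j" using assms farey_mono[of j i] j by (cases "j \<le> i") auto
  then show ?thesis using farey_mono[of "i + 1" j] j assms by auto
qed

text \<open>
  If \<open>a q' - a' q = 1\<close> and \<open>q + q' > Q\<close>, then no fraction of denominator at most \<open>Q\<close> lies
  strictly between \<open>a'/q'\<close> and \<open>a/q\<close>: its denominator \<open>y\<close> would satisfy
  \<open>y = q' (a y - x q) + q (x q' - a' y) \<ge> q + q'\<close>.
\<close>

lemma no_fraction_between:
  fixes a q a' q' x y :: nat
  assumes "a * q' = a' * q + 1" "Q < q + q'" "y \<le> Q" "x * q < a * y" "a' * y < x * q'"
  shows False
proof -
  have "int y = int q' * (int a * int y - int x * int q) + int q * (int x * int q' - int a' * int y)"
  proof -
    have "int a * int q' = int a' * int q + 1" using assms(1) by (metis of_nat_1 of_nat_add of_nat_mult)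
    then have "int y * (int a * int q' - int a' * int q) = int y" by simp
    then show ?thesis by (simp add: algebra_simps)
  qed
  moreover have "int a * int y - int x * int q \<ge> 1"
    using assms(4) by (metis of_nat_less_iff of_nat_mult zless_imp_add1_zle le_diff_eq add.commute)
  moreover have "int x * int q' - int a' * int y \<ge> 1"
    using assms(5) by (metis of_nat_less_iff of_nat_mult zless_imp_add1_zle le_diff_eq add.commute)
  ultimately have "int y \<ge> int q' * 1 + int q * 1"
    by (metis add_mono mult_left_mono of_nat_0_le_iff)
  then show False using assms(2,3) by simp
qed

text \<open>The value at \<open>i = 1\<close> is the denominator of \<open>0/1\<close>, the left
  neighbour outside the sequence; it lets the first fraction be treated like the others.\<close>

definition pred_denom :: "nat \<Rightarrow> nat" where
  "pred_denom i = (if i = 1 then 1 else farey_denom Q (i - 1))"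

text \<open>The congruence supplies \<open>a'\<close> with \<open>a * q' - a' * q = 1\<close>, and
  nothing of denominator at most \<open>Q\<close> lies between \<open>a'/q'\<close> and
  \<open>a/q\<close>. If \<open>a' > 0\<close>, then \<open>a'/q'\<close> belongs to the sequence
  and is the predecessor; \<open>a' = 0\<close> is the neighbour \<open>0/1\<close> and can only
  occur at the first fraction.\<close>

lemma pred_denom_eq:
  assumes i: "i \<in> {1..farey_length Q}" and rep: "farey_rep (farey Q i) a q"
    and q': "Q < q + q'" "q' \<le> Q" "[a * q' = 1] (mod q)"
  shows "pred_denom i = q'" "i = 1 \<Longrightarrow> q = Q \<and> q' = 1"
proof -
  have aq: "coprime a q" "0 < a" "a \<le> q" "q \<le> Q" "0 < q" and x: "farey Q i = of_nat a / of_nat q"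
    using rep by (auto simp: farey_rep_def)
  have q'pos: "0 < q'" using q' aq by simp
  have "a * q' \<ge> 1" using aq q'pos by simp
  obtain a' where a': "a * q' = a' * q + 1"
  proof -
    have "q dvd a * q' - 1" using q'(3) \<open>a * q' \<ge> 1\<close> by (rule cong_1_imp_dvd_diff_nat)
    then obtain c where "a * q' - 1 = q * c" by blast
    then have "a * q' = c * q + 1" using \<open>a * q' \<ge> 1\<close> by (metis le_add_diff_inverse2 mult.commute)
    then show ?thesis by (rule that)
  qed
  have above: "y \<le> of_nat a' / of_nat q'" if "y \<in> farey_set Q" "y < farey Q i" for y
  proof -
    obtain b r where br: "farey_rep y b r" using \<open>y \<in> farey_set Q\<close> farey_set_iff by blast
    then have r: "0 < r" "r \<le> Q" "y = of_nat b / of_nat r" by (auto simp: farey_rep_def)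
    have "b * q < a * r" using that r aq x rat_less_iff_nat by simp
    then have "\<not> a' * r < b * q'" using no_fraction_between[OF a' q'(1) r(2)] by blast
    then have "\<not> of_nat a' / of_nat q' < y" using r q'pos rat_less_iff_nat by simp
    then show ?thesis by simp
  qed
  have rep': "farey_rep (of_nat a' / of_nat q') a' q'" if "a' > 0"
  proof (rule farey_repI[OF _ that _ q'(2)])
    have "a' * q < q * q'" using a' aq by (metis add_lessD1 le_less_trans less_add_one mult_le_mono1 not_le)
    then show "a' \<le> q'" by (simp add: mult.commute)
  qed (rule coprime_of_unit_determinant[OF a'])
  have pred: "i > 1 \<and> of_nat a' / of_nat q' \<le> farey Q (i - 1)" if "a' > 0"
  proof (rule farey_less_imp_le_pred[OF i])
    show "of_nat a' / of_nat q' \<in> farey_set Q" using rep'[OF that] farey_set_iff by blast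
    show "of_nat a' / of_nat q' < farey Q i"
      unfolding x using a' aq q'pos by (subst rat_less_iff_nat) auto
  qed
  show one: "q = Q \<and> q' = 1" if "i = 1"
  proof -
    have "a' = 0" using pred that by auto
    then have "a * q' = 1" using a' by simp
    then have "q' = 1" by simp
    then show ?thesis using q' aq by simp
  qed
  show "pred_denom i = q'"
  proof (cases "i = 1")
    case True
    then show ?thesis using one by (simp add: pred_denom_def)
  next
    case False
    then have i1: "i - 1 \<in> {1..farey_length Q}" "i - 1 < i" using i by auto
    have lt: "farey Q (i - 1) < farey Q i" using farey_strict_mono[of "i - 1" i] i1 i by auto
    obtain b r where br: "farey_rep (farey Q (i - 1)) b r" using farey_in[OF i1(1)] farey_set_iff by blast
    have le: "farey Q (i - 1) \<le> of_nat a' / of_nat q'" using above farey_in[OF i1(1)] lt by blast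
    have "0 < farey Q (i - 1)" using br by (auto simp: farey_rep_def)
    with le have "(0::rat) < of_nat a' / of_nat q'" by simp
    then have "0 < a'" using q'pos by (simp add: zero_less_divide_iff)
    with le pred have "farey Q (i - 1) = of_nat a' / of_nat q'" by force
    then show ?thesis using False farey_rep_denom[OF rep'[OF \<open>0 < a'\<close>]] by (simp add: pred_denom_def farey_denom_def)
  qed
qed

text \<open>The mirror image on the right. Since \<open>q \<ge> 2\<close> forces
  \<open>a < q\<close>, the candidate is at most 1 and stays inside the sequence.\<close>

lemma succ_denom_eq:
  assumes i: "i \<in> {1..farey_length Q}" and rep: "farey_rep (farey Q i) a q" and q2: "q \<ge> 2"
    and q': "Q < q + q'" "q' \<le> Q" "q dvd a * q' + 1"
  shows "farey_denom Q (i + 1) = q'" "i < farey_length Q"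
proof -
  have aq: "coprime a q" "0 < a" "a \<le> q" "q \<le> Q" "0 < q" and x: "farey Q i = of_nat a / of_nat q"
    using rep by (auto simp: farey_rep_def)
  have "a \<noteq> q" using aq q2 by auto
  then have aq': "a < q" using aq by simp
  have q'pos: "0 < q'" using q' aq by simp
  obtain a' where a': "a' * q = a * q' + 1" using q'(3) by (metis dvd_def mult.commute)
  have below: "of_nat a' / of_nat q' \<le> y" if "y \<in> farey_set Q" "farey Q i < y" for y
  proof -
    obtain b r where br: "farey_rep y b r" using \<open>y \<in> farey_set Q\<close> farey_set_iff by blast
    then have r: "0 < r" "r \<le> Q" "y = of_nat b / of_nat r" by (auto simp: farey_rep_def)
    have "a * r < b * q" using that r aq x rat_less_iff_nat by simp
    then have "\<not> b * q' < a' * r" using no_fraction_between[OF a' _ r(2)] q'(1) by (simp add: add.commute) blast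
    then have "\<not> y < of_nat a' / of_nat q'" using r q'pos rat_less_iff_nat by simp
    then show ?thesis by simp
  qed
  have "a' * q \<le> q * q'"
  proof -
    have "a * q' + 1 \<le> a * q' + q'" using q'pos by simp
    also have "\<dots> = (a + 1) * q'" by simp
    also have "\<dots> \<le> q * q'" using aq' by (intro mult_le_mono1) simp
    finally show ?thesis using a' by simp
  qed
  then have "a' \<le> q'" using aq by (simp add: mult.commute)
  moreover have "coprime a' q'" by (rule coprime_of_unit_determinant[OF a'])
  moreover have "0 < a'" using a' by (intro Nat.gr0I) auto
  ultimately have rep': "farey_rep (of_nat a' / of_nat q') a' q'"
    using q' by (intro farey_repI) auto
  moreover have lt: "farey Q i < of_nat a' / of_nat q'"
    unfolding x using a' aq q'pos by (subst rat_less_iff_nat) auto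
  ultimately have succ: "i < farey_length Q \<and> farey Q (i + 1) \<le> of_nat a' / of_nat q'"
    using farey_greater_imp_succ_le[OF i] farey_set_iff by blast
  then show iN: "i < farey_length Q" by blast
  then have "farey Q i < farey Q (i + 1)" "i + 1 \<in> {1..farey_length Q}" using farey_strict_mono[of i "i + 1"] i by auto
  then have "of_nat a' / of_nat q' \<le> farey Q (i + 1)" using below farey_in by blast
  with succ have "farey Q (i + 1) = of_nat a' / of_nat q'" by simp
  then show "farey_denom Q (i + 1) = q'" using farey_rep_denom[OF rep'] by (simp add: farey_denom_def)
qed

lemma exists_residue_below:
  assumes "0 < q" "q \<le> Q"
  shows "\<exists>r. Q < q + r \<and> r \<le> Q \<and> [int r = c] (mod int q)"
proof -
  \<comment> \<open>Subtracting this remainder from \<open>Q\<close> gives the largest integer up to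
    \<open>Q\<close> in the residue class of \<open>c\<close>.\<close>
  define s where "s = (int Q - c) mod int q"
  have s: "0 \<le> s" "s < int q" using assms by (auto simp: s_def)
  define r where "r = nat (int Q - s)"
  have r: "int r = int Q - s" using s assms by (simp add: r_def)
  have "[int Q - s = int Q - (int Q - c)] (mod int q)"
    unfolding s_def by (intro cong_diff) (auto simp: cong_def)
  then have "[int r = c] (mod int q)" by (simp add: r)
  moreover have "Q < q + r" "r \<le> Q" using r s by linarith+
  ultimately show ?thesis by blast
qed

lemma exists_inverse_residue:
  assumes "coprime a q" "0 < q" "q \<le> Q"
  shows "\<exists>r. Q < q + r \<and> r \<le> Q \<and> [a * r = 1] (mod q)"
proof -
  obtain c where c: "[int a * c = 1] (mod int q)"
    using assms cong_solve_coprime_int[of "int a" "int q"] by auto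
  obtain r where r: "Q < q + r" "r \<le> Q" "[int r = c] (mod int q)"
    using exists_residue_below[OF assms(2,3)] by blast
  have "[int a * int r = int a * c] (mod int q)" using r(3) by (rule cong_scalar_left)
  with c have "[int (a * r) = int 1] (mod int q)" by (simp add: cong_trans)
  then have "[a * r = 1] (mod q)" by (simp only: cong_int_iff)
  with r show ?thesis by blast
qed

lemma farey_rep_pred_denom:
  assumes "i \<in> {1..farey_length Q}" "farey_rep (farey Q i) a q"
  shows "Q < q + pred_denom i" "pred_denom i \<le> Q" "[a * pred_denom i = 1] (mod q)"
proof -
  have "coprime a q" "0 < q" "q \<le> Q" using assms(2) by (auto simp: farey_rep_def)
  then obtain r where "Q < q + r" "r \<le> Q" "[a * r = 1] (mod q)" using exists_inverse_residue by blast
  then show "Q < q + pred_denom i" "pred_denom i \<le> Q" "[a * pred_denom i = 1] (mod q)"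
    using pred_denom_eq(1)[OF assms] by auto
qed

text \<open>Modulo \<open>q\<close>, the two neighbouring denominators are the inverse of
  \<open>a\<close> and its negative, so their sum is a multiple \<open>q * t\<close>. As the right
  one lies in \<open>{Q - q<..Q}\<close>, the quotient \<open>t\<close> is determined by the left
  one.\<close>

lemma farey_index_eq:
  assumes Q: "Q \<ge> 2" and i: "i \<in> {1..farey_length Q}"
  shows "farey_index Q i = real ((Q + pred_denom i) div farey_denom Q i)"
proof -
  obtain a q where rep: "farey_rep (farey Q i) a q" using farey_in[OF i] farey_set_iff by blast
  have q: "farey_denom Q i = q" using farey_rep_denom[OF rep] by (simp add: farey_denom_def)
  have aq: "coprime a q" "0 < a" "a \<le> q" "q \<le> Q" "0 < q" using rep by (auto simp: farey_rep_def)
  note p = farey_rep_pred_denom[OF i rep]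
  show ?thesis
  proof (cases "i = 1")
    case True
    then have "q = Q" "pred_denom i = 1" using pred_denom_eq(2)[OF i rep p] by auto
    \<comment> \<open>This needs \<open>Q \<ge> 2\<close>; for \<open>Q = 1\<close> the quotient
      would be 2.\<close>
    moreover have "(Q + 1) div Q = 1" using Q by (simp add: div_nat_eqI)
    ultimately show ?thesis using True q by (simp add: farey_index_def)
  next
    case i1: False
    show ?thesis
    proof (cases "q = 1")
      case True
      \<comment> \<open>At the last fraction \<open>(Q + Q) div 1\<close> reproduces the convention
        \<open>2 * Q\<close>.\<close>
      then have pQ: "pred_denom i = Q" using p by simp
      have "i = farey_length Q"
      proof (rule ccontr)
        assume "i \<noteq> farey_length Q"
        then have i': "i < i + 1" "i + 1 \<in> {1..farey_length Q}" using i by auto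
        then have "farey Q i < farey Q (i + 1)" using farey_strict_mono[of i "i + 1"] i by auto
        moreover obtain b r where br: "farey_rep (farey Q (i + 1)) b r" using farey_in[OF i'(2)] farey_set_iff by blast
        then have "farey Q (i + 1) \<le> 1" by (auto simp: farey_rep_def divide_le_eq_1)
        moreover have "farey Q i = 1" using True rep aq by (simp add: farey_rep_def)
        ultimately show False by simp
      qed
      then show ?thesis using i1 True pQ q by (simp add: farey_index_def)
    next
      case False
      then have q2: "q \<ge> 2" using aq by simp
      obtain c where c: "[int a * c = 1] (mod int q)"
        using aq cong_solve_coprime_int[of "int a" "int q"] by auto
      obtain r where r: "Q < q + r" "r \<le> Q" "[int r = - c] (mod int q)"
        using exists_residue_below[OF aq(5,4)] by blast
      have "[int a * int r + 1 = int a * (- c) + 1] (mod int q)"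
        by (intro cong_add cong_scalar_left r) auto
      also have "[int a * (- c) + 1 = - 1 + 1] (mod int q)"
        using c by (intro cong_add) (auto simp: cong_minus_minus_iff)
      finally have "int q dvd int a * int r + 1" by (simp add: cong_0_iff)
      then have "int q dvd int (a * r + 1)" by (simp only: of_nat_add of_nat_mult of_nat_1)
      then have qr: "q dvd a * r + 1" by (simp only: of_nat_dvd_iff)
      note s = succ_denom_eq[OF i rep q2 r(1,2) qr]
      have "q dvd (a * r + 1) + (a * pred_denom i - 1)"
      proof (rule dvd_add[OF qr])
        have "a * pred_denom i \<ge> 1" using p aq by simp
        then show "q dvd a * pred_denom i - 1"
          using p(3) by (intro cong_1_imp_dvd_diff_nat)
      qed
      moreover have "a * pred_denom i \<ge> 1" using p aq by simp
      then have "(a * r + 1) + (a * pred_denom i - 1) = a * (r + pred_denom i)"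
        by (simp add: algebra_simps)
      ultimately have "q dvd a * (r + pred_denom i)" by simp
      then have dvd: "q dvd r + pred_denom i"
        using aq(1) by (simp add: coprime_dvd_mult_right_iff coprime_commute)
      then obtain t where t: "r + pred_denom i = q * t" by blast
      have "(Q + pred_denom i) div q = t"
        by (rule div_nat_eqI) (use t r in \<open>auto simp: algebra_simps\<close>)
      moreover have "(real (pred_denom i) + real r) / real q = real t"
        using t aq by (simp add: field_simps flip: of_nat_add of_nat_mult)
      ultimately show ?thesis
        using i1 s by (simp add: farey_index_def q pred_denom_def)
    qed
  qed
qed

text \<open>The pair determines the fraction, because the numerator is the inverse of the left
  denominator modulo \<open>q\<close>; conversely every admissible pair arises from that
  inverse.\<close>

lemma farey_denom_pairs_bij:
  "bij_betw (\<lambda>i. (farey_denom Q i, pred_denom i)) {1..farey_length Q}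
     (SIGMA q:{1..Q}. {r \<in> {Q - q<..Q}. coprime r q})"
  unfolding bij_betw_def
proof
  show "inj_on (\<lambda>i. (farey_denom Q i, pred_denom i)) {1..farey_length Q}"
  proof (rule inj_onI)
    fix i j assume ij: "i \<in> {1..farey_length Q}" "j \<in> {1..farey_length Q}"
      "(farey_denom Q i, pred_denom i) = (farey_denom Q j, pred_denom j)"
    obtain a q where i: "farey_rep (farey Q i) a q" using farey_in[OF ij(1)] farey_set_iff by blast
    obtain b r where j: "farey_rep (farey Q j) b r" using farey_in[OF ij(2)] farey_set_iff by blast
    have "q = r" using ij(3) farey_rep_denom[OF i] farey_rep_denom[OF j] by (simp add: farey_denom_def)
    have p: "[a * pred_denom i = 1] (mod q)" "[b * pred_denom i = 1] (mod q)"
      using farey_rep_pred_denom(3)[OF ij(1) i] farey_rep_pred_denom(3)[OF ij(2) j] ij(3) \<open>q = r\<close> by auto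
    have "coprime (pred_denom i) q"
      using p(1) by (metis cong_imp_coprime cong_sym coprime_1_left coprime_mult_left_iff)
    moreover have "[a * pred_denom i = b * pred_denom i] (mod q)" using p by (metis cong_sym cong_trans)
    ultimately have "[a = b] (mod q)" by (simp add: cong_mult_rcancel_nat)
    moreover have "0 < a" "a \<le> q" "0 < b" "b \<le> q" using i j \<open>q = r\<close> by (auto simp: farey_rep_def)
    ultimately have "a = b"
      by (metis cong_less_modulus_unique_nat cong_def le_neq_implies_less mod_self mod_less less_not_refl)
    then have "farey Q i = farey Q j" using i j \<open>q = r\<close> by (simp add: farey_rep_def)
    then show "i = j" using farey_inj ij by blast
  qed
  show "(\<lambda>i. (farey_denom Q i, pred_denom i)) ` {1..farey_length Q} = (SIGMA q:{1..Q}. {r \<in> {Q - q<..Q}. coprime r q})"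
  proof safe
    fix i assume i: "i \<in> {1..farey_length Q}"
    obtain a q where rep: "farey_rep (farey Q i) a q" using farey_in[OF i] farey_set_iff by blast
    have q: "farey_denom Q i = q" using farey_rep_denom[OF rep] by (simp add: farey_denom_def)
    note p = farey_rep_pred_denom[OF i rep]
    show "farey_denom Q i \<in> {1..Q}" using rep by (auto simp: q farey_rep_def)
    have "q \<le> Q" using rep by (simp add: farey_rep_def)
    then show "pred_denom i \<in> {Q - farey_denom Q i<..Q}" using p by (simp add: q)
    show "coprime (pred_denom i) (farey_denom Q i)"
      unfolding q using p(3) by (metis cong_imp_coprime cong_sym coprime_1_left coprime_mult_left_iff)
  next
    fix q r assume qr: "q \<in> {1..Q}" "r \<in> {Q - q<..Q}" "coprime r q"
    obtain c where c: "[int r * c = 1] (mod int q)"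
      using qr cong_solve_coprime_int[of "int r" "int q"] by auto
    \<comment> \<open>For \<open>q = 1\<close> the remainder is 0, but the numerator must be
      positive: the fraction is \<open>1/1\<close>.\<close>
    define a where "a = (if q = 1 then 1 else nat (c mod int q))"
    have a: "[a * r = 1] (mod q)" "0 < a" "a \<le> q"
    proof -
      have "int a = c mod int q \<or> q = 1" using qr by (auto simp: a_def)
      then show ar: "[a * r = 1] (mod q)"
      proof
        assume "int a = c mod int q"
        then have "[int a * int r = c * int r] (mod int q)" by (intro cong_scalar_right) (simp add: cong_def)
        with c have "[int (a * r) = int 1] (mod int q)" by (simp add: mult.commute cong_trans)
        then show ?thesis by (simp only: cong_int_iff)
      qed (simp add: cong_def)
      show "0 < a"
      proof (cases "q = 1")
        case False
        then show ?thesis using ar qr by (intro Nat.gr0I) (auto simp: cong_def)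
      qed (simp add: a_def)
      have "nat (c mod int q) \<le> q" using qr by (simp add: nat_le_iff less_imp_le)
      then show "a \<le> q" using qr by (simp add: a_def)
    qed
    have "coprime a q" using a(1) by (metis cong_imp_coprime cong_sym coprime_1_left coprime_mult_left_iff)
    then have rep: "farey_rep (of_nat a / of_nat q) a q" using a qr by (intro farey_repI) auto
    then obtain i where i: "i \<in> {1..farey_length Q}" "farey Q i = of_nat a / of_nat q"
      using farey_set_iff farey_image by (metis imageE)
    have "farey_denom Q i = q" using farey_rep_denom[OF rep] i(2) by (simp add: farey_denom_def)
    moreover have "Q < q + r" "r \<le> Q" using qr by auto
    then have "pred_denom i = r" using pred_denom_eq(1)[OF i(1), of a q r] rep i(2) a(1) by simp
    ultimately show "(q, r) \<in> (\<lambda>i. (farey_denom Q i, pred_denom i)) ` {1..farey_length Q}"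
      using i(1) by force
  qed
qed

lemma farey_moment_eq:
  assumes Q: "Q \<ge> 2"
  shows "farey_moment l B u k Q =
    (\<Sum>q | q \<in> {1..Q} \<and> [q = u] (mod k) \<and> B_free B q.
       \<Sum>r | r \<in> {Q - q<..Q} \<and> coprime r q. real ((Q + r) div q) ^ l)"
proof -
  define P where "P q \<longleftrightarrow> [q = u] (mod k) \<and> B_free B q" for q
  have "farey_moment l B u k Q = (\<Sum>i\<in>{1..farey_length Q}. if P (farey_denom Q i) then farey_index Q i ^ l else 0)"
    unfolding farey_moment_def P_def[symmetric] by (rule sum.inter_filter) simp
  also have "\<dots> = (\<Sum>i\<in>{1..farey_length Q}.
      (\<lambda>(q, r). if P q then real ((Q + r) div q) ^ l else 0) (farey_denom Q i, pred_denom i))"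
    by (intro sum.cong refl) (simp add: farey_index_eq[OF Q])
  also have "\<dots> = (\<Sum>(q, r)\<in>(SIGMA q:{1..Q}. {r \<in> {Q - q<..Q}. coprime r q}). if P q then real ((Q + r) div q) ^ l else 0)"
    by (rule sum.reindex_bij_betw[OF farey_denom_pairs_bij])
  also have "\<dots> = (\<Sum>q\<in>{1..Q}. \<Sum>r | r \<in> {Q - q<..Q} \<and> coprime r q. if P q then real ((Q + r) div q) ^ l else 0)"
    by (rule sum.Sigma[symmetric]) auto
  also have "\<dots> = (\<Sum>q\<in>{1..Q}. if P q then (\<Sum>r | r \<in> {Q - q<..Q} \<and> coprime r q. real ((Q + r) div q) ^ l) else 0)"
    by (intro sum.cong refl) auto
  also have "\<dots> = (\<Sum>q\<in>{q\<in>{1..Q}. P q}. \<Sum>r | r \<in> {Q - q<..Q} \<and> coprime r q. real ((Q + r) div q) ^ l)"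
    by (rule sum.inter_filter[symmetric]) simp
  finally show ?thesis unfolding P_def by simp
qed

end

section \<open>Counting coprime residues in intervals\<close>

text \<open>Only sets of common primes of \<open>r\<close> and \<open>q\<close> count, and their
  alternating sum is a product of zeros unless there are none.\<close>

lemma indicator_coprime_eq_sum:
  fixes r q :: nat
  assumes "0 < r" "0 < q"
  shows "(if coprime r q then 1 else 0 :: real) = (\<Sum>F\<in>Pow (prime_factors q). if \<Prod>F dvd r then (-1) ^ card F else 0)"
proof -
  define P where "P = prime_factors q \<inter> prime_factors r"
  have finP: "finite P" by (simp add: P_def)
  have "(\<Sum>F\<in>Pow (prime_factors q). if \<Prod>F dvd r then (-1) ^ card F else 0 :: real)
      = (\<Sum>F\<in>{F \<in> Pow (prime_factors q). \<Prod>F dvd r}. (-1) ^ card F)"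
    by (rule sum.inter_filter[symmetric]) simp
  also have "{F \<in> Pow (prime_factors q). \<Prod>F dvd r} = Pow P"
  proof -
    have "\<Prod>F dvd r \<longleftrightarrow> F \<subseteq> prime_factors r" if "F \<subseteq> prime_factors q" for F
      by (rule Prod_primes_dvd_iff[OF subset_prime_factors_in_Fpow[OF that] assms(1)])
    then show ?thesis unfolding P_def by blast
  qed
  also have "(\<Sum>F\<in>Pow P. (-1) ^ card F :: real) = (\<Prod>p\<in>P. 1 + (-1))"
    using prod_one_plus_eq_sum_Pow[OF finP, of "\<lambda>_. -1 :: real"] by (simp only: prod_constant)
  also have "\<dots> = (if P = {} then 1 else 0)"
  proof (cases "P = {}")
    case False
    then have "card P \<noteq> 0" using finP by simp
    then show ?thesis using False by (simp only: add.right_inverse prod_constant power_0_left if_False)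
  qed simp
  also have "P = {} \<longleftrightarrow> coprime r q"
  proof
    assume "P = {}"
    show "coprime r q"
    proof (rule ccontr)
      assume "\<not> coprime r q"
      then have "gcd r q \<noteq> 1" by (simp only: coprime_iff_gcd_eq_1 not_False_eq_True)
      then obtain p where "prime p" "p dvd gcd r q" using prime_factor_nat by blast
      then have "prime p" "p dvd r" "p dvd q" by auto
      then have "p \<in> P" using assms by (simp add: P_def prime_factors_dvd)
      with \<open>P = {}\<close> show False by simp
    qed
  next
    assume *: "coprime r q"
    have False if "p \<in> P" for p
    proof -
      have "prime p" "p dvd r" "p dvd q" using that by (auto simp: P_def)
      then have "p dvd gcd r q" by simp
      moreover have "gcd r q = 1" using * by (rule coprime_imp_gcd_eq_1)
      ultimately show False using \<open>prime p\<close> by simp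
    qed
    then show "P = {}" by blast
  qed
  finally show ?thesis by simp
qed

lemma card_multiples:
  assumes "0 < d" "A \<le> B"
  shows "card {r \<in> {A<..B}. d dvd r} = B div d - A div d"
proof -
  have "{r \<in> {A<..B}. d dvd r} = (\<lambda>i. d * i) ` {A div d<..B div d}"
  proof -
    have iff: "d * i \<in> {A<..B} \<longleftrightarrow> i \<in> {A div d<..B div d}" for i
      using assms by (simp add: div_less_iff_less_mult less_eq_div_iff_mult_less_eq mult.commute)
    show ?thesis
    proof (rule Set.set_eqI, rule iffI)
      fix r assume "r \<in> {r \<in> {A<..B}. d dvd r}"
      then have r: "r \<in> {A<..B}" "d dvd r" by simp_all
      from r(2) obtain i where i: "r = d * i" by (rule dvdE)
      have "i \<in> {A div d<..B div d}" using r(1) unfolding i iff .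
      with i show "r \<in> (\<lambda>i. d * i) ` {A div d<..B div d}" by (rule image_eqI)
    next
      fix r assume "r \<in> (\<lambda>i. d * i) ` {A div d<..B div d}"
      then obtain i where i: "r = d * i" "i \<in> {A div d<..B div d}" by (rule imageE)
      then have "r \<in> {A<..B}" unfolding i(1) iff by simp
      then show "r \<in> {r \<in> {A<..B}. d dvd r}" by (simp add: i(1))
    qed
  qed
  moreover have "inj_on (\<lambda>i. d * i) {A div d<..B div d}" using assms by (auto simp: inj_on_def)
  ultimately show ?thesis by (simp add: card_image)
qed

lemma card_coprime_interval:
  fixes q :: nat
  assumes "0 < q" "A \<le> B"
  shows "real (card {r \<in> {A<..B}. coprime r q})
           = (\<Sum>F\<in>Pow (prime_factors q). (-1) ^ card F * real (B div \<Prod>F - A div \<Prod>F))"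
proof -
  have "real (card {r \<in> {A<..B}. coprime r q}) = (\<Sum>r\<in>{A<..B}. if coprime r q then 1 else 0)"
    by (simp add: sum.If_cases Int_def)
  also have "\<dots> = (\<Sum>r\<in>{A<..B}. \<Sum>F\<in>Pow (prime_factors q). if \<Prod>F dvd r then (-1) ^ card F else 0)"
    by (intro sum.cong indicator_coprime_eq_sum) (use assms in auto)
  also have "\<dots> = (\<Sum>F\<in>Pow (prime_factors q). \<Sum>r\<in>{A<..B}. if \<Prod>F dvd r then (-1) ^ card F else 0)"
    by (rule sum.swap)
  also have "\<dots> = (\<Sum>F\<in>Pow (prime_factors q). (-1) ^ card F * real (B div \<Prod>F - A div \<Prod>F))"
  proof (intro sum.cong refl)
    fix F assume "F \<in> Pow (prime_factors q)"
    then have "\<Prod>F > 0" using Prod_primes_pos subset_prime_factors_in_Fpow by blast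
    then have "card {r \<in> {A<..B}. \<Prod>F dvd r} = B div \<Prod>F - A div \<Prod>F" using assms(2) by (rule card_multiples)
    moreover have "(\<Sum>r\<in>{A<..B}. if \<Prod>F dvd r then (-1) ^ card F else 0)
        = (\<Sum>r\<in>{r \<in> {A<..B}. \<Prod>F dvd r}. (-1 :: real) ^ card F)"
      by (rule sum.inter_filter[symmetric]) simp
    ultimately show "(\<Sum>r\<in>{A<..B}. if \<Prod>F dvd r then (-1 :: real) ^ card F else 0)
        = (-1) ^ card F * real (B div \<Prod>F - A div \<Prod>F)" by simp
  qed
  finally show ?thesis .
qed

lemma totient_sum:
  assumes "0 < q"
  shows "(\<Sum>F\<in>Pow (prime_factors q). (-1) ^ card F / real (\<Prod>F)) = real (totient q) / real q"
proof -
  have "(\<Sum>F\<in>Pow (prime_factors q). (-1) ^ card F / real (\<Prod>F))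
      = (\<Sum>F\<in>Pow (prime_factors q). \<Prod>p\<in>F. - (1 / real p))"
  proof (intro sum.cong refl)
    fix F assume "F \<in> Pow (prime_factors q)"
    have "(\<Prod>p\<in>F. - (1 / real p)) = (\<Prod>p\<in>F. - 1 / real p)" by simp
    also have "\<dots> = (-1) ^ card F / real (\<Prod>F)" by (simp only: prod_dividef prod_constant of_nat_prod)
    finally show "(-1) ^ card F / real (\<Prod>F) = (\<Prod>p\<in>F. - (1 / real p))" by simp
  qed
  also have "\<dots> = (\<Prod>p\<in>prime_factors q. 1 + - (1 / real p))"
    by (rule prod_one_plus_eq_sum_Pow[symmetric]) simp
  also have "\<dots> = real (totient q) / real q"
    using assms by (simp add: totient_formula2)
  finally show ?thesis .
qed

text \<open>Over a length \<open>q\<close> there is no rounding, since every \<open>\<Prod>F\<close>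
  divides \<open>q\<close>.\<close>

lemma card_coprime_period:
  assumes "0 < q"
  shows "card {r \<in> {A<..A + q}. coprime r q} = totient q"
proof -
  have "real (card {r \<in> {A<..A + q}. coprime r q}) = (\<Sum>F\<in>Pow (prime_factors q). real q * ((-1) ^ card F / real (\<Prod>F)))"
    unfolding card_coprime_interval[OF assms le_add1]
  proof (intro sum.cong refl)
    fix F assume F: "F \<in> Pow (prime_factors q)"
    then have dvd: "\<Prod>F dvd q" using Prod_primes_dvd_iff[of F q] assms subset_prime_factors_in_Fpow by blast
    then obtain c where c: "q = \<Prod>F * c" by blast
    have "\<Prod>F \<noteq> 0" using assms c by (metis mult_0 less_irrefl)
    then have "(A + q) div \<Prod>F - A div \<Prod>F = c" "real q / real (\<Prod>F) = real c"
      unfolding c by (simp_all del: of_nat_prod)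
    then show "(-1) ^ card F * real ((A + q) div \<Prod>F - A div \<Prod>F) = real q * ((-1) ^ card F / real (\<Prod>F))"
      by (simp only: times_divide_eq_right mult.commute[of "real q"]) (simp only: times_divide_eq_right[symmetric])
  qed
  also have "\<dots> = real (totient q)"
    unfolding sum_distrib_left[symmetric] totient_sum[OF assms] using assms by simp
  finally show ?thesis by simp
qed

text \<open>Each of the \<open>2 ^ card (prime_factors q)\<close> terms contributes a difference of
  two fractional parts, hence at most 1.\<close>

lemma card_coprime_interval_bound:
  assumes "0 < q" "A \<le> B"
  shows "\<bar>real (card {r \<in> {A<..B}. coprime r q}) - real (totient q) / real q * real (B - A)\<bar> \<le> 2 ^ card (prime_factors q)"
proof -
  have "real (card {r \<in> {A<..B}. coprime r q}) - real (totient q) / real q * real (B - A)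
      = (\<Sum>F\<in>Pow (prime_factors q). (-1) ^ card F * (real (B div \<Prod>F - A div \<Prod>F) - real (B - A) / real (\<Prod>F)))"
    unfolding card_coprime_interval[OF assms] totient_sum[OF assms(1), symmetric] sum_distrib_right
      sum_subtractf[symmetric]
    by (intro sum.cong refl) (simp add: right_diff_distrib)
  also have "\<bar>\<dots>\<bar> \<le> (\<Sum>F\<in>Pow (prime_factors q). 1)"
  proof (rule sum_abs[THEN order_trans], rule sum_mono)
    fix F assume "F \<in> Pow (prime_factors q)"
    define d where "d = \<Prod>F"
    have d: "d > 0" using \<open>F \<in> Pow _\<close> Prod_primes_pos subset_prime_factors_in_Fpow by (auto simp: d_def)
    have "A div d \<le> B div d" using assms by (rule_tac div_le_mono)
    then have e: "real (B div d - A div d) - real (B - A) / real d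
        = (real (B div d) - real B / real d) - (real (A div d) - real A / real d)"
      using assms by (simp add: of_nat_diff diff_divide_distrib)
    have u: "real (n div d) \<le> real n / real d" "real n / real d - 1 \<le> real (n div d)" for n
      using floor_divide_of_nat_eq[of n d, where 'a = real] by linarith+
    have "\<bar>real (B div d - A div d) - real (B - A) / real d\<bar> \<le> 1"
      unfolding e using u[of A] u[of B] by (simp add: abs_le_iff)
    then show "\<bar>(-1) ^ card F * (real (B div \<Prod>F - A div \<Prod>F) - real (B - A) / real (\<Prod>F))\<bar> \<le> 1"
      by (simp add: abs_mult power_abs d_def)
  qed
  also have "\<dots> = 2 ^ card (prime_factors q)" by (simp add: card_Pow)
  finally show ?thesis .
qed

text \<open>Every prime other than 2 and 3 satisfies \<open>2 \<le> sqrt p\<close>; these two cost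
  at most the factor 4.\<close>

lemma two_power_card_prime_factors_le:
  assumes "0 < q"
  shows "2 ^ card (prime_factors q) \<le> 4 * sqrt (real q)"
proof -
  define P where "P = prime_factors q"
  have P: "finite P" "P \<in> Fpow primes"
    unfolding P_def by (simp, rule subset_prime_factors_in_Fpow, rule order_refl)
  have "2 ^ card P = (2 ^ card (P \<inter> {2, 3}) * 2 ^ card (P - {2, 3}) :: real)"
  proof -
    have "card P = card (P \<inter> {2, 3}) + card (P - {2, 3})"
      using P(1) by (metis card_Int_Diff)
    then show ?thesis by (simp add: power_add)
  qed
  also have "2 ^ card (P \<inter> {2, 3}) \<le> (2 ^ 2 :: real)"
  proof (rule power_increasing)
    have "card (P \<inter> {2, 3}) \<le> card {2, 3 :: nat}" by (intro card_mono) auto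
    then show "card (P \<inter> {2, 3}) \<le> 2" by simp
  qed simp
  also have "(2 :: real) ^ card (P - {2, 3}) = (\<Prod>p\<in>P - {2, 3}. 2)" by simp
  also have "\<dots> \<le> (\<Prod>p\<in>P - {2, 3}. sqrt (real p))"
  proof (intro prod_mono conjI)
    fix p assume p: "p \<in> P - {2, 3}"
    then have "prime p" "p \<noteq> 2" "p \<noteq> 3" by (auto simp: P_def)
    then have "p \<ge> 4" using prime_ge_2_nat[of p] by linarith
    then have "sqrt 4 \<le> sqrt (real p)" by (intro real_sqrt_le_mono) simp
    then show "2 \<le> sqrt (real p)" by simp
  qed simp
  also have "\<dots> \<le> (\<Prod>p\<in>P. sqrt (real p))"
  proof (rule prod_mono2)
    fix p assume "p \<in> P - (P - {2, 3})"
    then show "1 \<le> sqrt (real p)" by auto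
  qed (use P in auto)
  also have "\<dots> = sqrt (real (\<Prod>P))"
    using P(1) by (induction P rule: finite_induct) (auto simp: real_sqrt_mult)
  also have "\<dots> \<le> sqrt (real q)"
  proof -
    have "\<Prod>P dvd q" using Prod_primes_dvd_iff[OF P(2) assms] by (simp add: P_def)
    then show ?thesis using assms by (intro real_sqrt_le_mono of_nat_mono dvd_imp_le)
  qed
  finally show ?thesis by (simp add: P_def mult_left_mono)
qed

lemma sum_inverse_sqrt_le: "(\<Sum>q\<in>{1..n}. 1 / sqrt (real q)) \<le> 2 * sqrt (real n)"
proof (induction n)
  case (Suc n)
  define a where "a = sqrt (real n)"
  define b where "b = sqrt (real (Suc n))"
  have ab: "0 \<le> a" "a \<le> b" "0 < b" "b * b = a * a + 1" by (auto simp: a_def b_def)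
  have "1 / b \<le> 2 * b - 2 * a"
  proof -
    have "0 \<le> (b - a) * (b - a)" by simp
    then have "2 * (a * b) \<le> a * a + b * b" by (simp add: algebra_simps)
    then have "1 \<le> (2 * b - 2 * a) * b" using ab(4) by (simp add: algebra_simps)
    then show ?thesis using ab(3) by (simp add: divide_le_eq)
  qed
  then show ?case using Suc by (simp add: a_def b_def)
qed simp

section \<open>The second moment for a single denominator\<close>

lemma coprime_index_square_sum:
  fixes Q q :: nat
  assumes q: "1 \<le> q" "q \<le> Q"
  defines "t \<equiv> (2 * Q) div q"
  shows "(\<Sum>r | r \<in> {Q - q<..Q} \<and> coprime r q. real ((Q + r) div q) ^ 2)
           = (real t - 1) ^ 2 * real (totient q) + (2 * real t - 1) * real (card {r \<in> {t * q - Q - 1<..Q}. coprime r q})"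
proof -
  have t: "t * q \<le> 2 * Q" "2 * Q < (t + 1) * q"
    using q by (auto simp: t_def mult.commute dividend_less_times_div)
  have t1: "t \<ge> 2" unfolding t_def using q by (simp add: less_eq_div_iff_mult_less_eq)
  \<comment> \<open>The second inequality makes the truncated subtraction harmless: the half-open
    interval from \<open>t * q - Q - 1\<close> starts exactly at
    \<open>r = t * q - Q\<close>.\<close>
  have lo: "Q - q \<le> t * q - Q - 1" "t * q - Q \<ge> 1" using t q by (simp_all add: algebra_simps)
  \<comment> \<open>The quotient is \<open>t\<close> if \<open>t * q \<le> Q + r\<close> and
    \<open>t - 1\<close> otherwise. Counting \<open>(t - 1) ^ 2\<close> for every \<open>r\<close>
    leaves the difference \<open>2 * t - 1\<close> on the upper interval.\<close>
  have "(\<Sum>r | r \<in> {Q - q<..Q} \<and> coprime r q. real ((Q + r) div q) ^ 2)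
      = (\<Sum>r | r \<in> {Q - q<..Q} \<and> coprime r q. (real t - 1) ^ 2 + (if r \<in> {t * q - Q - 1<..Q} then 2 * real t - 1 else 0))"
  proof (intro sum.cong refl)
    fix r assume "r \<in> {r. r \<in> {Q - q<..Q} \<and> coprime r q}"
    then have r: "Q < q + r" "r \<le> Q" using q by auto
    show "real ((Q + r) div q) ^ 2 = (real t - 1) ^ 2 + (if r \<in> {t * q - Q - 1<..Q} then 2 * real t - 1 else 0)"
    proof (cases "t * q \<le> Q + r")
      case True
      have "(Q + r) div q = t"
        by (rule div_nat_eqI) (use True t r in \<open>auto simp: algebra_simps\<close>)
      moreover have "r \<in> {t * q - Q - 1<..Q}" using True lo r by auto
      ultimately show ?thesis by (simp add: power2_eq_square algebra_simps)
    next
      case False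
      have tq: "t * q = (t - 1) * q + q" using t1 by (metis add.commute le_add_diff_inverse2 mult_Suc Suc_eq_plus1 one_le_numeral order_trans)
      have "(Q + r) div q = t - 1"
        by (rule div_nat_eqI) (use False t r tq in \<open>auto simp: algebra_simps\<close>)
      moreover have "r \<notin> {t * q - Q - 1<..Q}" using False lo r by auto
      ultimately show ?thesis using t1 by (simp add: of_nat_diff)
    qed
  qed
  also have "\<dots> = (real t - 1) ^ 2 * real (card {r. r \<in> {Q - q<..Q} \<and> coprime r q})
      + (\<Sum>r | r \<in> {Q - q<..Q} \<and> coprime r q. if r \<in> {t * q - Q - 1<..Q} then 2 * real t - 1 else 0)"
    by (simp add: sum.distrib)
  also have "(\<Sum>r | r \<in> {Q - q<..Q} \<and> coprime r q. if r \<in> {t * q - Q - 1<..Q} then 2 * real t - 1 else 0)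
      = (\<Sum>r\<in>{r \<in> {r. r \<in> {Q - q<..Q} \<and> coprime r q}. r \<in> {t * q - Q - 1<..Q}}. 2 * real t - 1)"
    by (rule sum.inter_filter[symmetric]) simp
  also have "{r \<in> {r. r \<in> {Q - q<..Q} \<and> coprime r q}. r \<in> {t * q - Q - 1<..Q}} = {r \<in> {t * q - Q - 1<..Q}. coprime r q}"
    using lo by auto
  also have "card {r. r \<in> {Q - q<..Q} \<and> coprime r q} = totient q"
    using card_coprime_period[of q "Q - q"] q by simp
  finally show ?thesis by simp
qed

text \<open>With \<open>t = 2 * Q div q\<close> this equals
  \<open>(t - 1) ^ 2 * q + (2 * t - 1) * (2 * Q - t * q)\<close>. Written as a sum over
  \<open>j\<close>, it depends on \<open>q\<close> through \<open>q\<close> and the products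
  \<open>q * j\<close> and is ready to become a divisor sum.\<close>

definition index_weight :: "nat \<Rightarrow> nat \<Rightarrow> real" where
  "index_weight Q q = real q - 2 * real Q + 2 * (\<Sum>j\<in>nats_upto (2 * real Q / real q). 2 * real Q - real q * real j)"

lemma coprime_index_square_sum_approx:
  fixes Q q :: nat
  assumes q: "1 \<le> q" "q \<le> Q"
  shows "\<bar>(\<Sum>r | r \<in> {Q - q<..Q} \<and> coprime r q. real ((Q + r) div q) ^ 2)
            - real (totient q) / real q * index_weight Q q\<bar> \<le> 32 * real Q / sqrt (real q)"
proof -
  define t where "t = (2 * Q) div q"
  define c where "c = real (card {r \<in> {t * q - Q - 1<..Q}. coprime r q})"
  define \<phi> where "\<phi> = real (totient q) / real q"
  define E where "E = (2 :: real) ^ card (prime_factors q)"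
  have t: "t * q \<le> 2 * Q" "2 * Q < t * q + q"
    using q div_mult_mod_eq[of "2 * Q" q] mod_less_divisor[of q "2 * Q"] unfolding t_def by linarith+
  have rt: "real t * real q \<le> 2 * real Q" using t(1) by (metis of_nat_le_iff of_nat_mult of_nat_numeral)
  have t1: "t \<ge> 2" unfolding t_def using q by (simp add: less_eq_div_iff_mult_less_eq)
  have lo: "t * q - Q - 1 \<le> Q" using t by simp
  have len: "real (Q - (t * q - Q - 1)) = 2 * real Q - real t * real q + 1"
  proof -
    have "Q + 1 \<le> t * q" using t q by linarith
    then have "Q - (t * q - Q - 1) + t * q = 2 * Q + 1" using t by linarith
    then have "real (Q - (t * q - Q - 1)) + real t * real q = 2 * real Q + 1"
      by (metis of_nat_1 of_nat_add of_nat_mult of_nat_numeral)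
    then show ?thesis by simp
  qed
  have \<phi>: "0 \<le> \<phi>" "\<phi> \<le> 1" "\<phi> * real q = real (totient q)"
    using q totient_le[of q] by (auto simp: \<phi>_def)
  \<comment> \<open>The interval is longer by 1 than the length used here; the difference is at most
    \<open>\<phi> \<le> 1 \<le> E\<close>.\<close>
  have c: "\<bar>c - \<phi> * (2 * real Q - real t * real q)\<bar> \<le> 2 * E"
  proof -
    have "\<bar>c - \<phi> * (2 * real Q - real t * real q + 1)\<bar> \<le> E"
      using card_coprime_interval_bound[OF _ lo, of q] q unfolding len c_def \<phi>_def E_def by simp
    moreover have "1 \<le> E" by (simp add: E_def)
    ultimately show ?thesis using \<phi> unfolding distrib_left abs_le_iff by linarith
  qed
  have "nats_upto (2 * real Q / real q) = {1..t}"
  proof -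
    have "\<lfloor>2 * real Q / real q\<rfloor> = int t"
      unfolding t_def using floor_divide_of_nat_eq[of "2 * Q" q] by simp
    then show ?thesis by (simp add: nats_upto_eq)
  qed
  then have W: "index_weight Q q = real q - 2 * real Q + 2 * (real t * (2 * real Q) - real q * (\<Sum>j\<in>{1..t}. real j))"
    by (simp add: index_weight_def sum_subtractf sum_distrib_left)
  have gauss: "(\<Sum>j\<in>{1..t}. real j) = real t * (real t + 1) / 2"
    by (induction t) (auto simp: field_simps)
  have "(\<Sum>r | r \<in> {Q - q<..Q} \<and> coprime r q. real ((Q + r) div q) ^ 2) - \<phi> * index_weight Q q
      = (2 * real t - 1) * (c - \<phi> * (2 * real Q - real t * real q))"
    unfolding coprime_index_square_sum[OF q] t_def[symmetric] c_def[symmetric] W gauss \<phi>(3)[symmetric]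
    by (simp add: field_simps power2_eq_square)
  also have "\<bar>\<dots>\<bar> \<le> (2 * real t) * (2 * E)"
    unfolding abs_mult using t1 c by (intro mult_mono) auto
  \<comment> \<open>From \<open>t \<le> 2 * Q / q\<close> and \<open>E \<le> 4 * sqrt q\<close>; the
    constants multiply to 32.\<close>
  also have "\<dots> \<le> (2 * (2 * real Q / real q)) * (2 * (4 * sqrt (real q)))"
    using rt q two_power_card_prime_factors_le[of q] unfolding E_def
    by (intro mult_mono) (auto simp: field_simps)
  also have "\<dots> = 32 * real Q * (sqrt (real q) / real q)" by simp
  also have "sqrt (real q) / real q = 1 / sqrt (real q)"
    using q real_div_sqrt[of "real q"] by (simp add: field_simps)
  finally show ?thesis by (simp add: \<phi>_def)
qed

lemma farey_moment_2_approx: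
  assumes Q: "Q \<ge> 2"
  shows "\<bar>farey_moment 2 B u k Q - (\<Sum>q | q \<in> {1..Q} \<and> [q = u] (mod k) \<and> B_free B q.
            real (totient q) / real q * index_weight Q q)\<bar> \<le> 64 * real Q powr (3 / 2)"
proof -
  define A where "A = {q. q \<in> {1..Q} \<and> [q = u] (mod k) \<and> B_free B q}"
  have A: "finite A" "A \<subseteq> {1..Q}" by (auto simp: A_def)
  have "\<bar>farey_moment 2 B u k Q - (\<Sum>q\<in>A. real (totient q) / real q * index_weight Q q)\<bar>
      = \<bar>\<Sum>q\<in>A. (\<Sum>r | r \<in> {Q - q<..Q} \<and> coprime r q. real ((Q + r) div q) ^ 2) - real (totient q) / real q * index_weight Q q\<bar>"
    unfolding farey_moment_eq[OF Q] A_def[symmetric] by (simp add: sum_subtractf)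
  also have "\<dots> \<le> (\<Sum>q\<in>A. 32 * real Q / sqrt (real q))"
    by (rule sum_abs[THEN order_trans], rule sum_mono, rule coprime_index_square_sum_approx) (use A in auto)
  also have "\<dots> \<le> (\<Sum>q\<in>{1..Q}. 32 * real Q / sqrt (real q))"
    by (rule sum_mono2) (use A in auto)
  also have "\<dots> = 32 * real Q * (\<Sum>q\<in>{1..Q}. 1 / sqrt (real q))" by (simp add: sum_distrib_left)
  also have "\<dots> \<le> 32 * real Q * (2 * sqrt (real Q))" by (intro mult_left_mono sum_inverse_sqrt_le) auto
  also have "\<dots> = 64 * real Q powr (3 / 2)"
  proof -
    have "real Q powr (3 / 2) = real Q powr (1 + 1 / 2)" by simp
    also have "\<dots> = real Q * sqrt (real Q)" unfolding powr_add using Q by (simp add: powr_half_sqrt)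
    finally show ?thesis by simp
  qed
  finally show ?thesis unfolding A_def .
qed

section \<open>Mean values over sieved denominators\<close>

definition sieve_weight :: "nat set \<Rightarrow> nat \<Rightarrow> complex" where
  "sieve_weight A p = (if p \<in> A then -1 else - 1 / of_nat p)"

lemma prod_sieve_weight:
  assumes "A \<subseteq> primes" "0 < q"
  shows "(\<Prod>p\<in>prime_factors q. 1 + sieve_weight A p) = of_real (if B_free A q then real (totient q) / real q else 0)"
proof (cases "B_free A q")
  case True
  then have "p \<notin> A" if "p \<in> prime_factors q" for p using that by (auto simp: B_free_def)
  then have "(\<Prod>p\<in>prime_factors q. 1 + sieve_weight A p) = (\<Prod>p\<in>prime_factors q. of_real (1 - 1 / real p))"
    by (intro prod.cong) (auto simp: sieve_weight_def)
  also have "\<dots> = of_real (\<Prod>p\<in>prime_factors q. 1 - 1 / real p)" by simp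
  also have "(\<Prod>p\<in>prime_factors q. 1 - 1 / real p) = real (totient q) / real q"
    using assms by (simp add: totient_formula2)
  finally show ?thesis using True by simp
next
  case False
  then obtain p where "p \<in> A" "p dvd q" using assms by (auto simp: B_free_def)
  then have "p \<in> prime_factors q" "1 + sieve_weight A p = 0"
    using assms by (auto simp: prime_factors_dvd sieve_weight_def)
  then have "(\<Prod>p\<in>prime_factors q. 1 + sieve_weight A p) = 0" by (meson finite_set_mset prod_zero)
  then show ?thesis using False by simp
qed

text \<open>On \<open>A\<close> the weight has norm 1 and the hypothesis on \<open>A\<close> is
  used; off \<open>A\<close> it has norm \<open>1 / p\<close>, which raises the exponent to
  \<open>1 + \<theta> > 1\<close>.\<close>

lemma weighted_mean_value_sieve:
  assumes mv: "mean_value \<psi> \<alpha> b K" and A: "A \<subseteq> primes" and \<theta>: "1 / 2 \<le> \<theta>" "\<theta> < 1"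
    and sm: "(\<lambda>p. real p powr (-\<theta>)) summable_on A"
  shows "weighted_mean_value \<psi> \<alpha> b K (sieve_weight A) \<theta>"
proof (intro weighted_mean_value.intro weighted_mean_value_axioms.intro mv \<theta>)
  have "(\<lambda>p. norm (sieve_weight A p) * real p powr (-\<theta>)) summable_on A"
    by (rule summable_on_comparison_test[OF sm]) (auto simp: sieve_weight_def)
  moreover have "(\<lambda>p. norm (sieve_weight A p) * real p powr (-\<theta>)) summable_on primes - A"
  proof (rule summable_on_comparison_test)
    show "(\<lambda>p. real p powr (-(1 + \<theta>))) summable_on primes - A"
      using \<theta> primes_subset_pos by (intro nat_powr_summable_on) auto
    fix p assume p: "p \<in> primes - A"
    then have "real p > 0" using primes_subset_pos by auto
    then have n: "norm (sieve_weight A p) = real p powr (-1)"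
      using p by (simp add: sieve_weight_def norm_divide powr_minus inverse_eq_divide)
    have e: "-(1 + \<theta>) = -1 + (-\<theta>)" by simp
    show "norm (sieve_weight A p) * real p powr (-\<theta>) \<le> real p powr (-(1 + \<theta>))"
      unfolding n e powr_add by (rule order_refl)
  qed auto
  ultimately have "(\<lambda>p. norm (sieve_weight A p) * real p powr (-\<theta>)) summable_on (A \<union> (primes - A))"
    by (rule summable_on_Un_disjoint) auto
  then show "(\<lambda>p. norm (sieve_weight A p) * real p powr (-\<theta>)) summable_on primes"
    using A by (simp add: Un_absorb1)
  show "norm (sieve_weight A p) \<le> 1" if "prime p" for p
    using prime_ge_1_nat[OF that] by (auto simp: sieve_weight_def norm_divide divide_le_eq)
qed

definition sieve_constant :: "(nat \<Rightarrow> complex) \<Rightarrow> nat set \<Rightarrow> complex" where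
  "sieve_constant \<psi> A = euler_sum (\<lambda>p. sieve_weight A p * \<psi> p / of_nat p) primes"

definition sieve_log_constant :: "(nat \<Rightarrow> complex) \<Rightarrow> nat set \<Rightarrow> complex" where
  "sieve_log_constant \<psi> A = (\<Sum>\<^sub>\<infinity>p\<in>primes. of_real (ln (real p)) * (sieve_weight A p * \<psi> p / of_nat p)
      / (1 + sieve_weight A p * \<psi> p / of_nat p))"

definition sieved_sum :: "(nat \<Rightarrow> complex) \<Rightarrow> nat set \<Rightarrow> nat \<Rightarrow> complex" where
  "sieved_sum \<psi> A Q = (\<Sum>q\<in>{1..Q}. \<psi> q * of_real ((if B_free A q then real (totient q) / real q else 0) * index_weight Q q))"

lemma sieved_sum_asymptotics:
  assumes mv: "mean_value \<psi> \<alpha> b K" and A: "A \<subseteq> primes" and \<theta>: "1 / 2 \<le> \<theta>" "\<theta> < 1"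
    and sm: "(\<lambda>p. real p powr (-\<theta>)) summable_on A"
  shows "\<exists>C. \<forall>Q\<ge>1. norm (sieved_sum \<psi> A Q - 4 * of_nat Q ^ 2 *
      (sieve_constant \<psi> A * (\<alpha> * (of_real (ln (2 * real Q)) - 9 / 8) + (b + \<alpha> * (euler_mascheroni - 1)))
        - \<alpha> * (sieve_constant \<psi> A * sieve_log_constant \<psi> A))) \<le> C * real Q powr (1 + \<theta>)"
proof -
  interpret weighted_mean_value \<psi> \<alpha> b K "sieve_weight A" \<theta>
    by (rule weighted_mean_value_sieve) fact+
  have loc: "local_factor = (\<lambda>p. sieve_weight A p * \<psi> p / of_nat p)" by (simp add: local_factor_def fun_eq_iff)
  have dens: "density = sieve_constant \<psi> A" by (simp add: density_def sieve_constant_def loc)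
  have log_dens: "log_density = sieve_log_constant \<psi> A" by (simp add: log_density_def sieve_log_constant_def loc)
  obtain C where C: "\<And>Q. Q \<ge> 1 \<Longrightarrow> norm ((\<Sum>q\<in>nats_upto Q. \<psi> q * weight q *
         of_real (real q - 2 * Q + 2 * (\<Sum>j\<in>nats_upto (2 * Q / real q). 2 * Q - real q * real j)))
      - 4 * of_real (Q\<^sup>2) * (density * (\<alpha> * (of_real (ln (2 * Q)) - 9 / 8) + \<beta>) - \<alpha> * (density * log_density)))
      \<le> C * Q powr (1 + \<theta>)"
    using quadratic_weight_mean by blast
  show ?thesis
  proof (intro exI allI impI)
    fix Q :: nat assume Q: "Q \<ge> 1"
    have "sieved_sum \<psi> A Q = (\<Sum>q\<in>nats_upto (real Q). \<psi> q * weight q *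
         of_real (real q - 2 * real Q + 2 * (\<Sum>j\<in>nats_upto (2 * real Q / real q). 2 * real Q - real q * real j)))"
      unfolding sieved_sum_def nats_upto_of_nat index_weight_def[symmetric]
    proof (intro sum.cong refl)
      fix q assume "q \<in> {1..Q}"
      then have "weight q = of_real (if B_free A q then real (totient q) / real q else 0)"
        unfolding weight_def using A by (intro prod_sieve_weight) auto
      then show "\<psi> q * of_real ((if B_free A q then real (totient q) / real q else 0) * index_weight Q q)
          = \<psi> q * weight q * of_real (index_weight Q q)" by (simp only: of_real_mult mult.assoc)
    qed
    moreover have "4 * of_real ((real Q)\<^sup>2) = (4 * of_nat Q ^ 2 :: complex)" by simp
    ultimately show "norm (sieved_sum \<psi> A Q - 4 * of_nat Q ^ 2 *
      (sieve_constant \<psi> A * (\<alpha> * (of_real (ln (2 * real Q)) - 9 / 8) + (b + \<alpha> * (euler_mascheroni - 1)))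
        - \<alpha> * (sieve_constant \<psi> A * sieve_log_constant \<psi> A))) \<le> C * real Q powr (1 + \<theta>)"
      using C[of "real Q"] Q unfolding dens log_dens \<beta>_def by simp
  qed
qed

lemma powr_summable_imp_inverse_summable:
  assumes "\<theta> < 1" "A \<subseteq> primes" "(\<lambda>p. real p powr (-\<theta>)) summable_on A"
  shows "(\<lambda>p. 1 / real p) summable_on A"
proof (rule summable_on_comparison_test[OF assms(3)])
  fix p assume "p \<in> A"
  then have p: "real p \<ge> 1" using assms prime_ge_1_nat by auto
  then have "1 / real p = real p powr (-1)" by (simp add: powr_minus divide_inverse)
  also have "\<dots> \<le> real p powr (-\<theta>)" using p assms by (intro powr_mono) auto
  finally show "1 / real p \<le> real p powr (-\<theta>)" .
qed auto

text \<open>Off \<open>A\<close> the local factor is \<open>- \<psi> p / p ^ 2\<close>, the one of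
  the reciprocal L-series at 2. Multiplying by that series cancels all primes outside
  \<open>A\<close>.\<close>

lemma sieve_constant_has_prod:
  assumes bm: "bounded_multiplicative \<psi>" and A: "A \<subseteq> primes" and \<theta>: "\<theta> < 1"
    and sm: "(\<lambda>p. real p powr (-\<theta>)) summable_on A"
  shows "(\<lambda>p. if p \<in> A then (1 - \<psi> p / of_nat p) * inverse (1 - \<psi> p / of_nat p ^ 2) else 1)
           has_prod (sieve_constant \<psi> A * bounded_multiplicative.series_at_2 \<psi>)"
proof -
  interpret bounded_multiplicative \<psi> by fact
  have "(\<lambda>p. sieve_weight A p * \<psi> p / of_nat p) = (\<lambda>p. if p \<in> A then - \<psi> p / of_nat p else m p)"
    by (auto simp: sieve_weight_def m_def power2_eq_square fun_eq_iff)
  then show ?thesis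
    using euler_product_over[OF A powr_summable_imp_inverse_summable[OF \<theta> A sm]]
    by (simp add: sieve_constant_def)
qed

lemma nonprincipal_sieved_sum:
  assumes k: "k > 0" and \<psi>: "\<psi> \<in> dirichlet_characters k" "\<psi> \<noteq> principal_character k"
    and A: "A \<subseteq> primes" and \<theta>: "1 / 2 \<le> \<theta>" "\<theta> < 1"
    and sm: "(\<lambda>p. real p powr (-\<theta>)) summable_on A"
  shows "\<exists>C. \<forall>Q\<ge>1. norm (sieved_sum (\<lambda>n. \<psi> (int n)) A Q - 4 * of_nat Q ^ 2 *
      (dirichlet_L \<psi> 1 / dirichlet_L \<psi> 2 *
        prod_over A (\<lambda>p. (1 - \<psi> (int p) / of_nat p) * inverse (1 - \<psi> (int p) / of_nat p ^ 2))))
      \<le> C * real Q powr (1 + \<theta>)"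
proof -
  define H where "H = sieve_constant (\<lambda>n. \<psi> (int n)) A"
  interpret bounded_multiplicative "\<lambda>n. \<psi> (int n)" by (rule bounded_multiplicative_character[OF k \<psi>(1)])
  have series_at_2: "dirichlet_L \<psi> 2 = series_at_2" by (rule dirichlet_L_at_2[OF k \<psi>(1)])
  have nz: "series_at_2 \<noteq> 0" using series_at_2_times_euler_sum by auto
  have "prod_over A (\<lambda>p. (1 - \<psi> (int p) / of_nat p) * inverse (1 - \<psi> (int p) / of_nat p ^ 2)) = H * series_at_2"
    unfolding prod_over_def H_def
    by (rule has_prod_unique[symmetric, OF sieve_constant_has_prod[OF bounded_multiplicative_axioms A \<theta>(2) sm]])
  then have "dirichlet_L \<psi> 1 / dirichlet_L \<psi> 2 *
        prod_over A (\<lambda>p. (1 - \<psi> (int p) / of_nat p) * inverse (1 - \<psi> (int p) / of_nat p ^ 2)) = H * dirichlet_L \<psi> 1"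
    using nz by (simp add: series_at_2)
  then show ?thesis
    using sieved_sum_asymptotics[OF mean_value_character[OF k \<psi>] A \<theta> sm] unfolding H_def by simp
qed

lemma log_sum_summable:
  assumes \<theta>: "\<theta> < 1" and A: "A \<subseteq> primes" and sm: "(\<lambda>p. real p powr (-\<theta>)) summable_on A"
  shows "(\<lambda>p. real p * ln (real p) / (real p ^ 2 - 1)) summable_on A"
proof (rule summable_on_comparison_test)
  show "(\<lambda>p. 2 / (1 - \<theta>) * real p powr (-\<theta>)) summable_on A"
    by (intro summable_on_cmult_right sm)
  fix p assume "p \<in> A"
  then have p: "real p \<ge> 2" using A prime_ge_2_nat by auto
  then have p2: "real p ^ 2 \<ge> 2" using power_mono[of 2 "real p" 2] by simp
  have "real p * ln (real p) / (real p ^ 2 - 1) \<le> real p * ln (real p) / (real p ^ 2 / 2)"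
    using p p2 by (intro divide_left_mono) auto
  also have "\<dots> = 2 * (ln (real p) / real p)" using p by (simp add: power2_eq_square)
  also have "\<dots> \<le> 2 * ((real p powr (1 - \<theta>) / (1 - \<theta>)) / real p)"
    using p \<theta> by (intro mult_left_mono divide_right_mono ln_powr_bound) auto
  also have "real p powr (1 - \<theta>) = real p * real p powr (-\<theta>)"
    using p powr_add[of "real p" 1 "-\<theta>"] by simp
  finally show "real p * ln (real p) / (real p ^ 2 - 1) \<le> 2 / (1 - \<theta>) * real p powr (-\<theta>)"
    using p by simp
  show "0 \<le> real p * ln (real p) / (real p ^ 2 - 1)" using p p2 by simp
qed

text \<open>A prime in \<open>A\<close> contributes \<open>ln p / (p - 1)\<close>, the sum of
  \<open>p * ln p / (p ^ 2 - 1)\<close> and \<open>ln p / (p ^ 2 - 1)\<close>; any other prime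
  contributes only the latter. The common part, summed over all primes, is the logarithmic
  derivative of zeta at 2 up to sign.\<close>

lemma sieve_log_constant_trivial:
  assumes \<theta>: "\<theta> < 1" and A: "A \<subseteq> primes" and sm: "(\<lambda>p. real p powr (-\<theta>)) summable_on A"
  shows "- sieve_log_constant (\<lambda>_. 1) A =
           of_real (\<Sum>\<^sub>\<infinity>p\<in>A. real p * ln (real p) / (real p ^ 2 - 1)) - deriv zeta 2 / zeta 2"
proof -
  define a where "a p = real p * ln (real p) / (real p ^ 2 - 1)" for p :: nat
  define c where "c p = ln (real p) / (real p ^ 2 - 1)" for p :: nat
  have a: "(a has_sum infsum a A) A" unfolding a_def using log_sum_summable[OF assms] by simp
  moreover have "(a has_sum infsum a A) A \<longleftrightarrow> ((\<lambda>p. if p \<in> A then a p else 0) has_sum infsum a A) primes"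
    by (rule has_sum_cong_neutral) (use A in auto)
  ultimately have a': "((\<lambda>p. if p \<in> A then a p else 0) has_sum infsum a A) primes" by blast
  have c: "(c has_sum infsum c primes) primes" unfolding c_def using prime_log_summable by simp
  have "((\<lambda>p. complex_of_real ((if p \<in> A then a p else 0) + c p)) has_sum of_real (infsum a A + infsum c primes)) primes"
    by (intro has_sum_of_real has_sum_add a' c)
  then have "of_real (infsum a A + infsum c primes) = (\<Sum>\<^sub>\<infinity>p\<in>primes. complex_of_real ((if p \<in> A then a p else 0) + c p))"
    by (simp only: infsumI)
  also have "\<dots> = (\<Sum>\<^sub>\<infinity>p\<in>primes. - (of_real (ln (real p)) * (sieve_weight A p * 1 / of_nat p) / (1 + sieve_weight A p * 1 / of_nat p)))"
  proof (rule infsum_cong)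
    fix p assume "p \<in> primes"
    then have p: "real p \<ge> 2" using prime_ge_2_nat by auto
    define x where "x = real p"
    define w where "w = (if p \<in> A then - 1 else - 1 / x)"
    have w: "sieve_weight A p = complex_of_real w" by (simp add: sieve_weight_def w_def x_def)
    have x: "x \<ge> 2" "x ^ 2 - 1 = (x - 1) * (x + 1)" using p by (auto simp: x_def power2_eq_square algebra_simps)
    have "- (ln x * (w * 1 / x) / (1 + w * 1 / x)) = (if p \<in> A then x * ln x / (x ^ 2 - 1) else 0) + ln x / (x ^ 2 - 1)"
    proof (cases "p \<in> A")
      case True
      have "- (ln x * (w * 1 / x) / (1 + w * 1 / x)) = ln x / (x - 1)"
        using x(1) True by (simp add: w_def field_simps)
      also have "\<dots> = (x + 1) * ln x / ((x - 1) * (x + 1))" using x(1) by simp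
      also have "\<dots> = x * ln x / (x ^ 2 - 1) + ln x / (x ^ 2 - 1)"
        unfolding x(2) by (simp add: distrib_right add_divide_distrib)
      finally show ?thesis using True by simp
    next
      case False
      have "x ^ 2 \<noteq> 1" using x by auto
      then show ?thesis using x(1) False by (simp add: w_def divide_simps power2_eq_square)
    qed
    then have eq: "(if p \<in> A then a p else 0) + c p = - (ln x * (w * 1 / x) / (1 + w * 1 / x))"
      unfolding a_def c_def x_def[symmetric] by (rule sym)
    show "complex_of_real ((if p \<in> A then a p else 0) + c p)
        = - (of_real (ln (real p)) * (sieve_weight A p * 1 / of_nat p) / (1 + sieve_weight A p * 1 / of_nat p))"
      unfolding eq w by (simp add: x_def)
  qed
  also have "\<dots> = - sieve_log_constant (\<lambda>_. 1) A"
    unfolding sieve_log_constant_def by (rule infsum_uminus)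
  finally have "- sieve_log_constant (\<lambda>_. 1) A = of_real (infsum a A) + of_real (infsum c primes)"
    by (simp only: of_real_add)
  also have "of_real (infsum c primes) = - deriv zeta 2 / zeta 2"
    using log_deriv_zeta_2 by (simp add: c_def[abs_def])
  finally show ?thesis unfolding a_def[abs_def] by simp
qed

lemma sieve_constant_trivial:
  assumes k: "k > 0" and \<theta>: "\<theta> < 1" and B: "B \<subseteq> primes" and sm: "(\<lambda>p. real p powr (-\<theta>)) summable_on B"
  shows "sieve_constant (\<lambda>_. 1) (B \<union> prime_factors k) =
    prod_over {p\<in>B. \<not> p dvd k} (\<lambda>p. inverse (1 + 1 / of_nat p)) *
      (\<Prod>p\<in>prime_factors k. inverse (1 + 1 / of_nat p)) / zeta 2"
proof -
  define A where "A = B \<union> prime_factors k"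
  define v :: "nat \<Rightarrow> complex" where "v p = inverse (1 + 1 / of_nat p)" for p
  interpret trivial: bounded_multiplicative "\<lambda>_. 1" by unfold_locales auto
  have A: "A \<subseteq> primes" using B by (auto simp: A_def)
  have smA: "(\<lambda>p. real p powr (-\<theta>)) summable_on A"
    unfolding A_def by (intro summable_on_union sm summable_on_finite) auto
  have z: "zeta 2 = trivial.series_at_2" by (rule zeta_2)
  have nz: "zeta 2 \<noteq> 0" using trivial.series_at_2_times_euler_sum by (auto simp: z)
  have v0: "v p \<noteq> 0" for p
  proof -
    have "1 + 1 / of_nat p = complex_of_real (1 + 1 / real p)" by simp
    moreover have "1 + 1 / real p > 0" by (simp add: add_pos_nonneg)
    ultimately have "1 + 1 / of_nat p \<noteq> (0 :: complex)" by (metis less_irrefl of_real_eq_0_iff)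
    then show ?thesis by (simp add: v_def)
  qed
  have v: "(1 - 1 / of_nat p) * inverse (1 - 1 / of_nat p ^ 2) = v p" if "prime p" for p
  proof -
    have "of_nat p \<noteq> (1 :: complex)" "of_nat p \<noteq> (0 :: complex)" using prime_gt_1_nat[OF that] by auto
    then have "1 - 1 / of_nat p \<noteq> (0 :: complex)" by (simp add: field_simps)
    moreover have "1 - 1 / of_nat p ^ 2 = (1 - 1 / of_nat p) * (1 + 1 / of_nat p :: complex)"
      by (simp add: algebra_simps power2_eq_square)
    ultimately show ?thesis by (simp add: v_def inverse_mult_distrib del: right_minus_eq)
  qed
  have "(\<lambda>p. if p \<in> A then (1 - 1 / of_nat p) * inverse (1 - 1 / of_nat p ^ 2) else 1)
           has_prod (sieve_constant (\<lambda>_. 1) A * zeta 2)"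
    unfolding z by (rule sieve_constant_has_prod[OF trivial.bounded_multiplicative_axioms A \<theta> smA])
  also have "(\<lambda>p. if p \<in> A then (1 - 1 / of_nat p) * inverse (1 - 1 / of_nat p ^ 2) else 1) = (\<lambda>p. if p \<in> A then v p else 1)"
    using A v by (auto simp: fun_eq_iff)
  \<comment> \<open>Dividing by the finite product over the primes of \<open>k\<close> leaves the
    primes of \<open>B\<close> that do not divide \<open>k\<close>, so those in both sets are not
    counted twice.\<close>
  finally have "(\<lambda>p. (if p \<in> A then v p else 1) / (if p \<in> prime_factors k then v p else 1))
      has_prod (sieve_constant (\<lambda>_. 1) A * zeta 2 / (\<Prod>p\<in>prime_factors k. v p))"
    by (intro has_prod_divide has_prod_If_finite_set) auto
  also have "(\<lambda>p. (if p \<in> A then v p else 1) / (if p \<in> prime_factors k then v p else 1))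
      = (\<lambda>p. if p \<in> {p\<in>B. \<not> p dvd k} then v p else 1)"
    using B k v0 by (auto simp: fun_eq_iff A_def prime_factors_dvd)
  finally have "prod_over {p\<in>B. \<not> p dvd k} v = sieve_constant (\<lambda>_. 1) A * zeta 2 / (\<Prod>p\<in>prime_factors k. v p)"
    unfolding prod_over_def by (rule has_prod_unique[symmetric])
  moreover have "(\<Prod>p\<in>prime_factors k. v p) \<noteq> 0" using v0 by simp
  ultimately show ?thesis using nz unfolding A_def v_def[abs_def] by (simp add: field_simps)
qed

lemma principal_sieved_sum:
  assumes k: "k > 0" and B: "B \<subseteq> primes" and \<theta>: "1 / 2 \<le> \<theta>" "\<theta> < 1"
    and sm: "(\<lambda>p. real p powr (-\<theta>)) summable_on B"
  shows "\<exists>C. \<forall>Q\<ge>1. norm (sieved_sum (\<lambda>n. principal_character k (int n)) B Q -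
      4 * of_nat Q ^ 2 / zeta 2 *
           (of_real (ln (2 * real Q)) + 2 * euler_mascheroni - deriv zeta 2 / zeta 2 - 17 / 8
            + of_real (\<Sum>\<^sub>\<infinity>p\<in>{p\<in>B. \<not> p dvd k}. real p * ln (real p) / (real p ^ 2 - 1))
            + of_real (\<Sum>p\<in>prime_factors k. real p * ln (real p) / (real p ^ 2 - 1))) *
           prod_over {p\<in>B. \<not> p dvd k} (\<lambda>p. inverse (1 + 1 / of_nat p)) *
           (\<Prod>p\<in>prime_factors k. inverse (1 + 1 / of_nat p))) \<le> C * real Q powr (1 + \<theta>)"
proof -
  define A where "A = B \<union> prime_factors k"
  define a where "a p = real p * ln (real p) / (real p ^ 2 - 1)" for p :: nat
  define D where "D = {p\<in>B. \<not> p dvd k}"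
  define E where "E = sieve_constant (\<lambda>_. 1) A"
  have A: "A \<subseteq> primes" using B by (auto simp: A_def)
  have smA: "(\<lambda>p. real p powr (-\<theta>)) summable_on A"
    unfolding A_def by (intro summable_on_union sm summable_on_finite) auto
  have D: "A = D \<union> prime_factors k" "D \<inter> prime_factors k = {}"
    using B k by (auto simp: A_def D_def prime_factors_dvd)
  have "a summable_on D"
    unfolding a_def[abs_def] by (rule summable_on_subset[OF log_sum_summable[OF \<theta>(2) A smA]]) (use D(1) in auto)
  then have aA: "infsum a A = infsum a D + (\<Sum>p\<in>prime_factors k. a p)"
    unfolding D(1) using D(2) by (subst infsum_Un_disjoint) auto
  have L: "sieve_log_constant (\<lambda>_. 1) A = deriv zeta 2 / zeta 2 - of_real (infsum a A)"
    using sieve_log_constant_trivial[OF \<theta>(2) A smA] unfolding a_def[abs_def] by (simp add: algebra_simps minus_equation_iff)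
  have E: "E = prod_over D (\<lambda>p. inverse (1 + 1 / of_nat p)) * (\<Prod>p\<in>prime_factors k. inverse (1 + 1 / of_nat p)) / zeta 2"
    unfolding E_def A_def D_def by (rule sieve_constant_trivial[OF k \<theta>(2) B sm])
  have eq: "sieved_sum (\<lambda>n. principal_character k (int n)) B Q = sieved_sum (\<lambda>_. 1) A Q" for Q
    unfolding sieved_sum_def
  proof (intro sum.cong refl)
    fix q assume q: "q \<in> {1..Q}"
    have "B_free A q \<longleftrightarrow> B_free B q \<and> coprime q k"
    proof -
      have "coprime q k \<longleftrightarrow> (\<forall>p\<in>prime_factors k. \<not> p dvd q)"
      proof
        assume *: "coprime q k"
        show "\<forall>p\<in>prime_factors k. \<not> p dvd q"
        proof (intro ballI notI)
          fix p assume "p \<in> prime_factors k" "p dvd q"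
          then have "prime p" "p dvd gcd q k" by (auto simp: prime_factors_dvd)
          moreover have "gcd q k = 1" using * by (rule coprime_imp_gcd_eq_1)
          ultimately show False by simp
        qed
      next
        assume *: "\<forall>p\<in>prime_factors k. \<not> p dvd q"
        show "coprime q k"
        proof (rule ccontr)
          assume "\<not> coprime q k"
          then have "gcd q k \<noteq> 1" by (simp only: coprime_iff_gcd_eq_1 not_False_eq_True)
          then obtain p where "prime p" "p dvd gcd q k" using prime_factor_nat by blast
          then have "p \<in> prime_factors k" "p dvd q" using k by (auto simp: prime_factors_dvd)
          then show False using * by blast
        qed
      qed
      then show ?thesis by (auto simp: B_free_def A_def)
    qed
    moreover have "principal_character k (int q) = (if coprime q k then 1 else 0)"
      by (simp add: principal_character_def)
    ultimately show "principal_character k (int q) * of_real ((if B_free B q then real (totient q) / real q else 0) * index_weight Q q)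
        = 1 * of_real ((if B_free A q then real (totient q) / real q else 0) * index_weight Q q)"
      by (cases "coprime q k") simp_all
  qed
  \<comment> \<open>The constant arises as \<open>- 9/8 + (2 * euler_mascheroni - 1) = 2 *
    euler_mascheroni - 17/8\<close>.\<close>
  have main: "4 * of_nat Q ^ 2 / zeta 2 *
           (of_real (ln (2 * real Q)) + 2 * euler_mascheroni - deriv zeta 2 / zeta 2 - 17 / 8
            + of_real (infsum a D) + of_real (\<Sum>p\<in>prime_factors k. a p)) *
           prod_over D (\<lambda>p. inverse (1 + 1 / of_nat p)) *
           (\<Prod>p\<in>prime_factors k. inverse (1 + 1 / of_nat p))
      = 4 * of_nat Q ^ 2 * (E * (1 * (of_real (ln (2 * real Q)) - 9 / 8) + (euler_mascheroni + 1 * (euler_mascheroni - 1)))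
          - 1 * (E * sieve_log_constant (\<lambda>_. 1) A))" (is "?l = ?r") for Q
  proof -
    define l where "l = complex_of_real (ln (2 * real Q))"
    define x where "x = complex_of_real (infsum a D)"
    define y where "y = complex_of_real (\<Sum>p\<in>prime_factors k. a p)"
    define Z where "Z = deriv zeta 2 / zeta 2"
    define \<gamma> where "\<gamma> = (euler_mascheroni :: complex)"
    have split: "N / z * br * po * pr = N * br * (po * pr / z)" for N z br po pr :: complex
      by simp
    have "?l = 4 * of_nat Q ^ 2 * (l + 2 * \<gamma> - Z - 17 / 8 + x + y) * E"
      unfolding E split l_def x_def y_def Z_def \<gamma>_def ..
    also have "\<dots> = 4 * of_nat Q ^ 2 * (E * (1 * (l - 9 / 8) + (\<gamma> + 1 * (\<gamma> - 1))) - 1 * (E * (Z - (x + y))))"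
      by (simp add: algebra_simps)
    finally show ?thesis
      unfolding L aA l_def x_def y_def Z_def \<gamma>_def of_real_add .
  qed
  show ?thesis
    using sieved_sum_asymptotics[OF mean_value_one A \<theta> smA]
    unfolding eq main[unfolded D_def a_def[abs_def]] E_def[symmetric] by (simp only: of_real_sum)
qed

theorem theorem1p3:
  fixes \<theta> :: real and B :: "nat set" and k :: nat
  assumes "1/2 < \<theta>" and "\<theta> < 1"
    and "infinite B" and "\<forall>p\<in>B. prime p"
    and "\<exists>\<sigma><\<theta>. (\<lambda>p. real p powr (-\<sigma>)) summable_on B"
    and "k > 0"
  shows "\<exists>C::real. \<forall>(u::nat) (ubar::int).
    u > 0 \<longrightarrow> coprime k u \<longrightarrow> [int u * ubar = 1] (mod int k) \<longrightarrow>
    (\<forall>\<^sub>F Q::nat in sequentially.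
      norm (complex_of_real (farey_moment 2 B u k Q) -
        (4 * of_nat Q ^ 2 / (of_nat (totient k) * zeta 2) *
           (of_real (ln (2 * real Q)) + 2 * euler_mascheroni - deriv zeta 2 / zeta 2 - 17 / 8
            + of_real (\<Sum>\<^sub>\<infinity>p\<in>{p\<in>B. \<not> p dvd k}. real p * ln (real p) / (real p ^ 2 - 1))
            + of_real (\<Sum>p\<in>prime_factors k. real p * ln (real p) / (real p ^ 2 - 1))) *
           prod_over {p\<in>B. \<not> p dvd k} (\<lambda>p. inverse (1 + 1 / of_nat p)) *
           (\<Prod>p\<in>prime_factors k. inverse (1 + 1 / of_nat p))
         + 4 * of_nat Q ^ 2 / of_nat (totient k) *
           (\<Sum>\<psi>\<in>dirichlet_characters k - {principal_character k}.
              \<psi> ubar * dirichlet_L \<psi> 1 / dirichlet_L \<psi> 2 *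
              prod_over B (\<lambda>p. (1 - \<psi> (int p) / of_nat p) *
                               inverse (1 - \<psi> (int p) / of_nat p ^ 2)))))
      \<le> C * (real Q powr (1 + \<theta>) * (ln (real Q))\<^sup>2))"
proof -
  note k = \<open>k > 0\<close>
  have B: "B \<subseteq> primes" using assms(4) by auto
  have \<theta>: "1 / 2 \<le> \<theta>" "\<theta> < 1" using assms(1,2) by auto
  obtain \<sigma> where \<sigma>: "\<sigma> < \<theta>" "(\<lambda>p. real p powr (-\<sigma>)) summable_on B" using assms(5) by blast
  have sm: "(\<lambda>p. real p powr (-\<theta>)) summable_on B"
  proof (rule summable_on_comparison_test[OF \<sigma>(2)])
    fix p assume "p \<in> B"
    then have "real p \<ge> 1" using B prime_ge_1_nat by auto
    then show "real p powr (-\<theta>) \<le> real p powr (-\<sigma>)" using \<sigma>(1) by (intro powr_mono) auto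
  qed auto
  define X where "X = dirichlet_characters k"
  define \<phi>\<^sub>0 where "\<phi>\<^sub>0 = principal_character k"
  have X: "finite X" "\<phi>\<^sub>0 \<in> X"
    using finite_dirichlet_characters[OF k] principal_character_in[OF k] by (auto simp: X_def \<phi>\<^sub>0_def)
  define \<phi> where "\<phi> = (of_nat (totient k) :: complex)"
  have \<phi>: "norm \<phi> \<ge> 1" "\<phi> \<noteq> 0" using k by (auto simp: \<phi>_def Suc_le_eq)
  define P where "P Q = 4 * of_nat Q ^ 2 / zeta 2 *
           (of_real (ln (2 * real Q)) + 2 * euler_mascheroni - deriv zeta 2 / zeta 2 - 17 / 8
            + of_real (\<Sum>\<^sub>\<infinity>p\<in>{p\<in>B. \<not> p dvd k}. real p * ln (real p) / (real p ^ 2 - 1))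
            + of_real (\<Sum>p\<in>prime_factors k. real p * ln (real p) / (real p ^ 2 - 1))) *
           prod_over {p\<in>B. \<not> p dvd k} (\<lambda>p. inverse (1 + 1 / of_nat p)) *
           (\<Prod>p\<in>prime_factors k. inverse (1 + 1 / of_nat p))" for Q :: nat
  define R where "R \<psi> = dirichlet_L \<psi> 1 / dirichlet_L \<psi> 2 *
      prod_over B (\<lambda>p. (1 - \<psi> (int p) / of_nat p) * inverse (1 - \<psi> (int p) / of_nat p ^ 2))" for \<psi>
  define M where "M \<psi> Q = (if \<psi> = \<phi>\<^sub>0 then P Q else 4 * of_nat Q ^ 2 * R \<psi>)" for \<psi> and Q :: nat
  define S where "S \<psi> Q = sieved_sum (\<lambda>n. \<psi> (int n)) B Q" for \<psi> Q
  have "\<exists>C. \<forall>Q\<ge>1. norm (S \<psi> Q - M \<psi> Q) \<le> C * real Q powr (1 + \<theta>)" if "\<psi> \<in> X" for \<psi>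
  proof (cases "\<psi> = \<phi>\<^sub>0")
    case True
    then show ?thesis
      using principal_sieved_sum[OF k B \<theta> sm] by (simp only: S_def M_def P_def \<phi>\<^sub>0_def if_True simp_thms)
  next
    case False
    then show ?thesis
      using nonprincipal_sieved_sum[OF k _ _ B \<theta> sm] that by (simp add: S_def M_def R_def \<phi>\<^sub>0_def X_def)
  qed
  then obtain Cf where Cf: "\<And>\<psi> Q. \<psi> \<in> X \<Longrightarrow> Q \<ge> 1 \<Longrightarrow> norm (S \<psi> Q - M \<psi> Q) \<le> Cf \<psi> * real Q powr (1 + \<theta>)"
    by metis
  \<comment> \<open>The constant is fixed before \<open>u\<close> and \<open>ubar\<close>: the
    estimates for single characters do not involve the residue class, and 64 comes from the
    approximation of the moment.\<close>
  define C where "C = 64 + (\<Sum>\<psi>\<in>X. \<bar>Cf \<psi>\<bar>)"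
  have C0: "C \<ge> 0" by (simp add: C_def add_nonneg_nonneg sum_nonneg)
  have bound: "norm (complex_of_real (farey_moment 2 B u k Q) -
        (P Q / \<phi> + 4 * of_nat Q ^ 2 / \<phi> * (\<Sum>\<psi>\<in>X - {\<phi>\<^sub>0}. \<psi> ubar * R \<psi>)))
      \<le> C * (real Q powr (1 + \<theta>) * (ln (real Q))\<^sup>2)"
    if ubar: "[int u * ubar = 1] (mod int k)" and Q: "Q \<ge> 3" for u ubar Q
  proof -
    define w where "w q = real (totient q) / real q * index_weight Q q" for q
    define T where "T = (\<Sum>q | q \<in> {1..Q} \<and> [q = u] (mod k) \<and> B_free B q. w q)"
    have "coprime ubar (int k)"
      using ubar by (metis cong_imp_coprime cong_sym coprime_1_left coprime_mult_left_iff)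
    then have \<phi>\<^sub>0u: "\<phi>\<^sub>0 ubar = 1" by (simp add: \<phi>\<^sub>0_def principal_character_def)
    \<comment> \<open>Exchanging the sums over characters and denominators lets orthogonality pick
      out the class of \<open>u\<close>.\<close>
    have "(\<Sum>\<psi>\<in>X. \<psi> ubar * S \<psi> Q)
        = (\<Sum>q\<in>{1..Q}. (\<Sum>\<psi>\<in>X. \<psi> ubar * \<psi> (int q)) * of_real ((if B_free B q then real (totient q) / real q else 0) * index_weight Q q))"
      unfolding S_def sieved_sum_def sum_distrib_left sum_distrib_right by (subst sum.swap) (simp only: mult.assoc)
    also have "\<dots> = (\<Sum>q\<in>{1..Q}. if [q = u] (mod k) \<and> B_free B q then \<phi> * of_real (w q) else 0)"
    proof (intro sum.cong refl)
      fix q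
      have "(\<Sum>\<psi>\<in>X. \<psi> ubar * \<psi> (int q)) = (if [q = u] (mod k) then \<phi> else 0)"
        unfolding X_def \<phi>_def character_orthogonality[OF k ubar] cong_int_iff ..
      then show "(\<Sum>\<psi>\<in>X. \<psi> ubar * \<psi> (int q)) * of_real ((if B_free B q then real (totient q) / real q else 0) * index_weight Q q)
          = (if [q = u] (mod k) \<and> B_free B q then \<phi> * of_real (w q) else 0)"
        by (simp add: w_def)
    qed
    also have "\<dots> = (\<Sum>q\<in>{q\<in>{1..Q}. [q = u] (mod k) \<and> B_free B q}. \<phi> * of_real (w q))"
      by (rule sum.inter_filter[symmetric]) simp
    also have "\<dots> = \<phi> * of_real T" by (simp add: T_def sum_distrib_left)
    finally have T: "complex_of_real T = (\<Sum>\<psi>\<in>X. \<psi> ubar * S \<psi> Q) / \<phi>" using \<phi> by simp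
    have main: "P Q / \<phi> + 4 * of_nat Q ^ 2 / \<phi> * (\<Sum>\<psi>\<in>X - {\<phi>\<^sub>0}. \<psi> ubar * R \<psi>) = (\<Sum>\<psi>\<in>X. \<psi> ubar * M \<psi> Q) / \<phi>"
    proof -
      have "(\<Sum>\<psi>\<in>X. \<psi> ubar * M \<psi> Q) = \<phi>\<^sub>0 ubar * M \<phi>\<^sub>0 Q + (\<Sum>\<psi>\<in>X - {\<phi>\<^sub>0}. \<psi> ubar * M \<psi> Q)"
        by (rule sum.remove[OF X])
      also have "(\<Sum>\<psi>\<in>X - {\<phi>\<^sub>0}. \<psi> ubar * M \<psi> Q) = (\<Sum>\<psi>\<in>X - {\<phi>\<^sub>0}. 4 * of_nat Q ^ 2 * (\<psi> ubar * R \<psi>))"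
        by (intro sum.cong refl) (simp add: M_def)
      also have "\<dots> = 4 * of_nat Q ^ 2 * (\<Sum>\<psi>\<in>X - {\<phi>\<^sub>0}. \<psi> ubar * R \<psi>)" by (simp add: sum_distrib_left)
      finally show ?thesis by (simp add: \<phi>\<^sub>0u M_def add_divide_distrib)
    qed
    have n1: "norm (complex_of_real (farey_moment 2 B u k Q) - of_real T) \<le> 64 * real Q powr (1 + \<theta>)"
    proof -
      have "norm (complex_of_real (farey_moment 2 B u k Q) - of_real T) = \<bar>farey_moment 2 B u k Q - T\<bar>"
        by (simp only: of_real_diff[symmetric] norm_of_real)
      also have "\<dots> \<le> 64 * real Q powr (3 / 2)"
        using farey_moment_2_approx[of Q B u k] Q unfolding T_def w_def by simp
      \<comment> \<open>The bound \<open>1 / 2 \<le> \<theta>\<close> absorbs the error of counting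
        coprime residues.\<close>
      also have "\<dots> \<le> 64 * real Q powr (1 + \<theta>)" using Q \<theta> by (intro mult_left_mono powr_mono) auto
      finally show ?thesis .
    qed
    have n2: "norm ((\<Sum>\<psi>\<in>X. \<psi> ubar * S \<psi> Q) / \<phi> - (\<Sum>\<psi>\<in>X. \<psi> ubar * M \<psi> Q) / \<phi>)
        \<le> (\<Sum>\<psi>\<in>X. \<bar>Cf \<psi>\<bar>) * real Q powr (1 + \<theta>)"
    proof -
      have "norm ((\<Sum>\<psi>\<in>X. \<psi> ubar * S \<psi> Q) / \<phi> - (\<Sum>\<psi>\<in>X. \<psi> ubar * M \<psi> Q) / \<phi>)
          = norm (\<Sum>\<psi>\<in>X. \<psi> ubar * (S \<psi> Q - M \<psi> Q)) / norm \<phi>"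
        by (simp add: right_diff_distrib sum_subtractf norm_divide flip: diff_divide_distrib)
      also have "\<dots> \<le> norm (\<Sum>\<psi>\<in>X. \<psi> ubar * (S \<psi> Q - M \<psi> Q)) / 1"
        using \<phi> by (intro divide_left_mono) auto
      also have "\<dots> \<le> (\<Sum>\<psi>\<in>X. \<bar>Cf \<psi>\<bar> * real Q powr (1 + \<theta>))"
        unfolding div_by_1
      proof (rule sum_norm_le)
        fix \<psi> assume \<psi>: "\<psi> \<in> X"
        have "norm (\<psi> ubar * (S \<psi> Q - M \<psi> Q)) \<le> 1 * (Cf \<psi> * real Q powr (1 + \<theta>))"
          unfolding norm_mult using \<psi> Q norm_character[OF k, of \<psi> ubar]
          by (intro mult_mono Cf) (auto simp: X_def)
        also have "\<dots> \<le> \<bar>Cf \<psi>\<bar> * real Q powr (1 + \<theta>)" by (simp add: mult_right_mono)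
        finally show "norm (\<psi> ubar * (S \<psi> Q - M \<psi> Q)) \<le> \<bar>Cf \<psi>\<bar> * real Q powr (1 + \<theta>)" .
      qed
      finally show ?thesis by (simp add: sum_distrib_right)
    qed
    have "norm (complex_of_real (farey_moment 2 B u k Q) - (\<Sum>\<psi>\<in>X. \<psi> ubar * M \<psi> Q) / \<phi>) \<le> C * real Q powr (1 + \<theta>)"
      using norm_triangle_ineq[of "complex_of_real (farey_moment 2 B u k Q) - of_real T"
        "of_real T - (\<Sum>\<psi>\<in>X. \<psi> ubar * M \<psi> Q) / \<phi>"] n1 n2 unfolding T C_def distrib_right by simp
    also have "\<dots> = C * (real Q powr (1 + \<theta>) * 1)" by simp
    also have "\<dots> \<le> C * (real Q powr (1 + \<theta>) * (ln (real Q))\<^sup>2)"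
    proof (intro mult_left_mono C0)
      \<comment> \<open>The threshold \<open>Q \<ge> 3\<close> exceeds \<open>exp 1\<close>, so the
        logarithmic factor is at least 1.\<close>
      have "exp 1 \<le> real Q" using exp_le Q by linarith
      then have "1 \<le> ln (real Q)" using Q by (simp add: ln_ge_iff)
      then show "1 \<le> (ln (real Q))\<^sup>2" by (rule one_le_power)
    qed auto
    finally show ?thesis unfolding main .
  qed
  have split: "4 * of_nat Q ^ 2 / (\<phi> * z) * a * b * c = 4 * of_nat Q ^ 2 / z * a * b * c / \<phi>" for Q :: nat and z a b c :: complex
    by (simp add: divide_inverse mult_ac)
  have assoc: "x * (a / b * c) = x * a / b * c" for x a b c :: complex by simp
  show ?thesis
    using bound unfolding P_def R_def X_def \<phi>\<^sub>0_def \<phi>_def[symmetric] split assoc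
    by (intro exI[of _ C] allI impI eventually_sequentiallyI[of 3]) blast
qed

end
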